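(* Let $N\ge2$ be even, let $a$ be an integer coprime to $N$, and let $L\ge1$ satisfy $a^L\equiv1\pmod N$. On a chain of $L$ $\mathbb Z_N$-qudits consider $$\mathcal U_x=\bigotimes_{j=1}^LX_j^{a^{j-1}},\qquad \mathcal U_c=\bigotimes_{j=1}^LC_jZ_j .$$ Then there is no left-canonical injective MPS tensor $A$ (of any finite bond dimension, physical dimension $N$) such that for all positive integers $m$ the periodic MPS $|\psi_{mL}\rangle$ is an eigenstate of both $\mathcal U_x^{\otimes m}$ and $\mathcal U_c^{\otimes m}$.
   Context: $X,Z$ are the $N\times N$ unitary shift and clock matrices with $X^N=Z^N=\mathbb 1$, $ZX=e^{2\pi i/N}XZ$. $C$ is the charge-conjugation unitary, $C^2=\mathbb 1$, $CXC^{-1}=X^\dagger$, $CZC^{-1}=Z^\dagger$. Subscript $j$ denotes action on site $j$. An MPS tensor is a tuple $A=(A^s)_{s=1}^d$ of complex $\chi\times\chi$ matrices. The periodic MPS on $M$ sites is $|\psi_M\rangle=\sum_{s_1,\dots,s_M}\mathrm{Tr}(A^{s_1}\cdots A^{s_M})|s_1\dots s_M\rangle$. The transfer channel is $\mathcal E(Y)=\sum_s (A^s)^\dagger Y A^s$. Left-canonical injective means: $\mathcal E(\mathbb 1)=\mathbb 1$; there is a positive definite $\rho$ with $\mathrm{Tr}\,\rho=1$ and $\sum_s A^s\rho (A^s)^\dagger=\rho$; and $1$ is a simple eigenvalue of $\mathcal E$ with all other eigenvalues of modulus strictly less than $1$. "Eigenstate of $\mathcal U$" means $\mathcal U|\psi\rangle=e^{i\theta}|\psi\rangle$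 for some real $\theta$. *)

theory Defs
  imports
    "Jordan_Normal_Form.Schur_Decomposition"
    "HOL-Number_Theory.Cong"
begin

section \<open>Single-site operators\<close>

text \<open>The basis of a site is labelled by \<open>0, \<dots>, N - 1\<close>: shift maps \<open>|k>\<close> to
  \<open>|k + 1 mod N>\<close>, clock is diagonal, charge conjugation maps \<open>|k>\<close> to \<open>|- k mod N>\<close>.\<close>

definition shift_mat :: "nat \<Rightarrow> complex mat" where
  "shift_mat N = mat N N (\<lambda>(i, j). if i = (j + 1) mod N then 1 else 0)"

definition clock_mat :: "nat \<Rightarrow> complex mat" where
  "clock_mat N = mat N N (\<lambda>(i, j). if i = j then cis (2 * pi * real i / real N) else 0)"

definition charge_mat :: "nat \<Rightarrow> complex mat" where
  "charge_mat N = mat N N (\<lambda>(i, j). if (i + j) mod N = 0 then 1 else 0)"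

text \<open>Integer powers of a unitary matrix, whose inverse is its adjoint.\<close>

definition unitary_powi :: "complex mat \<Rightarrow> int \<Rightarrow> complex mat" where
  "unitary_powi U k =
     (if k \<ge> 0 then U ^\<^sub>m nat k else mat_adjoint U ^\<^sub>m nat (- k))"

section \<open>Many-body states and operators\<close>

text \<open>A vector of the \<open>M\<close>-site Hilbert space is given by its amplitudes on the configurations
  \<open>[s\<^sub>1, \<dots>, s\<^sub>M]\<close>, an operator by its matrix elements between configurations; values elsewhere
  are irrelevant.\<close>

type_synonym many_body_state = "nat list \<Rightarrow> complex"
type_synonym many_body_op = "nat list \<Rightarrow> nat list \<Rightarrow> complex"

definition configs :: "nat \<Rightarrow> nat \<Rightarrow> nat list set" where
  "configs d M = {s. length s = M \<and> set s \<subseteq> {..<d}}"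

definition apply_op :: "nat \<Rightarrow> nat \<Rightarrow> many_body_op \<Rightarrow> many_body_state \<Rightarrow> many_body_state" where
  "apply_op d M K \<psi> = (\<lambda>s. \<Sum>t\<in>configs d M. K s t * \<psi> t)"

definition eigenstate :: "nat \<Rightarrow> nat \<Rightarrow> many_body_op \<Rightarrow> many_body_state \<Rightarrow> bool" where
  "eigenstate d M K \<psi> \<longleftrightarrow>
     (\<exists>\<theta>::real. \<forall>s\<in>configs d M. apply_op d M K \<psi> s = cis \<theta> * \<psi> s)"

definition site_tensor :: "complex mat list \<Rightarrow> many_body_op" where
  "site_tensor Os = (\<lambda>s t. \<Prod>j<length Os. (Os ! j) $$ (s ! j, t ! j))"

text \<open>\<open>K\<^sup>\<otimes>\<^sup>m\<close> for an operator \<open>K\<close> on \<open>L\<close> sites; block number \<open>b\<close> consists of the sites with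
  (zero-based) positions \<open>b L, \<dots>, b L + L - 1\<close>.\<close>

definition tensor_power :: "nat \<Rightarrow> nat \<Rightarrow> many_body_op \<Rightarrow> many_body_op" where
  "tensor_power L m K =
     (\<lambda>s t. \<Prod>b<m. K (take L (drop (b * L) s)) (take L (drop (b * L) t)))"

definition U_x :: "nat \<Rightarrow> nat \<Rightarrow> int \<Rightarrow> many_body_op" where
  "U_x N L a = site_tensor (map (\<lambda>j. unitary_powi (shift_mat N) (a ^ (j - 1))) [1..<L + 1])"

definition U_c :: "nat \<Rightarrow> nat \<Rightarrow> many_body_op" where
  "U_c N L = site_tensor (replicate L (charge_mat N * clock_mat N))"

section \<open>Matrix product states\<close>

text \<open>An MPS tensor of physical dimension \<open>d\<close> and bond dimension \<open>\<chi>\<close> is a family \<open>A\<close> with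
  \<open>A s \<in> carrier_mat \<chi> \<chi>\<close> for \<open>s < d\<close>.\<close>

definition mat_trace :: "complex mat \<Rightarrow> complex" where
  "mat_trace A = (\<Sum>i<dim_row A. A $$ (i, i))"

definition mps :: "nat \<Rightarrow> (nat \<Rightarrow> complex mat) \<Rightarrow> many_body_state" where
  "mps \<chi> A = (\<lambda>s. mat_trace (foldr (\<lambda>k B. A k * B) s (1\<^sub>m \<chi>)))"

definition mat_sum :: "nat \<Rightarrow> nat \<Rightarrow> (nat \<Rightarrow> complex mat) \<Rightarrow> complex mat" where
  "mat_sum \<chi> d F = mat \<chi> \<chi> (\<lambda>(i, j). \<Sum>s<d. F s $$ (i, j))"

definition transfer :: "nat \<Rightarrow> nat \<Rightarrow> (nat \<Rightarrow> complex mat) \<Rightarrow> complex mat \<Rightarrow> complex mat" where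
  "transfer d \<chi> A Y = mat_sum \<chi> d (\<lambda>s. mat_adjoint (A s) * Y * A s)"

text \<open>The matrix of a linear map on \<open>\<chi> \<times> \<chi>\<close> matrices with respect to the matrix units
  \<open>E\<^sub>k\<^sub>l\<close>, where \<open>(k, l)\<close> is encoded as \<open>k \<chi> + l\<close>.\<close>

definition mat_unit :: "nat \<Rightarrow> nat \<Rightarrow> nat \<Rightarrow> complex mat" where
  "mat_unit \<chi> k l = mat \<chi> \<chi> (\<lambda>(i, j). if i = k \<and> j = l then 1 else 0)"

definition superop_mat :: "nat \<Rightarrow> (complex mat \<Rightarrow> complex mat) \<Rightarrow> complex mat" where
  "superop_mat \<chi> F = mat (\<chi> * \<chi>) (\<chi> * \<chi>)
     (\<lambda>(p, q). F (mat_unit \<chi> (q div \<chi>) (q mod \<chi>)) $$ (p div \<chi>, p mod \<chi>))"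

text \<open>The strict order on complex numbers used here entails that the quadratic form is real.\<close>

definition positive_definite :: "nat \<Rightarrow> complex mat \<Rightarrow> bool" where
  "positive_definite n R \<longleftrightarrow> R \<in> carrier_mat n n \<and> mat_adjoint R = R \<and>
     (\<forall>v\<in>carrier_vec n. v \<noteq> 0\<^sub>v n \<longrightarrow> (R *\<^sub>v v) \<bullet>c v > 0)"

text \<open>A simple eigenvalue is one of algebraic multiplicity one. The condition
  \<open>mat_trace R = 1\<close> excludes \<open>\<chi> = 0\<close>.\<close>

definition left_canonical_injective :: "nat \<Rightarrow> nat \<Rightarrow> (nat \<Rightarrow> complex mat) \<Rightarrow> bool" where
  "left_canonical_injective d \<chi> A \<longleftrightarrow>
     (\<forall>s<d. A s \<in> carrier_mat \<chi> \<chi>) \<and>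
     transfer d \<chi> A (1\<^sub>m \<chi>) = 1\<^sub>m \<chi> \<and>
     (\<exists>R. positive_definite \<chi> R \<and> mat_trace R = 1 \<and>
          mat_sum \<chi> d (\<lambda>s. A s * R * mat_adjoint (A s)) = R) \<and>
     Polynomial.order 1 (char_poly (superop_mat \<chi> (transfer d \<chi> A))) = 1 \<and>
     (\<forall>\<mu>. eigenvalue (superop_mat \<chi> (transfer d \<chi> A)) \<mu> \<longrightarrow> \<mu> \<noteq> 1 \<longrightarrow> cmod \<mu> < 1)"

section \<open>Relations between shift, clock and charge conjugation\<close>

lemma site_mat_carrier [simp]:
  "shift_mat N \<in> carrier_mat N N" "clock_mat N \<in> carrier_mat N N" "charge_mat N \<in> carrier_mat N N"
  by (auto simp: shift_mat_def clock_mat_def charge_mat_def)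

lemma site_mat_dim [simp]:
  "dim_row (shift_mat N) = N" "dim_col (shift_mat N) = N"
  "dim_row (clock_mat N) = N" "dim_col (clock_mat N) = N"
  "dim_row (charge_mat N) = N" "dim_col (charge_mat N) = N"
  by (auto simp: shift_mat_def clock_mat_def charge_mat_def)

lemma mat_adjoint_index:
  assumes "A \<in> carrier_mat n m" "i < m" "j < n"
  shows "mat_adjoint A $$ (i, j) = cnj (A $$ (j, i))"
  using assms by (auto simp: mat_adjoint_def mat_of_rows_index)

lemma mat_adjoint_carrier [simp]:
  assumes "A \<in> carrier_mat n m"
  shows "mat_adjoint A \<in> carrier_mat m n"
  using assms by (auto simp: mat_adjoint_def)

lemma clock_shift:
  assumes "N > 0"
  shows "clock_mat N * shift_mat N = cis (2 * pi / real N) \<cdot>\<^sub>m (shift_mat N * clock_mat N)"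
proof (rule eq_matI)
  fix i j assume "i < dim_row (cis (2 * pi / real N) \<cdot>\<^sub>m (shift_mat N * clock_mat N))"
    and "j < dim_col (cis (2 * pi / real N) \<cdot>\<^sub>m (shift_mat N * clock_mat N))"
  hence ij: "i < N" "j < N" by (auto simp: shift_mat_def clock_mat_def)
  let ?z = "\<lambda>i. cis (2 * pi * real i / real N)"
  have l: "(clock_mat N * shift_mat N) $$ (i, j) = (if i = (j + 1) mod N then ?z i else 0)"
    using ij by (simp add: clock_mat_def shift_mat_def scalar_prod_def if_distrib[of "\<lambda>x. x * _"] 
        cong: if_cong)
  have r: "(shift_mat N * clock_mat N) $$ (i, j) = (if i = (j + 1) mod N then ?z j else 0)"
    using ij by (simp add: clock_mat_def shift_mat_def scalar_prod_def if_distrib[of "\<lambda>x. _ * x"] 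
        cong: if_cong)
  have z: "?z ((j + 1) mod N) = cis (2 * pi / real N) * ?z j"
  proof (cases "j + 1 = N")
    case True
    have "cis (2 * pi / real N) * ?z j = cis (2 * pi * real (j + 1) / real N)"
      by (simp add: cis_mult add_divide_distrib algebra_simps)
    also have "\<dots> = 1" unfolding True using assms by simp
    finally show ?thesis using True by simp
  next
    case False
    with ij have "(j + 1) mod N = j + 1" by simp
    thus ?thesis by (simp add: cis_mult add_divide_distrib algebra_simps)
  qed
  show "(clock_mat N * shift_mat N) $$ (i, j) =
      (cis (2 * pi / real N) \<cdot>\<^sub>m (shift_mat N * clock_mat N)) $$ (i, j)"
    using ij z r by (simp add: l del: index_mult_mat(1))
qed (auto simp: shift_mat_def clock_mat_def)

lemma charge_index:
  assumes "i < N" "j < N"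
  shows "charge_mat N $$ (i, j) = (if j = (N - i) mod N then 1 else 0)"
    and "charge_mat N $$ (i, j) = (if i = (N - j) mod N then 1 else 0)"
proof -
  have *: "(i + j) mod N = 0 \<longleftrightarrow> j = (N - i) mod N" if "i < N" "j < N" for i j
  proof (cases "i = 0")
    case False
    have "(i + j) mod N = (if i + j < N then i + j else i + j - N)"
      using that by (simp add: le_mod_geq)
    thus ?thesis using that False by auto
  qed (use that in auto)
  show "charge_mat N $$ (i, j) = (if j = (N - i) mod N then 1 else 0)"
    using assms *[of i j] by (simp add: charge_mat_def)
  show "charge_mat N $$ (i, j) = (if i = (N - j) mod N then 1 else 0)"
    using assms *[of j i] by (simp add: charge_mat_def add.commute)
qed

lemma mult_charge_index:
  assumes "A \<in> carrier_mat N N" "i < N" "j < N"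
  shows "(A * charge_mat N) $$ (i, j) = A $$ (i, (N - j) mod N)"
    and "(charge_mat N * A) $$ (i, j) = A $$ ((N - i) mod N, j)"
proof -
  have "(A * charge_mat N) $$ (i, j) = (\<Sum>k = 0..<N. A $$ (i, k) * charge_mat N $$ (k, j))"
    using assms by (simp add: scalar_prod_def)
  also have "\<dots> = (\<Sum>k = 0..<N. if k = (N - j) mod N then A $$ (i, k) else 0)"
    by (rule sum.cong) (use assms in \<open>auto simp: charge_index(2)\<close>)
  also have "\<dots> = A $$ (i, (N - j) mod N)"
    using assms by (subst sum.delta) auto
  finally show "(A * charge_mat N) $$ (i, j) = A $$ (i, (N - j) mod N)" .
  have "(charge_mat N * A) $$ (i, j) = (\<Sum>k = 0..<N. charge_mat N $$ (i, k) * A $$ (k, j))"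
    using assms by (simp add: scalar_prod_def)
  also have "\<dots> = (\<Sum>k = 0..<N. if k = (N - i) mod N then A $$ (k, j) else 0)"
    by (rule sum.cong) (use assms in \<open>auto simp: charge_index(1)\<close>)
  also have "\<dots> = A $$ ((N - i) mod N, j)"
    using assms by (subst sum.delta) auto
  finally show "(charge_mat N * A) $$ (i, j) = A $$ ((N - i) mod N, j)" .
qed

lemma neg_mod_neg: "(N - (N - i) mod N) mod N = i" if "i < N" for i N :: nat
  using that by (cases "i = 0") auto

lemma charge_charge: "charge_mat N * charge_mat N = 1\<^sub>m N"
proof (rule eq_matI)
  fix i j assume "i < dim_row (1\<^sub>m N :: complex mat)" "j < dim_col (1\<^sub>m N :: complex mat)"
  hence ij: "i < N" "j < N" by auto
  have m: "(N - i) mod N < N" using ij by simp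
  show "(charge_mat N * charge_mat N) $$ (i, j) = 1\<^sub>m N $$ (i, j)"
    unfolding mult_charge_index(2)[OF site_mat_carrier(3) ij] charge_index(1)[OF m ij(2)]
      neg_mod_neg[OF ij(1)] using ij by auto
qed (auto simp: charge_mat_def)

lemma charge_shift: "charge_mat N * shift_mat N * charge_mat N = mat_adjoint (shift_mat N)"
proof (rule eq_matI)
  note c = site_mat_carrier[of N]
  fix i j assume "i < dim_row (mat_adjoint (shift_mat N))" "j < dim_col (mat_adjoint (shift_mat N))"
  hence ij: "i < N" "j < N" using mat_adjoint_carrier[OF c(1)] by auto
  have m: "(N - j) mod N < N" using ij by simp
  have n: "(N - k) mod N = (if k = 0 then 0 else N - k)" if "k < N" for k
    using that by simp
  have s: "(k + 1) mod N = (if k + 1 = N then 0 else k + 1)" if "k < N" for k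
    using that by auto
  have "(N - i) mod N = ((N - j) mod N + 1) mod N \<longleftrightarrow> j = (i + 1) mod N"
    using ij by (subst s[OF m], subst s[OF ij(1)], subst n[OF ij(1)], (subst n[OF ij(2)])+) (auto split: if_splits)
  thus "(charge_mat N * shift_mat N * charge_mat N) $$ (i, j) = mat_adjoint (shift_mat N) $$ (i, j)"
    unfolding mult_charge_index(1)[OF mult_carrier_mat[OF c(3) c(1)] ij]
      mult_charge_index(2)[OF c(1) ij(1) m] mat_adjoint_index[OF c(1) ij]
    using ij m by (auto simp: shift_mat_def)
qed (auto simp: charge_mat_def shift_mat_def mat_adjoint_def)

lemma charge_clock: "charge_mat N * clock_mat N * charge_mat N = mat_adjoint (clock_mat N)"
proof (rule eq_matI)
  note c = site_mat_carrier[of N]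
  fix i j assume "i < dim_row (mat_adjoint (clock_mat N))" "j < dim_col (mat_adjoint (clock_mat N))"
  hence ij: "i < N" "j < N" using mat_adjoint_carrier[OF c(2)] by auto
  have m: "(N - j) mod N < N" using ij by simp
  have 1: "(N - i) mod N = (N - j) mod N \<longleftrightarrow> i = j"
    by (metis neg_mod_neg[OF ij(1)] neg_mod_neg[OF ij(2)])
  have 2: "cis (2 * pi * real ((N - i) mod N) / real N) = cnj (cis (2 * pi * real i / real N))"
  proof (cases "i = 0")
    case False
    have "2 * pi * real (N - i) / real N = 2 * pi + - (2 * pi * real i / real N)"
      using ij by (simp add: of_nat_diff field_simps)
    hence "cis (2 * pi * real (N - i) / real N) = cis (2 * pi) * cis (- (2 * pi * real i / real N))"
      by (simp only: cis_mult)
    thus ?thesis using False ij by (simp add: cis_cnj)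
  qed simp
  show "(charge_mat N * clock_mat N * charge_mat N) $$ (i, j) = mat_adjoint (clock_mat N) $$ (i, j)"
    unfolding mult_charge_index(1)[OF mult_carrier_mat[OF c(3) c(2)] ij]
      mult_charge_index(2)[OF c(2) ij(1) m] mat_adjoint_index[OF c(2) ij]
    using ij m 1 2 by (cases "i = j") (simp_all add: clock_mat_def)
qed (auto simp: charge_mat_def clock_mat_def mat_adjoint_def)

end

theory Submission
  imports Defs
begin

text \<open>An MPS symmetry acts on the virtual level by a projective unitary. For the clock-type symmetry
  this is a single \<open>W\<close>, for the shift-type symmetry a family \<open>V\<^sub>n\<close> on the bonds, with
  \<open>V\<^sub>n A\<^sup>s\<^sup>-\<^sup>k = A\<^sup>s V\<^sub>n\<^sub>+\<^sub>1\<close> for \<open>k = a\<^sup>n\<close>. Such unitaries come from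
  eigenvectors of modulus one of mixed transfer channels, which exist since the norms of the
  periodic states converge to one, and which intertwine because the mixed channel is a contraction
  in the norm weighted by the fixed point. Injectivity makes a sequence of matrices that
  commutes with the tensor up to a step along the chain a constant scalar. This gives
  \<open>V\<^sub>n\<^sub>+\<^sub>1 = c V\<^sub>n\<^sup>a\<close> and \<open>V\<^sub>n\<^sup>N = g\<close>, and \<open>V\<^sub>n W V\<^sub>n W\<^sup>\<dagger>\<close> is a scalar \<open>l\<^sub>n\<close> with
  \<open>l\<^sub>1 = \<omega> l\<^sub>0\<close>, where \<open>\<omega> = exp (2 \<pi> i / N)\<close>. Hence \<open>\<omega> l\<^sub>0 = c\<^sup>2 l\<^sub>0\<^sup>a\<close>, \<open>l\<^sub>0\<^sup>N = g\<^sup>2\<close> and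
  \<open>g = c\<^sup>N g\<^sup>a\<close>; as \<open>a\<close> is odd, the power \<open>N / 2\<close> of the first equation reads \<open>-1 = 1\<close>.\<close>

section \<open>Spectral facts\<close>

text \<open>The operators of the shift symmetry change from site to site while the tensor does not.
  Blocking \<open>L\<close> sites would keep the virtual unitaries only at the block ends and lose
  the relation between neighbours, so the whole family \<open>V n\<close> is kept. Since
  \<open>a * a ^ n = a ^ (n + 1)\<close>, the power \<open>V n ^ a\<close> and
  \<open>V (n + 1)\<close> implement the same shift, which forces them to be proportional. Charge
  conjugation negates labels. This is why \<open>V W V\<close> times the adjoint of \<open>W\<close>
  takes the place of a commutator: the label shifts caused by the two factors \<open>V\<close>
  cancel, and the clock phase left over depends on the site but not on the label. From site 0 to
  site 1 its exponent is \<open>a ^ 0 = 1\<close>, hence the factor omega. The power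
  \<open>N / 2\<close> is chosen because there the unknown scalars occur only through
  \<open>c ^ N\<close> and \<open>l ^ N\<close>, both tied to \<open>g\<close>. The norm needs a
  weight because the transfer map fixes the identity but may fail to preserve the trace; with the
  fixed point of the dual map as weight, one step becomes an isometry followed by a
  projection.\<close>

lemma mult_upper_triangular:
  fixes A B :: "complex mat"
  assumes "A \<in> carrier_mat n n" "B \<in> carrier_mat n n" "upper_triangular A" "upper_triangular B"
  shows "upper_triangular (A * B)"
    and "i < n \<Longrightarrow> (A * B) $$ (i, i) = A $$ (i, i) * B $$ (i, i)"
proof -
  have e: "(A * B) $$ (i, j) = (\<Sum>k<n. A $$ (i, k) * B $$ (k, j))" if "i < n" "j < n" for i j
    using assms that by (simp add: scalar_prod_def lessThan_atLeast0)
  have z: "A $$ (i, k) * B $$ (k, j) = 0" if "i < n" "k < n" "k < i \<or> j < k" for i j k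
    using that(3)
  proof
    assume "k < i"
    thus ?thesis using upper_triangularD[OF assms(3), of k i] assms that by simp
  next
    assume "j < k"
    thus ?thesis using upper_triangularD[OF assms(4), of j k] assms that by simp
  qed
  show "upper_triangular (A * B)"
  proof
    fix i j assume "j < i" "i < dim_row (A * B)"
    hence ij: "j < i" "i < n" using assms by auto
    show "(A * B) $$ (i, j) = 0"
      using ij z[of i _ j] by (subst e) (auto intro!: sum.neutral, metis not_less order_less_le_trans)
  qed
  assume i: "i < n"
  have "(\<Sum>k<n. A $$ (i, k) * B $$ (k, i)) = (\<Sum>k<n. if k = i then A $$ (i, i) * B $$ (i, i) else 0)"
    by (rule sum.cong) (use z[of i _ i] i in \<open>auto, metis nat_neq_iff\<close>)
  thus "(A * B) $$ (i, i) = A $$ (i, i) * B $$ (i, i)" using i by (simp add: e)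
qed

lemma pow_upper_triangular:
  fixes A :: "complex mat"
  assumes "A \<in> carrier_mat n n" "upper_triangular A"
  shows "upper_triangular (A ^\<^sub>m k)"
    and "i < n \<Longrightarrow> (A ^\<^sub>m k) $$ (i, i) = A $$ (i, i) ^ k"
proof -
  have "upper_triangular (A ^\<^sub>m k) \<and> (\<forall>i<n. (A ^\<^sub>m k) $$ (i, i) = A $$ (i, i) ^ k)"
  proof (induction k)
    case (Suc k)
    thus ?case using assms mult_upper_triangular[of "A ^\<^sub>m k" n A] by auto
  qed (use assms in auto)
  thus "upper_triangular (A ^\<^sub>m k)" "i < n \<Longrightarrow> (A ^\<^sub>m k) $$ (i, i) = A $$ (i, i) ^ k" by auto
qed

section \<open>Traces of matrix powers as power sums of eigenvalues\<close>

lemma mat_trace_eq: "A \<in> carrier_mat n n \<Longrightarrow> mat_trace A = (\<Sum>i<n. A $$ (i, i))"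
  by (auto simp: mat_trace_def)

lemma mat_trace_comm:
  assumes "A \<in> carrier_mat n m" "B \<in> carrier_mat m n"
  shows "mat_trace (A * B) = mat_trace (B * A)"
proof -
  have "mat_trace (A * B) = (\<Sum>i<n. \<Sum>k<m. A $$ (i, k) * B $$ (k, i))"
    using assms by (simp add: mat_trace_def scalar_prod_def lessThan_atLeast0)
  also have "\<dots> = (\<Sum>k<m. \<Sum>i<n. B $$ (k, i) * A $$ (i, k))"
    by (subst sum.swap) (simp add: mult.commute)
  also have "\<dots> = mat_trace (B * A)"
    using assms by (simp add: mat_trace_def scalar_prod_def lessThan_atLeast0)
  finally show ?thesis .
qed

lemma mult_mat_vec_index_sum:
  assumes "A \<in> carrier_mat n n" "v \<in> carrier_vec n" "i < n"
  shows "(A *\<^sub>v v) $ i = (\<Sum>j<n. A $$ (i, j) * v $ j)"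
  using assms by (simp add: scalar_prod_def lessThan_atLeast0)

text \<open>The list \<open>es\<close> may come in any order, and Schur decomposition places it on
  the diagonal in that order. This freedom later puts the eigenvalue 1 into the top left
  corner.\<close>

lemma schur_triangularization:
  fixes S :: "complex mat"
  assumes "S \<in> carrier_mat n n" "char_poly S = (\<Prod>e\<leftarrow>es. [:- e, 1:])"
  obtains T P Q where "similar_mat_wit S T P Q" "upper_triangular T" "diag_mat T = es"
  using schur_decomposition[OF assms] by (metis prod_cases3)

lemma mat_trace_pow:
  fixes S :: "complex mat"
  assumes S: "S \<in> carrier_mat n n" and c: "char_poly S = (\<Prod>e\<leftarrow>es. [:- e, 1:])"
  shows "mat_trace (S ^\<^sub>m m) = (\<Sum>e\<leftarrow>es. e ^ m)"
proof -
  obtain T P Q where w: "similar_mat_wit S T P Q" and u: "upper_triangular T" and d: "diag_mat T = es"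
    using schur_triangularization[OF assms] .
  note k = similar_mat_witD2[OF S w]
  have "mat_trace (S ^\<^sub>m m) = mat_trace (P * (T ^\<^sub>m m * Q))"
    unfolding similar_mat_wit_pow_id[OF w] by (subst assoc_mult_mat) (use k in auto)
  also have "\<dots> = mat_trace (T ^\<^sub>m m * Q * P)"
    by (rule mat_trace_comm) (use k in auto)
  also have "\<dots> = mat_trace (T ^\<^sub>m m)"
    using k by (simp add: assoc_mult_mat[of "T ^\<^sub>m m" n n Q n P n])
  also have "\<dots> = (\<Sum>i<n. T $$ (i, i) ^ m)"
    using k(5) u pow_upper_triangular(2)[OF k(5) u] by (simp add: mat_trace_def)
  also have "\<dots> = (\<Sum>e\<leftarrow>es. e ^ m)"
    using k(5) unfolding d[symmetric] 
    by (simp add: diag_mat_def comp_def interv_sum_list_conv_sum_set_nat lessThan_atLeast0)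
  finally show ?thesis .
qed

lemma eigenvalue_char_poly_linear_factors:
  fixes S :: "complex mat"
  assumes S: "S \<in> carrier_mat n n" and c: "char_poly S = (\<Prod>e\<leftarrow>es. [:- e, 1:])" 
  shows "eigenvalue S e \<longleftrightarrow> e \<in> set es"
proof -
  have "poly (\<Prod>e\<leftarrow>es. [:- e, 1:]) e = 0 \<longleftrightarrow> e \<in> set es" for es :: "complex list"
    by (induction es) auto
  thus ?thesis by (simp add: eigenvalue_root_char_poly[OF S] c)
qed

lemma sum_list_pow_tendsto_0:
  fixes es :: "complex list"
  assumes "\<forall>e\<in>set es. cmod e < 1"
  shows "(\<lambda>m. \<Sum>e\<leftarrow>es. e ^ m) \<longlonglongrightarrow> 0"
  using assms by (induction es) (auto intro!: tendsto_add_zero LIMSEQ_power_zero)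

text \<open>Used backwards: traces of powers that do not tend to zero force an eigenvalue of modulus
  at least one. Overlaps of states thereby yield an eigenvector.\<close>

lemma mat_trace_pow_tendsto_0:
  fixes S :: "complex mat"
  assumes S: "S \<in> carrier_mat n n" and "\<And>e. eigenvalue S e \<Longrightarrow> cmod e < 1"
  shows "(\<lambda>m. mat_trace (S ^\<^sub>m m)) \<longlonglongrightarrow> 0"
proof -
  obtain es where es: "char_poly S = (\<Prod>e\<leftarrow>es. [:- e, 1:])"
    using char_poly_factorized[OF S] by auto
  show ?thesis
    using assms(2) sum_list_pow_tendsto_0
    by (auto simp: mat_trace_pow[OF S es] eigenvalue_char_poly_linear_factors[OF S es])
qed

section \<open>A simple eigenvalue 1 that dominates the spectrum\<close>

lemma order_linear_factors:
  "Polynomial.order x (\<Prod>e\<leftarrow>es. [:- e, 1:]) = count_list es (x :: complex)"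
proof (induction es)
  case (Cons e es)
  have "(\<Prod>e\<leftarrow>es. [:- e, 1:]) \<noteq> 0" by (auto simp: prod_list_zero_iff)
  thus ?case using Cons by (simp add: order_mult order_linear' del: mult_pCons_left)
qed auto

lemma simple_eigenvalue_factorization:
  fixes S :: "complex mat"
  assumes S: "S \<in> carrier_mat n n" and o: "Polynomial.order 1 (char_poly S) = 1"
    and e: "\<And>e. eigenvalue S e \<Longrightarrow> e \<noteq> 1 \<Longrightarrow> cmod e < 1"
  obtains es where "char_poly S = (\<Prod>e\<leftarrow>1 # es. [:- e, 1:])" "\<forall>e\<in>set es. cmod e < 1"
proof -
  obtain es where es: "char_poly S = (\<Prod>e\<leftarrow>es. [:- e, 1:])"
    using char_poly_factorized[OF S] by auto
  hence "count_list es 1 = 1" using o by (simp add: order_linear_factors)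
  then obtain xs ys where xs: "es = xs @ 1 # ys" 
    by (metis count_list_0_iff One_nat_def split_list zero_neq_one)
  with \<open>count_list es 1 = 1\<close> have "1 \<notin> set (xs @ ys)" by (simp add: count_list_0_iff[symmetric])
  moreover have "char_poly S = (\<Prod>e\<leftarrow>1 # (xs @ ys). [:- e, 1:])" by (simp add: es xs mult.left_commute del: mult_pCons_left mult_pCons_right)
  moreover have "e \<in> set (xs @ ys) \<Longrightarrow> eigenvalue S e" for e
    using xs by (auto simp: eigenvalue_char_poly_linear_factors[OF S es])
  ultimately show ?thesis using that[of "xs @ ys"] e by metis
qed

lemma mat_trace_pow_tendsto_1:
  fixes S :: "complex mat"
  assumes S: "S \<in> carrier_mat n n" and "Polynomial.order 1 (char_poly S) = 1"
    and "\<And>e. eigenvalue S e \<Longrightarrow> e \<noteq> 1 \<Longrightarrow> cmod e < 1"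
  shows "(\<lambda>m. mat_trace (S ^\<^sub>m m)) \<longlonglongrightarrow> 1"
proof -
  obtain es where es: "char_poly S = (\<Prod>e\<leftarrow>1 # es. [:- e, 1:])" "\<forall>e\<in>set es. cmod e < 1"
    using simple_eigenvalue_factorization[OF assms] .
  have "(\<lambda>m. 1 + (\<Sum>e\<leftarrow>es. e ^ m)) \<longlonglongrightarrow> 1 + 0"
    by (intro tendsto_intros sum_list_pow_tendsto_0 es)
  thus ?thesis by (simp add: mat_trace_pow[OF S es(1)])
qed

text \<open>In a triangular form that begins with 1, the other diagonal entries of every positive
  power lie strictly inside the unit disc, so a peripheral eigenvector has only a first coordinate.
  One \<open>v\<close> thus serves all \<open>k\<close> and \<open>\<mu>\<close> at once; powers
  matter because the chains below close up only after \<open>L\<close> steps, and then only up to a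
  phase.\<close>

lemma peripheral_eigenvectors_parallel:
  fixes S :: "complex mat"
  assumes S: "S \<in> carrier_mat n n" and "Polynomial.order 1 (char_poly S) = 1"
    and "\<And>e. eigenvalue S e \<Longrightarrow> e \<noteq> 1 \<Longrightarrow> cmod e < 1"
  obtains v where "v \<in> carrier_vec n"
    "\<And>y k \<mu>. y \<in> carrier_vec n \<Longrightarrow> S ^\<^sub>m k *\<^sub>v y = \<mu> \<cdot>\<^sub>v y \<Longrightarrow> k > 0 \<Longrightarrow> cmod \<mu> = 1 \<Longrightarrow> \<exists>c. y = c \<cdot>\<^sub>v v"
proof -
  obtain es where es: "char_poly S = (\<Prod>e\<leftarrow>1 # es. [:- e, 1:])" "\<forall>e\<in>set es. cmod e < 1"
    using simple_eigenvalue_factorization[OF assms] .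
  obtain T P Q where w: "similar_mat_wit S T P Q" and u: "upper_triangular T" 
    and d: "diag_mat T = 1 # es"
    using schur_triangularization[OF S es(1)] .
  note k = similar_mat_witD2[OF S w]
  have n: "n = Suc (length es)" using arg_cong[OF d, of length] k(5) by (simp add: diag_mat_def)
  have small: "cmod (T $$ (i, i)) < 1" if "0 < i" "i < n" for i
  proof -
    have "diag_mat T ! i = T $$ (i, i)" using that k(5) by (auto simp: diag_mat_def)
    hence "T $$ (i, i) = es ! (i - 1)" using d that by (simp add: nth_Cons')
    moreover have "i - 1 < length es" using that n by auto
    ultimately show ?thesis using es(2) by auto
  qed
  have par: "\<exists>c. y = c \<cdot>\<^sub>v (P *\<^sub>v unit_vec n 0)"
    if y: "y \<in> carrier_vec n" and ev: "S ^\<^sub>m m *\<^sub>v y = \<mu> \<cdot>\<^sub>v y" and m: "m > 0" and mu: "cmod \<mu> = 1" 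
    for y m \<mu>
  proof -
    define z where "z = Q *\<^sub>v y"
    have z: "z \<in> carrier_vec n" using k y by (auto simp: z_def)
    have Tc: "T ^\<^sub>m m \<in> carrier_mat n n" using k by auto
    have "\<mu> \<cdot>\<^sub>v y = P * T ^\<^sub>m m * Q *\<^sub>v y" using ev similar_mat_wit_pow_id[OF w, of m] by simp
    also have "\<dots> = P *\<^sub>v (T ^\<^sub>m m *\<^sub>v z)"
      unfolding z_def using k(5-7) y Tc mult_mat_vec_carrier[OF k(7) y]
      by (simp add: assoc_mult_mat_vec[of "P * T ^\<^sub>m m" n n Q n y]
        assoc_mult_mat_vec[of P n n "T ^\<^sub>m m" n])
    finally have "Q *\<^sub>v (\<mu> \<cdot>\<^sub>v y) = Q *\<^sub>v (P *\<^sub>v (T ^\<^sub>m m *\<^sub>v z))" by simp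
    also have "\<dots> = (Q * P) *\<^sub>v (T ^\<^sub>m m *\<^sub>v z)"
      by (rule assoc_mult_mat_vec[symmetric]) (use k z Tc mult_mat_vec_carrier[OF Tc z] in auto)
    also have "\<dots> = T ^\<^sub>m m *\<^sub>v z" using k(2) mult_mat_vec_carrier[OF Tc z] by simp
    finally have Tz: "T ^\<^sub>m m *\<^sub>v z = \<mu> \<cdot>\<^sub>v z" using k y by (simp add: z_def mult_mat_vec)
    \<comment> \<open>back substitution: below the first row the diagonal entries of \<open>T\<close> have modulus less than one\<close>
    have "i < n \<longrightarrow> 0 < i \<longrightarrow> z $ i = 0" for i
    proof (induction "n - i" arbitrary: i rule: less_induct)
      case less
      show ?case
      proof (intro impI)
        assume i: "i < n" "0 < i"
        have "\<mu> * z $ i = (T ^\<^sub>m m *\<^sub>v z) $ i" using Tz z i by simp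
        also have "\<dots> = (\<Sum>j<n. (T ^\<^sub>m m) $$ (i, j) * z $ j)"
          by (rule mult_mat_vec_index_sum[OF Tc z i(1)])
        also have "\<dots> = (\<Sum>j<n. if j = i then T $$ (i, i) ^ m * z $ i else 0)"
        proof (rule sum.cong)
          fix j assume j: "j \<in> {..<n}"
          consider "j < i" | "j = i" | "i < j" by linarith
          thus "(T ^\<^sub>m m) $$ (i, j) * z $ j = (if j = i then T $$ (i, i) ^ m * z $ i else 0)"
          proof cases
            case 1
            thus ?thesis using pow_upper_triangular(1)[OF k(5) u, of m] i Tc by auto
          next
            case 2
            thus ?thesis using pow_upper_triangular(2)[OF k(5) u] i by simp
          next
            case 3
            thus ?thesis using less[of j] j i by auto
          qed
        qed simp
        also have "\<dots> = T $$ (i, i) ^ m * z $ i" using i by simp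
        finally have eq: "\<mu> * z $ i = T $$ (i, i) ^ m * z $ i" .
        have "cmod (T $$ (i, i) ^ m) < 1" 
          using small[OF i(2,1)] m by (simp add: norm_power power_less_one_iff)
        hence "\<mu> \<noteq> T $$ (i, i) ^ m" using mu by auto
        thus "z $ i = 0" using eq by simp
      qed
    qed
    hence zz: "z = z $ 0 \<cdot>\<^sub>v unit_vec n 0" using z n by (intro eq_vecI) (auto simp: unit_vec_def)
    have "y = P *\<^sub>v z" using k y by (simp add: z_def assoc_mult_mat_vec[symmetric, of P n n])
    also have "\<dots> = z $ 0 \<cdot>\<^sub>v (P *\<^sub>v unit_vec n 0)" 
      by (subst zz) (use k in \<open>auto intro!: mult_mat_vec\<close>)
    finally show ?thesis by blast
  qed
  show ?thesis using that[of "P *\<^sub>v unit_vec n 0"] par k by auto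
qed

section \<open>Matrices of superoperators\<close>

lemma mult_add_less_square:
  fixes k l n :: nat
  assumes "k < n" "l < n"
  shows "k * n + l < n * n"
proof -
  have "k * n + l < Suc k * n" using assms by simp
  also have "\<dots> \<le> n * n" using assms by (intro mult_right_mono) auto
  finally show ?thesis .
qed

lemma sum_div_mod:
  fixes f :: "nat \<Rightarrow> nat \<Rightarrow> complex"
  shows "(\<Sum>p<n * n. f (p div n) (p mod n)) = (\<Sum>k<n. \<Sum>l<n. f k l)"
proof (cases "n = 0")
  case False
  have "(\<Sum>k<n. \<Sum>l<n. f k l) = (\<Sum>(k, l)\<in>{..<n} \<times> {..<n}. f k l)"
    by (simp add: sum.cartesian_product)
  also have "\<dots> = (\<Sum>p<n * n. f (p div n) (p mod n))"
    by (rule sum.reindex_bij_witness[of _ "\<lambda>p. (p div n, p mod n)" "\<lambda>(k, l). k * n + l"])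
      (use False in \<open>auto simp: mult_add_less_square less_mult_imp_div_less\<close>)
  finally show ?thesis ..
qed auto

text \<open>Linearity is encoded as expansion in matrix units, the form in which entries of
  \<open>superop_mat\<close> and of compositions are computed.\<close>

definition linear_superop :: "nat \<Rightarrow> (complex mat \<Rightarrow> complex mat) \<Rightarrow> bool" where
  "linear_superop \<chi> G \<longleftrightarrow> (\<forall>Y\<in>carrier_mat \<chi> \<chi>. G Y \<in> carrier_mat \<chi> \<chi> \<and>
     (\<forall>i<\<chi>. \<forall>j<\<chi>. G Y $$ (i, j) = (\<Sum>k<\<chi>. \<Sum>l<\<chi>. Y $$ (k, l) * G (mat_unit \<chi> k l) $$ (i, j))))"

lemma linear_superop_index:
  assumes "linear_superop \<chi> G" "Y \<in> carrier_mat \<chi> \<chi>" "i < \<chi>" "j < \<chi>"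
  shows "G Y $$ (i, j) = (\<Sum>k<\<chi>. \<Sum>l<\<chi>. Y $$ (k, l) * G (mat_unit \<chi> k l) $$ (i, j))"
  using assms unfolding linear_superop_def by blast

lemma linear_superop_carrier:
  "linear_superop \<chi> G \<Longrightarrow> Y \<in> carrier_mat \<chi> \<chi> \<Longrightarrow> G Y \<in> carrier_mat \<chi> \<chi>"
  by (simp add: linear_superop_def)

lemma mat_unit_carrier [simp]: "mat_unit \<chi> k l \<in> carrier_mat \<chi> \<chi>"
  by (simp add: mat_unit_def)

lemma superop_mat_carrier [simp]: "superop_mat \<chi> G \<in> carrier_mat (\<chi> * \<chi>) (\<chi> * \<chi>)"
  by (simp add: superop_mat_def)

text \<open>Row by row flattening, matching the encoding of index pairs in
  \<open>superop_mat\<close>.\<close>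

definition vec_of_mat :: "nat \<Rightarrow> complex mat \<Rightarrow> complex vec" where
  "vec_of_mat \<chi> Y = vec (\<chi> * \<chi>) (\<lambda>p. Y $$ (p div \<chi>, p mod \<chi>))"

lemma vec_of_mat_carrier [simp]: "vec_of_mat \<chi> Y \<in> carrier_vec (\<chi> * \<chi>)"
  by (simp add: vec_of_mat_def)

lemma div_mod_less: "p < n * n \<Longrightarrow> p div n < n \<and> p mod n < n" for p n :: nat
  by (cases "n = 0") (auto simp: less_mult_imp_div_less)

lemma vec_of_mat_inject:
  assumes "X \<in> carrier_mat \<chi> \<chi>" "Y \<in> carrier_mat \<chi> \<chi>" "vec_of_mat \<chi> X = vec_of_mat \<chi> Y"
  shows "X = Y"
proof (rule eq_matI)
  fix k l assume "k < dim_row Y" "l < dim_col Y"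
  hence kl: "k < \<chi>" "l < \<chi>" using assms by auto
  have "vec_of_mat \<chi> X $ (k * \<chi> + l) = vec_of_mat \<chi> Y $ (k * \<chi> + l)" using assms by simp
  thus "X $$ (k, l) = Y $$ (k, l)" using kl mult_add_less_square[OF kl] by (simp add: vec_of_mat_def)
qed (use assms in auto)

lemma vec_of_mat_smult:
  assumes "Y \<in> carrier_mat \<chi> \<chi>"
  shows "vec_of_mat \<chi> (c \<cdot>\<^sub>m Y) = c \<cdot>\<^sub>v vec_of_mat \<chi> Y"
  using assms by (intro eq_vecI) (auto simp: vec_of_mat_def div_mod_less)

lemma superop_mat_mult_vec:
  assumes "linear_superop \<chi> G" "Y \<in> carrier_mat \<chi> \<chi>"
  shows "superop_mat \<chi> G *\<^sub>v vec_of_mat \<chi> Y = vec_of_mat \<chi> (G Y)"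
proof (rule eq_vecI)
  fix p assume "p < dim_vec (vec_of_mat \<chi> (G Y))"
  hence p: "p < \<chi> * \<chi>" by (simp add: vec_of_mat_def)
  have "(superop_mat \<chi> G *\<^sub>v vec_of_mat \<chi> Y) $ p =
     (\<Sum>q<\<chi> * \<chi>. G (mat_unit \<chi> (q div \<chi>) (q mod \<chi>)) $$ (p div \<chi>, p mod \<chi>) * Y $$ (q div \<chi>, q mod \<chi>))"
    using p by (simp add: superop_mat_def vec_of_mat_def scalar_prod_def lessThan_atLeast0)
  also have "\<dots> = (\<Sum>k<\<chi>. \<Sum>l<\<chi>. G (mat_unit \<chi> k l) $$ (p div \<chi>, p mod \<chi>) * Y $$ (k, l))"
    by (rule sum_div_mod)
  also have "\<dots> = G Y $$ (p div \<chi>, p mod \<chi>)"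
    using linear_superop_index[OF assms] div_mod_less[OF p] by (simp add: mult.commute)
  finally show "(superop_mat \<chi> G *\<^sub>v vec_of_mat \<chi> Y) $ p = vec_of_mat \<chi> (G Y) $ p"
    using p by (simp add: vec_of_mat_def)
qed (simp add: superop_mat_def vec_of_mat_def)

lemma mult_mat_index_sum:
  fixes A B :: "complex mat"
  assumes "A \<in> carrier_mat m n" "B \<in> carrier_mat n r" "i < m" "j < r"
  shows "(A * B) $$ (i, j) = (\<Sum>k<n. A $$ (i, k) * B $$ (k, j))"
  using assms by (simp add: scalar_prod_def lessThan_atLeast0)

lemma linear_superop_comp:
  assumes "linear_superop \<chi> F" "linear_superop \<chi> G"
  shows "linear_superop \<chi> (F \<circ> G)"
  unfolding linear_superop_def
proof (intro ballI conjI allI impI)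
  fix Y :: "complex mat" assume Y: "Y \<in> carrier_mat \<chi> \<chi>"
  have G: "G X \<in> carrier_mat \<chi> \<chi>" if "X \<in> carrier_mat \<chi> \<chi>" for X
    using linear_superop_carrier[OF assms(2) that] .
  have F: "F X \<in> carrier_mat \<chi> \<chi>" if "X \<in> carrier_mat \<chi> \<chi>" for X
    using linear_superop_carrier[OF assms(1) that] .
  show "(F \<circ> G) Y \<in> carrier_mat \<chi> \<chi>" using F G Y by simp
  fix i j assume ij: "i < \<chi>" "j < \<chi>"
  let ?f = "\<lambda>p q. F (mat_unit \<chi> p q) $$ (i, j)"
  let ?g = "\<lambda>k l p q. G (mat_unit \<chi> k l) $$ (p, q)"
  have Fe: "F X $$ (i, j) = (\<Sum>p<\<chi>. \<Sum>q<\<chi>. X $$ (p, q) * ?f p q)" if "X \<in> carrier_mat \<chi> \<chi>" for X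
    using linear_superop_index[OF assms(1) that ij] .
  have Ge: "G Y $$ (p, q) = (\<Sum>k<\<chi>. \<Sum>l<\<chi>. Y $$ (k, l) * ?g k l p q)" if "p < \<chi>" "q < \<chi>" for p q
    using linear_superop_index[OF assms(2) Y that] .
  have "(F \<circ> G) Y $$ (i, j) = (\<Sum>p<\<chi>. \<Sum>q<\<chi>. \<Sum>k<\<chi>. \<Sum>l<\<chi>. Y $$ (k, l) * ?g k l p q * ?f p q)"
    by (simp add: Fe[OF G[OF Y]] Ge sum_distrib_right)
  also have "\<dots> = (\<Sum>p<\<chi>. \<Sum>k<\<chi>. \<Sum>q<\<chi>. \<Sum>l<\<chi>. Y $$ (k, l) * ?g k l p q * ?f p q)"
    by (rule sum.cong[OF refl]) (rule sum.swap)
  also have "\<dots> = (\<Sum>k<\<chi>. \<Sum>p<\<chi>. \<Sum>q<\<chi>. \<Sum>l<\<chi>. Y $$ (k, l) * ?g k l p q * ?f p q)"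
    by (rule sum.swap)
  also have "\<dots> = (\<Sum>k<\<chi>. \<Sum>p<\<chi>. \<Sum>l<\<chi>. \<Sum>q<\<chi>. Y $$ (k, l) * ?g k l p q * ?f p q)"
    by (rule sum.cong[OF refl], rule sum.cong[OF refl], rule sum.swap)
  also have "\<dots> = (\<Sum>k<\<chi>. \<Sum>l<\<chi>. \<Sum>p<\<chi>. \<Sum>q<\<chi>. Y $$ (k, l) * ?g k l p q * ?f p q)"
    by (rule sum.cong[OF refl], rule sum.swap)
  also have "\<dots> = (\<Sum>k<\<chi>. \<Sum>l<\<chi>. Y $$ (k, l) * (F \<circ> G) (mat_unit \<chi> k l) $$ (i, j))"
    by (simp add: Fe[OF G] sum_distrib_left mult.assoc)
  finally show "(F \<circ> G) Y $$ (i, j) =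
      (\<Sum>k<\<chi>. \<Sum>l<\<chi>. Y $$ (k, l) * (F \<circ> G) (mat_unit \<chi> k l) $$ (i, j))" .
qed

lemma superop_mat_comp:
  assumes "linear_superop \<chi> F" "linear_superop \<chi> G"
  shows "superop_mat \<chi> (F \<circ> G) = superop_mat \<chi> F * superop_mat \<chi> G"
proof (rule eq_matI)
  fix p q assume "p < dim_row (superop_mat \<chi> F * superop_mat \<chi> G)" 
    "q < dim_col (superop_mat \<chi> F * superop_mat \<chi> G)"
  hence pq: "p < \<chi> * \<chi>" "q < \<chi> * \<chi>" by (auto simp: superop_mat_def)
  let ?E = "mat_unit \<chi> (q div \<chi>) (q mod \<chi>)"
  have G: "G ?E \<in> carrier_mat \<chi> \<chi>" by (rule linear_superop_carrier[OF assms(2)]) simp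
  have "(superop_mat \<chi> F * superop_mat \<chi> G) $$ (p, q) =
     (\<Sum>r<\<chi> * \<chi>. F (mat_unit \<chi> (r div \<chi>) (r mod \<chi>)) $$ (p div \<chi>, p mod \<chi>) * G ?E $$ (r div \<chi>, r mod \<chi>))"
    using pq by (simp add: superop_mat_def scalar_prod_def lessThan_atLeast0)
  also have "\<dots> = (\<Sum>k<\<chi>. \<Sum>l<\<chi>. F (mat_unit \<chi> k l) $$ (p div \<chi>, p mod \<chi>) * G ?E $$ (k, l))"
    by (rule sum_div_mod)
  also have "\<dots> = F (G ?E) $$ (p div \<chi>, p mod \<chi>)"
    using linear_superop_index[OF assms(1) G] div_mod_less[OF pq(1)] by (simp add: mult.commute)
  finally show "superop_mat \<chi> (F \<circ> G) $$ (p, q) = (superop_mat \<chi> F * superop_mat \<chi> G) $$ (p, q)"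
    using pq by (simp add: superop_mat_def)
qed (auto simp: superop_mat_def)

lemma superop_mat_id: "superop_mat \<chi> (\<lambda>Y. Y) = 1\<^sub>m (\<chi> * \<chi>)"
proof (rule eq_matI)
  fix p q assume "p < dim_row (1\<^sub>m (\<chi> * \<chi>) :: complex mat)" "q < dim_col (1\<^sub>m (\<chi> * \<chi>) :: complex mat)"
  hence pq: "p < \<chi> * \<chi>" "q < \<chi> * \<chi>" by auto
  have "p = q \<longleftrightarrow> p div \<chi> = q div \<chi> \<and> p mod \<chi> = q mod \<chi>" by (metis div_mult_mod_eq)
  thus "superop_mat \<chi> (\<lambda>Y. Y) $$ (p, q) = 1\<^sub>m (\<chi> * \<chi>) $$ (p, q)"
    using pq div_mod_less[OF pq(1)] by (auto simp: superop_mat_def mat_unit_def)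
qed (auto simp: superop_mat_def)

lemma linear_superop_id: "linear_superop \<chi> (\<lambda>Y. Y)"
proof -
  have "(\<Sum>k<\<chi>. \<Sum>l<\<chi>. Y $$ (k, l) * mat_unit \<chi> k l $$ (i, j)) = Y $$ (i, j)"
    if "i < \<chi>" "j < \<chi>" for Y :: "complex mat" and i j
  proof -
    have "(\<Sum>k<\<chi>. \<Sum>l<\<chi>. Y $$ (k, l) * mat_unit \<chi> k l $$ (i, j)) = 
        (\<Sum>k<\<chi>. if k = i then (\<Sum>l<\<chi>. if l = j then Y $$ (i, j) else 0) else 0)"
    proof (rule sum.cong[OF refl])
      fix k assume k: "k \<in> {..<\<chi>}"
      have "(\<Sum>l<\<chi>. Y $$ (k, l) * mat_unit \<chi> k l $$ (i, j)) = 
          (\<Sum>l<\<chi>. if l = j then (if k = i then Y $$ (i, j) else 0) else 0)"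
        using that k by (intro sum.cong[OF refl]) (auto simp: mat_unit_def)
      thus "(\<Sum>l<\<chi>. Y $$ (k, l) * mat_unit \<chi> k l $$ (i, j)) =
          (if k = i then (\<Sum>l<\<chi>. if l = j then Y $$ (i, j) else 0) else 0)"
        by simp
    qed
    thus ?thesis using that by simp
  qed
  thus ?thesis by (auto simp: linear_superop_def)
qed

lemma mat_trace_superop_mat:
  "mat_trace (superop_mat \<chi> G) = (\<Sum>k<\<chi>. \<Sum>l<\<chi>. G (mat_unit \<chi> k l) $$ (k, l))"
proof -
  have "mat_trace (superop_mat \<chi> G) =
      (\<Sum>p<\<chi> * \<chi>. G (mat_unit \<chi> (p div \<chi>) (p mod \<chi>)) $$ (p div \<chi>, p mod \<chi>))"
    by (simp add: mat_trace_def superop_mat_def)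
  also have "\<dots> = (\<Sum>k<\<chi>. \<Sum>l<\<chi>. G (mat_unit \<chi> k l) $$ (k, l))" by (rule sum_div_mod)
  finally show ?thesis .
qed

lemma eigenvalue_superop_mat:
  assumes G: "linear_superop \<chi> G" and e: "eigenvalue (superop_mat \<chi> G) \<mu>"
  obtains Y where "Y \<in> carrier_mat \<chi> \<chi>" "Y \<noteq> 0\<^sub>m \<chi> \<chi>" "G Y = \<mu> \<cdot>\<^sub>m Y"
proof -
  obtain v where v: "v \<in> carrier_vec (\<chi> * \<chi>)" "v \<noteq> 0\<^sub>v (\<chi> * \<chi>)" 
      "superop_mat \<chi> G *\<^sub>v v = \<mu> \<cdot>\<^sub>v v"
    using e by (auto simp: eigenvalue_def eigenvector_def superop_mat_def)
  define Y where "Y = mat \<chi> \<chi> (\<lambda>(k, l). v $ (k * \<chi> + l))"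
  have Y: "Y \<in> carrier_mat \<chi> \<chi>" by (simp add: Y_def)
  have vY: "vec_of_mat \<chi> Y = v"
  proof (rule eq_vecI)
    fix p assume "p < dim_vec v"
    hence "p < \<chi> * \<chi>" using v by simp
    thus "vec_of_mat \<chi> Y $ p = v $ p" using div_mod_less[of p \<chi>] by (simp add: vec_of_mat_def Y_def)
  qed (use v in \<open>simp add: vec_of_mat_def\<close>)
  have "G Y = \<mu> \<cdot>\<^sub>m Y"
    using superop_mat_mult_vec[OF G Y] v(3)
    by (intro vec_of_mat_inject[OF linear_superop_carrier[OF G Y] smult_carrier_mat[OF Y]])
      (simp add: vY vec_of_mat_smult[OF Y])
  moreover have "Y \<noteq> 0\<^sub>m \<chi> \<chi>"
  proof
    assume "Y = 0\<^sub>m \<chi> \<chi>"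
    hence "vec_of_mat \<chi> Y = 0\<^sub>v (\<chi> * \<chi>)" 
      by (intro eq_vecI) (auto simp: vec_of_mat_def div_mod_less)
    thus False using v vY by simp
  qed
  ultimately show ?thesis using that Y by blast
qed

text \<open>The map \<open>F 0\<close> acts first and \<open>F n\<close> outermost, so that one more
  site on the right end of a word is one more application on the outside.\<close>

primrec iterate_seq :: "(nat \<Rightarrow> 'a \<Rightarrow> 'a) \<Rightarrow> nat \<Rightarrow> 'a \<Rightarrow> 'a" where
  "iterate_seq F 0 Y = Y"
| "iterate_seq F (Suc n) Y = F n (iterate_seq F n Y)"

lemma iterate_seq_periodic:
  assumes "\<And>n. F (n + L) = F n"
  shows "iterate_seq F (n + L) Y = iterate_seq F n (iterate_seq F L Y)"
  by (induction n) (auto simp: assms)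

lemma linear_superop_iterate_seq:
  assumes "\<And>n. linear_superop \<chi> (F n)"
  shows "linear_superop \<chi> (iterate_seq F n)"
proof (induction n)
  case 0
  have "iterate_seq F 0 = (\<lambda>Y. Y)" by auto
  thus ?case by (simp add: linear_superop_id)
next
  case (Suc n)
  have "iterate_seq F (Suc n) = F n \<circ> iterate_seq F n" by auto
  thus ?case using linear_superop_comp[OF assms Suc] by metis
qed

text \<open>Turns a chain of \<open>m\<close> periods into an \<open>m\<close>-th matrix power, to
  which the results on traces of powers apply.\<close>

lemma superop_mat_iterate_seq_mult:
  assumes "\<And>n. linear_superop \<chi> (F n)" "\<And>n. F (n + L) = F n"
  shows "superop_mat \<chi> (iterate_seq F (m * L)) = superop_mat \<chi> (iterate_seq F L) ^\<^sub>m m"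
proof (induction m)
  case 0
  have "iterate_seq F 0 = (\<lambda>Y. Y)" by auto
  thus ?case by (simp add: superop_mat_id carrier_matD(1)[OF superop_mat_carrier])
next
  case (Suc m)
  have "iterate_seq F (Suc m * L) = iterate_seq F (m * L) \<circ> iterate_seq F L"
    using iterate_seq_periodic[of F L "m * L"] assms by (auto simp: add.commute)
  thus ?case using Suc
    by (simp only: superop_mat_comp[OF linear_superop_iterate_seq linear_superop_iterate_seq, OF assms(1) assms(1)] pow_mat.simps)
qed

section \<open>Transfer maps between two different tensors\<close>

definition mixed_transfer ::
  "nat \<Rightarrow> nat \<Rightarrow> (nat \<Rightarrow> complex mat) \<Rightarrow> (nat \<Rightarrow> complex mat) \<Rightarrow> complex mat \<Rightarrow> complex mat" where
  "mixed_transfer d \<chi> A B Y = mat_sum \<chi> d (\<lambda>s. mat_adjoint (A s) * Y * B s)"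

lemma transfer_eq_mixed_transfer: "transfer d \<chi> A = mixed_transfer d \<chi> A A"
  by (simp add: fun_eq_iff transfer_def mixed_transfer_def)

lemma mixed_transfer_carrier [simp]: "mixed_transfer d \<chi> A B Y \<in> carrier_mat \<chi> \<chi>"
  by (simp add: mixed_transfer_def mat_sum_def)

lemma mixed_transfer_index:
  assumes A: "\<forall>s<d. A s \<in> carrier_mat \<chi> \<chi>" and B: "\<forall>s<d. B s \<in> carrier_mat \<chi> \<chi>" 
    and Y: "Y \<in> carrier_mat \<chi> \<chi>" and ij: "i < \<chi>" "j < \<chi>"
  shows "mixed_transfer d \<chi> A B Y $$ (i, j) =
    (\<Sum>s<d. \<Sum>k<\<chi>. \<Sum>l<\<chi>. cnj (A s $$ (k, i)) * Y $$ (k, l) * B s $$ (l, j))"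
proof -
  have "(mat_adjoint (A s) * Y * B s) $$ (i, j) =
      (\<Sum>k<\<chi>. \<Sum>l<\<chi>. cnj (A s $$ (k, i)) * Y $$ (k, l) * B s $$ (l, j))" if "s < d" for s
  proof -
    note As = A[rule_format, OF that] and Bs = B[rule_format, OF that]
    have "(mat_adjoint (A s) * Y * B s) $$ (i, j) = (\<Sum>l<\<chi>. (mat_adjoint (A s) * Y) $$ (i, l) * B s $$ (l, j))"
      by (rule mult_mat_index_sum[OF mult_carrier_mat[OF mat_adjoint_carrier[OF As] Y] Bs ij])
    also have "\<dots> = (\<Sum>l<\<chi>. (\<Sum>k<\<chi>. cnj (A s $$ (k, i)) * Y $$ (k, l)) * B s $$ (l, j))"
      using ij by (simp add: mult_mat_index_sum[OF mat_adjoint_carrier[OF As] Y] mat_adjoint_index[OF As])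
    also have "\<dots> = (\<Sum>k<\<chi>. \<Sum>l<\<chi>. cnj (A s $$ (k, i)) * Y $$ (k, l) * B s $$ (l, j))"
      by (subst sum.swap) (simp add: sum_distrib_right)
    finally show ?thesis .
  qed
  thus ?thesis using ij by (simp add: mixed_transfer_def mat_sum_def)
qed

lemma mixed_transfer_mat_unit:
  assumes A: "\<forall>s<d. A s \<in> carrier_mat \<chi> \<chi>" and B: "\<forall>s<d. B s \<in> carrier_mat \<chi> \<chi>" 
    and kl: "k < \<chi>" "l < \<chi>" and ij: "i < \<chi>" "j < \<chi>"
  shows "mixed_transfer d \<chi> A B (mat_unit \<chi> k l) $$ (i, j) = (\<Sum>s<d. cnj (A s $$ (k, i)) * B s $$ (l, j))"
proof -
  have "(\<Sum>p<\<chi>. \<Sum>q<\<chi>. cnj (A s $$ (p, i)) * mat_unit \<chi> k l $$ (p, q) * B s $$ (q, j)) =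
     (\<Sum>p<\<chi>. if p = k then (\<Sum>q<\<chi>. if q = l then cnj (A s $$ (k, i)) * B s $$ (l, j) else 0) else 0)" for s
  proof (rule sum.cong[OF refl])
    fix p assume p: "p \<in> {..<\<chi>}"
    have "(\<Sum>q<\<chi>. cnj (A s $$ (p, i)) * mat_unit \<chi> k l $$ (p, q) * B s $$ (q, j)) =
        (\<Sum>q<\<chi>. if q = l then (if p = k then cnj (A s $$ (k, i)) * B s $$ (l, j) else 0) else 0)"
      using p by (intro sum.cong[OF refl]) (auto simp: mat_unit_def)
    thus "(\<Sum>q<\<chi>. cnj (A s $$ (p, i)) * mat_unit \<chi> k l $$ (p, q) * B s $$ (q, j)) =
        (if p = k then (\<Sum>q<\<chi>. if q = l then cnj (A s $$ (k, i)) * B s $$ (l, j) else 0) else 0)"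
      by simp
  qed
  thus ?thesis using kl unfolding mixed_transfer_index[OF A B mat_unit_carrier ij] by simp
qed

lemma linear_superop_mixed_transfer:
  assumes A: "\<forall>s<d. A s \<in> carrier_mat \<chi> \<chi>" and B: "\<forall>s<d. B s \<in> carrier_mat \<chi> \<chi>" 
  shows "linear_superop \<chi> (mixed_transfer d \<chi> A B)"
  unfolding linear_superop_def
proof (intro ballI conjI allI impI)
  fix Y :: "complex mat" and i j assume Y: "Y \<in> carrier_mat \<chi> \<chi>" and ij: "i < \<chi>" "j < \<chi>"
  have "mixed_transfer d \<chi> A B Y $$ (i, j) = 
      (\<Sum>k<\<chi>. \<Sum>s<d. \<Sum>l<\<chi>. cnj (A s $$ (k, i)) * Y $$ (k, l) * B s $$ (l, j))"
    unfolding mixed_transfer_index[OF A B Y ij] by (rule sum.swap)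
  also have "\<dots> = (\<Sum>k<\<chi>. \<Sum>l<\<chi>. \<Sum>s<d. cnj (A s $$ (k, i)) * Y $$ (k, l) * B s $$ (l, j))"
    by (rule sum.cong[OF refl]) (rule sum.swap)
  also have "\<dots> = (\<Sum>k<\<chi>. \<Sum>l<\<chi>. Y $$ (k, l) * mixed_transfer d \<chi> A B (mat_unit \<chi> k l) $$ (i, j))"
    by (intro sum.cong[OF refl]) (simp add: mixed_transfer_mat_unit[OF A B _ _ ij] sum_distrib_left ac_simps)
  finally show "mixed_transfer d \<chi> A B Y $$ (i, j) =
    (\<Sum>k<\<chi>. \<Sum>l<\<chi>. Y $$ (k, l) * mixed_transfer d \<chi> A B (mat_unit \<chi> k l) $$ (i, j))" .
qed auto

section \<open>Symmetric states and mixed transfer channels\<close>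

definition word_prod :: "nat \<Rightarrow> (nat \<Rightarrow> complex mat) \<Rightarrow> nat list \<Rightarrow> complex mat" where
  "word_prod \<chi> A s = foldr (\<lambda>k B. A k * B) s (1\<^sub>m \<chi>)"

lemma word_prod_carrier:
  "\<forall>s<d. A s \<in> carrier_mat \<chi> \<chi> \<Longrightarrow> set s \<subseteq> {..<d} \<Longrightarrow> word_prod \<chi> A s \<in> carrier_mat \<chi> \<chi>"
  by (induction s) (auto simp: word_prod_def)

text \<open>The fold recurses at the first letter, whereas iterating the channel adds sites at the
  end of the word; this bridges the two.\<close>

lemma word_prod_snoc:
  assumes "\<forall>s<d. A s \<in> carrier_mat \<chi> \<chi>" "set s \<subseteq> {..<d}" "x < d"
  shows "word_prod \<chi> A (s @ [x]) = word_prod \<chi> A s * A x"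
  using assms(2)
proof (induction s)
  case Nil
  have "A x \<in> carrier_mat \<chi> \<chi>" using assms by simp
  thus ?case by (simp add: word_prod_def)
next
  case (Cons y s)
  have "word_prod \<chi> A (y # s) * A x = A y * (word_prod \<chi> A s * A x)"
    using assms Cons word_prod_carrier[OF assms(1), of s]
    by (simp add: word_prod_def assoc_mult_mat[of _ \<chi> \<chi> _ \<chi> _ \<chi>])
  thus ?case using Cons by (simp add: word_prod_def)
qed

section \<open>Configurations, relabellings and overlaps of periodic states\<close>

lemma finite_configs [simp]: "finite (configs d M)"
  using finite_lists_length_eq[of "{..<d}" M] by (simp add: configs_def conj_commute)

lemma sum_configs_Suc:
  "(\<Sum>s\<in>configs d (Suc M). f s) = (\<Sum>s\<in>configs d M. \<Sum>x<d. f (s @ [x]))"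
  for f :: "nat list \<Rightarrow> complex"
proof -
  have "(\<Sum>s\<in>configs d M. \<Sum>x<d. f (s @ [x])) = (\<Sum>(s, x)\<in>configs d M \<times> {..<d}. f (s @ [x]))"
    by (simp add: sum.cartesian_product)
  also have "\<dots> = (\<Sum>s\<in>configs d (Suc M). f s)"
  proof (rule sum.reindex_bij_witness[of _ "\<lambda>s. (butlast s, last s)" "\<lambda>(s, x). s @ [x]"])
    fix s assume "s \<in> configs d (Suc M)"
    hence "s \<noteq> []" "length s = Suc M" "set s \<subseteq> {..<d}" by (auto simp: configs_def)
    thus "(butlast s, last s) \<in> configs d M \<times> {..<d}" 
      using subsetD[OF _ last_in_set, of s "{..<d}"] by (auto simp: configs_def dest: in_set_butlastD)
    show "(case (butlast s, last s) of (s, x) \<Rightarrow> s @ [x]) = s" using \<open>s \<noteq> []\<close> by simp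
  qed (auto simp: configs_def)
  finally show ?thesis ..
qed

definition relabel :: "(nat \<Rightarrow> nat \<Rightarrow> nat) \<Rightarrow> nat list \<Rightarrow> nat list" where
  "relabel \<pi> s = map (\<lambda>n. \<pi> n (s ! n)) [0..<length s]"

lemma relabel_snoc: "relabel \<pi> (s @ [x]) = relabel \<pi> s @ [\<pi> (length s) x]"
  by (auto simp: relabel_def nth_append)

lemma relabel_in_configs:
  assumes "s \<in> configs d M" "\<forall>n. \<forall>x<d. \<pi> n x < d"
  shows "relabel \<pi> s \<in> configs d M"
  using assms by (auto simp: relabel_def configs_def subset_iff)

text \<open>The tensor obtained by acting on site \<open>n\<close> with the monomial matrix that has entry \<open>p n s\<close> at
  position \<open>(s, \<pi> n s)\<close> and zeros elsewhere.\<close>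

definition monomial_action ::
  "(nat \<Rightarrow> nat \<Rightarrow> complex) \<Rightarrow> (nat \<Rightarrow> nat \<Rightarrow> nat) \<Rightarrow> (nat \<Rightarrow> complex mat) \<Rightarrow> nat \<Rightarrow> nat \<Rightarrow> complex mat" where
  "monomial_action p \<pi> A n s = p n s \<cdot>\<^sub>m A (\<pi> n s)"

text \<open>Starting from a matrix unit keeps the left virtual indices of the two layers fixed at
  \<open>k\<close> and \<open>l\<close>, so each configuration contributes one entry of the
  conjugated word and one of the relabelled word. Induction on the last site.\<close>

lemma iterate_mixed_transfer_mat_unit:
  assumes A: "\<forall>s<d. A s \<in> carrier_mat \<chi> \<chi>" and pi: "\<forall>n. \<forall>x<d. \<pi> n x < d"
    and kl: "k < \<chi>" "l < \<chi>"
  shows "i < \<chi> \<Longrightarrow> j < \<chi> \<Longrightarrow> iterate_seq (\<lambda>n. mixed_transfer d \<chi> A (monomial_action p \<pi> A n)) M (mat_unit \<chi> k l) $$ (i, j) =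
    (\<Sum>s\<in>configs d M. (\<Prod>n<M. p n (s ! n)) *
       (cnj (word_prod \<chi> A s $$ (k, i)) * word_prod \<chi> A (relabel \<pi> s) $$ (l, j)))"
proof (induction M arbitrary: i j)
  case 0
  have "configs d 0 = {[]}" by (auto simp: configs_def)
  thus ?case using 0 kl by (simp add: word_prod_def relabel_def mat_unit_def)
next
  case (Suc M)
  let ?B = "monomial_action p \<pi> A"
  let ?c = "\<lambda>s i. cnj (word_prod \<chi> A s $$ (k, i))" and ?d = "\<lambda>s j. word_prod \<chi> A (relabel \<pi> s) $$ (l, j)"
  let ?P = "\<lambda>M s. \<Prod>n<M. p n (s ! n)"
  have B: "\<forall>s<d. ?B n s \<in> carrier_mat \<chi> \<chi>" for n
    using A pi by (auto simp: monomial_action_def)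
  have lin: "linear_superop \<chi> (iterate_seq (\<lambda>n. mixed_transfer d \<chi> A (?B n)) M)"
    by (intro linear_superop_iterate_seq linear_superop_mixed_transfer A B)
  note X = linear_superop_carrier[OF lin mat_unit_carrier[of \<chi> k l]]
  \<comment> \<open>The phase of the new site is attached to its relabelled letter, which makes the
    product an entry of the transformed tensor \<open>?B M x\<close>.\<close>
  have step: "?P (Suc M) (s @ [x]) * (?c (s @ [x]) i * ?d (s @ [x]) j) =
     (\<Sum>u<\<chi>. \<Sum>v<\<chi>. cnj (A x $$ (u, i)) * (?P M s * (?c s u * ?d s v)) * ?B M x $$ (v, j))"
    if s: "s \<in> configs d M" and x: "x < d" for s x
  proof -
    have ls: "length s = M" and ss: "set s \<subseteq> {..<d}" using s by (auto simp: configs_def)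
    have rs: "set (relabel \<pi> s) \<subseteq> {..<d}" 
      using relabel_in_configs[OF s, of \<pi>] pi by (auto simp: configs_def)
    have c: "?c (s @ [x]) i = (\<Sum>u<\<chi>. ?c s u * cnj (A x $$ (u, i)))"
      unfolding word_prod_snoc[OF A ss x] mult_mat_index_sum[OF word_prod_carrier[OF A ss] A[rule_format, OF x] kl(1) Suc.prems(1)]
      by simp
    have d: "p M x * ?d (s @ [x]) j = (\<Sum>v<\<chi>. ?d s v * ?B M x $$ (v, j))"
      unfolding relabel_snoc ls word_prod_snoc[OF A rs pi[rule_format, OF x]] 
        mult_mat_index_sum[OF word_prod_carrier[OF A rs] A[rule_format, OF pi[rule_format, OF x]] kl(2) Suc.prems(2)]
      unfolding sum_distrib_left using carrier_matD[OF A[rule_format, OF pi[rule_format, OF x]], of M] Suc.prems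
      by (intro sum.cong[OF refl]) (simp add: monomial_action_def mult.left_commute)
    have P: "?P (Suc M) (s @ [x]) = ?P M s * p M x"
      using ls by (auto simp: nth_append intro!: arg_cong2[of _ _ _ _ "(*)"] prod.cong)
    have "?P (Suc M) (s @ [x]) * (?c (s @ [x]) i * ?d (s @ [x]) j) = 
       ?P M s * (?c (s @ [x]) i * (p M x * ?d (s @ [x]) j))" by (simp only: P ac_simps)
    also have "\<dots> = ?P M s * (\<Sum>u<\<chi>. \<Sum>v<\<chi>. (?c s u * cnj (A x $$ (u, i))) * (?d s v * ?B M x $$ (v, j)))"
      unfolding c d by (simp only: sum_product)
    finally show ?thesis by (simp add: sum_distrib_left ac_simps)
  qed
  have "iterate_seq (\<lambda>n. mixed_transfer d \<chi> A (?B n)) (Suc M) (mat_unit \<chi> k l) $$ (i, j) =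
     (\<Sum>x<d. \<Sum>u<\<chi>. \<Sum>v<\<chi>. cnj (A x $$ (u, i)) * 
       (\<Sum>s\<in>configs d M. ?P M s * (?c s u * ?d s v)) * ?B M x $$ (v, j))"
    using mixed_transfer_index[OF A B X Suc.prems] Suc.IH by simp
  also have "\<dots> = (\<Sum>x<d. \<Sum>u<\<chi>. \<Sum>v<\<chi>. \<Sum>s\<in>configs d M. cnj (A x $$ (u, i)) * 
       (?P M s * (?c s u * ?d s v)) * ?B M x $$ (v, j))"
    by (simp only: sum_distrib_left sum_distrib_right)
  also have "\<dots> = (\<Sum>x<d. \<Sum>u<\<chi>. \<Sum>s\<in>configs d M. \<Sum>v<\<chi>. cnj (A x $$ (u, i)) * 
       (?P M s * (?c s u * ?d s v)) * ?B M x $$ (v, j))"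
    by (rule sum.cong[OF refl], rule sum.cong[OF refl], rule sum.swap)
  also have "\<dots> = (\<Sum>x<d. \<Sum>s\<in>configs d M. \<Sum>u<\<chi>. \<Sum>v<\<chi>. cnj (A x $$ (u, i)) * 
       (?P M s * (?c s u * ?d s v)) * ?B M x $$ (v, j))"
    by (rule sum.cong[OF refl], rule sum.swap)
  also have "\<dots> = (\<Sum>s\<in>configs d M. \<Sum>x<d. \<Sum>u<\<chi>. \<Sum>v<\<chi>. cnj (A x $$ (u, i)) * 
       (?P M s * (?c s u * ?d s v)) * ?B M x $$ (v, j))"
    by (rule sum.swap)
  also have "\<dots> = (\<Sum>s\<in>configs d M. \<Sum>x<d. ?P (Suc M) (s @ [x]) * (?c (s @ [x]) i * ?d (s @ [x]) j))"
    by (intro sum.cong[OF refl]) (simp only: step lessThan_iff)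
  also have "\<dots> = (\<Sum>s\<in>configs d (Suc M). ?P (Suc M) s * (?c s i * ?d s j))"
    by (rule sum_configs_Suc[symmetric])
  finally show ?case .
qed

lemma mps_eq: "\<forall>s<d. A s \<in> carrier_mat \<chi> \<chi> \<Longrightarrow> s \<in> configs d M \<Longrightarrow>
    mps \<chi> A s = (\<Sum>i<\<chi>. word_prod \<chi> A s $$ (i, i))"
  using word_prod_carrier[of d A \<chi> s]
  by (simp add: mps_def mat_trace_def word_prod_def[symmetric] configs_def)

text \<open>Putting \<open>i = k\<close> and \<open>j = l\<close> and summing closes both layers
  into separate rings. The sum factors into two traces, so the trace of the iterated channel is the
  overlap of the state with its image under the symmetry.\<close>

lemma mat_trace_superop_iterate_mixed_transfer:
  assumes A: "\<forall>s<d. A s \<in> carrier_mat \<chi> \<chi>" and pi: "\<forall>n. \<forall>x<d. \<pi> n x < d"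
  shows "mat_trace (superop_mat \<chi> (iterate_seq (\<lambda>n. mixed_transfer d \<chi> A (monomial_action p \<pi> A n)) M)) =
    (\<Sum>s\<in>configs d M. cnj (mps \<chi> A s) * ((\<Prod>n<M. p n (s ! n)) * mps \<chi> A (relabel \<pi> s)))"
proof -
  let ?P = "\<lambda>s. \<Prod>n<M. p n (s ! n)"
  let ?c = "\<lambda>s i. cnj (word_prod \<chi> A s $$ (i, i))" and ?d = "\<lambda>s j. word_prod \<chi> A (relabel \<pi> s) $$ (j, j)"
  have "mat_trace (superop_mat \<chi> (iterate_seq (\<lambda>n. mixed_transfer d \<chi> A (monomial_action p \<pi> A n)) M)) =
    (\<Sum>k<\<chi>. \<Sum>l<\<chi>. \<Sum>s\<in>configs d M. ?P s * (?c s k * ?d s l))"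
    by (simp add: mat_trace_superop_mat iterate_mixed_transfer_mat_unit[OF A pi])
  also have "\<dots> = (\<Sum>k<\<chi>. \<Sum>s\<in>configs d M. \<Sum>l<\<chi>. ?P s * (?c s k * ?d s l))"
    by (rule sum.cong[OF refl], rule sum.swap)
  also have "\<dots> = (\<Sum>s\<in>configs d M. \<Sum>k<\<chi>. \<Sum>l<\<chi>. ?P s * (?c s k * ?d s l))"
    by (rule sum.swap)
  also have "\<dots> = (\<Sum>s\<in>configs d M. ?P s * ((\<Sum>k<\<chi>. ?c s k) * (\<Sum>l<\<chi>. ?d s l)))"
    by (simp only: sum_product) (simp only: sum_distrib_left)
  also have "\<dots> = (\<Sum>s\<in>configs d M. cnj (mps \<chi> A s) * (?P s * mps \<chi> A (relabel \<pi> s)))"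
    by (rule sum.cong[OF refl]) 
      (simp add: mps_eq[OF A] mps_eq[OF A relabel_in_configs[OF _ pi]] mult.left_commute)
  finally show ?thesis .
qed

text \<open>Each row of a monomial operator has a single nonzero column, so only one configuration
  survives the sum.\<close>

lemma apply_op_monomial:
  assumes s: "s \<in> configs d M" and pi: "\<forall>n. \<forall>x<d. \<pi> n x < d"
    and K: "\<And>t. t \<in> configs d M \<Longrightarrow> K s t = (\<Prod>n<M. if t ! n = \<pi> n (s ! n) then p n (s ! n) else 0)"
  shows "apply_op d M K \<psi> s = (\<Prod>n<M. p n (s ! n)) * \<psi> (relabel \<pi> s)"
proof -
  have r: "relabel \<pi> s \<in> configs d M" by (rule relabel_in_configs[OF s pi])
  have l: "length s = M" using s by (simp add: configs_def)
  have "apply_op d M K \<psi> s = (\<Sum>t\<in>configs d M. if t = relabel \<pi> s then (\<Prod>n<M. p n (s ! n)) * \<psi> t else 0)"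
    unfolding apply_op_def
  proof (rule sum.cong[OF refl])
    fix t assume t: "t \<in> configs d M"
    have "K s t = 0" if ne: "t \<noteq> relabel \<pi> s"
    proof -
      have "length t = M" using t by (simp add: configs_def)
      hence "\<exists>n<M. t ! n \<noteq> \<pi> n (s ! n)" using ne l by (auto simp: list_eq_iff_nth_eq relabel_def)
      thus ?thesis using K[OF t] by (auto intro!: prod_zero)
    qed
    moreover have "K s t = (\<Prod>n<M. p n (s ! n))" if "t = relabel \<pi> s"
      unfolding K[OF t] using that l by (auto simp: relabel_def intro!: prod.cong)
    ultimately show "K s t * \<psi> t = (if t = relabel \<pi> s then (\<Prod>n<M. p n (s ! n)) * \<psi> t else 0)"
      by auto
  qed
  also have "\<dots> = (\<Prod>n<M. p n (s ! n)) * \<psi> (relabel \<pi> s)" using r by simp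
  finally show ?thesis .
qed

text \<open>Here \<open>L\<close> is the period of the symmetry, which may be a proper divisor of the length unit \<open>r L\<close>:
  the shift symmetry has \<open>r = 1\<close>, while the on-site symmetry has period one.\<close>

lemma symmetric_mps_peripheral_eigenvector:
  assumes inj: "left_canonical_injective d \<chi> A" and pi: "\<forall>n. \<forall>x<d. \<pi> n x < d"
    and L: "L \<ge> 1" and r: "r \<ge> 1" and per: "\<And>n. p (n + L) = p n" "\<And>n. \<pi> (n + L) = \<pi> n"
    and sym: "\<And>m. m \<ge> 1 \<Longrightarrow> \<exists>\<theta>::real. \<forall>s\<in>configs d (m * r * L).
       (\<Prod>n<m * r * L. p n (s ! n)) * mps \<chi> A (relabel \<pi> s) = cis \<theta> * mps \<chi> A s"
  obtains \<mu> Y where "cmod \<mu> \<ge> 1" "Y \<in> carrier_mat \<chi> \<chi>" "Y \<noteq> 0\<^sub>m \<chi> \<chi>"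
    "iterate_seq (\<lambda>n. mixed_transfer d \<chi> A (monomial_action p \<pi> A n)) L Y = \<mu> \<cdot>\<^sub>m Y"
proof -
  have A: "\<forall>s<d. A s \<in> carrier_mat \<chi> \<chi>" using inj by (simp add: left_canonical_injective_def)
  let ?F = "\<lambda>n. mixed_transfer d \<chi> A (monomial_action p \<pi> A n)"
  let ?S = "superop_mat \<chi> (iterate_seq ?F L)" and ?T = "superop_mat \<chi> (transfer d \<chi> A)"
  have lin: "linear_superop \<chi> (?F n)" for n
    by (intro linear_superop_mixed_transfer A) (use A pi in \<open>auto simp: monomial_action_def\<close>)
  have perF: "?F (n + L) = ?F n" for n
  proof -
    have "monomial_action p \<pi> A (n + L) = monomial_action p \<pi> A n"
      by (rule ext) (simp add: monomial_action_def per)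
    thus ?thesis by simp
  qed
  \<comment> \<open>With trivial phases and relabelling the overlap formula gives the squared norm
    of the state as a trace of powers of the plain channel.\<close>
  have id: "monomial_action (\<lambda>_ _. 1) (\<lambda>_ s. s) A n = A" for n
    by (intro ext eq_matI) (auto simp: monomial_action_def)
  let ?E = "\<lambda>n::nat. mixed_transfer d \<chi> A A"
  have linE: "linear_superop \<chi> (?E n)" for n by (intro linear_superop_mixed_transfer A)
  have E1: "iterate_seq ?E 1 = transfer d \<chi> A" by (auto simp: transfer_eq_mixed_transfer)
  have E: "mat_trace (?T ^\<^sub>m M) = (\<Sum>s\<in>configs d M. cnj (mps \<chi> A s) * mps \<chi> A s)" for M
  proof -
    have "relabel (\<lambda>_ s. s) s = s" for s by (auto simp: relabel_def map_nth)
    hence "mat_trace (superop_mat \<chi> (iterate_seq ?E M)) = (\<Sum>s\<in>configs d M. cnj (mps \<chi> A s) * mps \<chi> A s)"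
      using mat_trace_superop_iterate_mixed_transfer[OF A, of "\<lambda>_ s. s" "\<lambda>_ _. 1" M] 
      by (simp add: id)
    moreover have "superop_mat \<chi> (iterate_seq ?E M) = ?T ^\<^sub>m M"
      using superop_mat_iterate_seq_mult[of \<chi> ?E 1 M, OF linE] by (simp only: E1 mult_1_right)
    ultimately show ?thesis by simp
  qed
  \<comment> \<open>The phase \<open>\<theta>\<close> may depend on \<open>m\<close> without any
    control, hence only moduli are compared.\<close>
  have norm: "cmod (mat_trace (?S ^\<^sub>m (m * r))) = cmod (mat_trace (?T ^\<^sub>m (m * r * L)))" if m: "m \<ge> 1" for m
  proof -
    obtain \<theta> :: real where th: "\<forall>s\<in>configs d (m * r * L).
       (\<Prod>n<m * r * L. p n (s ! n)) * mps \<chi> A (relabel \<pi> s) = cis \<theta> * mps \<chi> A s" 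
      using sym[OF m] by blast
    have "mat_trace (?S ^\<^sub>m (m * r)) = (\<Sum>s\<in>configs d (m * r * L). cnj (mps \<chi> A s) * 
        ((\<Prod>n<m * r * L. p n (s ! n)) * mps \<chi> A (relabel \<pi> s)))"
      using superop_mat_iterate_seq_mult[of \<chi> ?F L "m * r", OF lin perF] 
        mat_trace_superop_iterate_mixed_transfer[OF A pi, where p = p and M = "m * r * L"] by simp
    also have "\<dots> = (\<Sum>s\<in>configs d (m * r * L). cnj (mps \<chi> A s) * (cis \<theta> * mps \<chi> A s))"
      using th by (intro sum.cong) auto
    also have "\<dots> = cis \<theta> * mat_trace (?T ^\<^sub>m (m * r * L))"
      by (simp add: E sum_distrib_left mult.left_commute)
    finally show ?thesis by (simp add: norm_mult)
  qed
  have "(\<lambda>M. mat_trace (?T ^\<^sub>m M)) \<longlonglongrightarrow> 1"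
    using inj by (intro mat_trace_pow_tendsto_1[OF superop_mat_carrier]) 
      (auto simp: left_canonical_injective_def)
  moreover have "strict_mono (\<lambda>m. m * r * L)" using L r by (auto simp: strict_mono_def)
  ultimately have "(\<lambda>m. mat_trace (?T ^\<^sub>m (m * r * L))) \<longlonglongrightarrow> 1"
    using LIMSEQ_subseq_LIMSEQ[of "\<lambda>M. mat_trace (?T ^\<^sub>m M)" 1 "\<lambda>m. m * r * L"] by (simp add: comp_def)
  hence lim: "(\<lambda>m. cmod (mat_trace (?T ^\<^sub>m (m * r * L)))) \<longlonglongrightarrow> 1"
    using tendsto_norm by fastforce
  have limS: "(\<lambda>m. cmod (mat_trace (?S ^\<^sub>m (m * r)))) \<longlonglongrightarrow> 1"
    by (rule Lim_transform_eventually[OF lim], rule eventually_mono[OF eventually_ge_at_top[of 1]])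
      (simp add: norm)
  \<comment> \<open>If all eigenvalues of the one-period map had modulus below one, the overlaps
    would vanish in the limit, although along the admissible lengths their moduli tend to 1.\<close>
  have "\<not> (\<lambda>m. mat_trace (?S ^\<^sub>m m)) \<longlonglongrightarrow> 0"
  proof
    assume "(\<lambda>m. mat_trace (?S ^\<^sub>m m)) \<longlonglongrightarrow> 0"
    moreover have "strict_mono (\<lambda>m. m * r)" using r by (auto simp: strict_mono_def)
    ultimately have "(\<lambda>m. mat_trace (?S ^\<^sub>m (m * r))) \<longlonglongrightarrow> 0"
      using LIMSEQ_subseq_LIMSEQ[of "\<lambda>M. mat_trace (?S ^\<^sub>m M)" 0 "\<lambda>m. m * r"] by (simp add: comp_def)
    from LIMSEQ_unique[OF tendsto_norm_zero[OF this] limS] show False by simp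
  qed
  then obtain \<mu> where "eigenvalue ?S \<mu>" "cmod \<mu> \<ge> 1"
    using mat_trace_pow_tendsto_0[OF superop_mat_carrier] by (meson not_less)
  thus ?thesis
    using eigenvalue_superop_mat[OF linear_superop_iterate_seq[of \<chi> ?F, OF lin]] that by metis
qed

section \<open>Adjoints and sums of matrices\<close>

lemma mat_adjoint_dim [simp]:
  "dim_row (mat_adjoint A) = dim_col A" "dim_col (mat_adjoint A) = dim_row A"
  by (auto simp: mat_adjoint_def)

lemma mat_adjoint_mult:
  fixes A B :: "complex mat"
  assumes A: "A \<in> carrier_mat m n" and B: "B \<in> carrier_mat n r"
  shows "mat_adjoint (A * B) = mat_adjoint B * mat_adjoint A"
proof (rule eq_matI)
  fix i j assume "i < dim_row (mat_adjoint B * mat_adjoint A)" "j < dim_col (mat_adjoint B * mat_adjoint A)"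
  hence ij: "i < r" "j < m" using A B by auto
  show "mat_adjoint (A * B) $$ (i, j) = (mat_adjoint B * mat_adjoint A) $$ (i, j)"
    using ij by (simp add: mat_adjoint_index[OF mult_carrier_mat[OF A B]] mult_mat_index_sum[OF A B]
      mult_mat_index_sum[OF mat_adjoint_carrier[OF B] mat_adjoint_carrier[OF A]]
      mat_adjoint_index[OF A] mat_adjoint_index[OF B] mult.commute)
qed (use A B in auto)

lemma mat_adjoint_adjoint:
  fixes A :: "complex mat"
  assumes A: "A \<in> carrier_mat m n"
  shows "mat_adjoint (mat_adjoint A) = A"
  using A
  by (intro eq_matI) (auto simp: mat_adjoint_index[OF mat_adjoint_carrier[OF A]] mat_adjoint_index[OF A])

lemma mat_adjoint_one: "mat_adjoint (1\<^sub>m n :: complex mat) = 1\<^sub>m n"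
  by (intro eq_matI) (auto simp: mat_adjoint_index[OF one_carrier_mat[of n]])

lemma mat_adjoint_smult:
  fixes A :: "complex mat"
  assumes A: "A \<in> carrier_mat m n"
  shows "mat_adjoint (c \<cdot>\<^sub>m A) = cnj c \<cdot>\<^sub>m mat_adjoint A"
  using A
  by (intro eq_matI) 
    (auto simp: mat_adjoint_index[OF smult_carrier_mat[OF A]] mat_adjoint_index[OF A])

lemma mat_adjoint_minus:
  fixes A B :: "complex mat"
  assumes A: "A \<in> carrier_mat m n" and B: "B \<in> carrier_mat m n"
  shows "mat_adjoint (A - B) = mat_adjoint A - mat_adjoint B"
  using A B
  by (intro eq_matI) 
    (auto simp: mat_adjoint_index[OF minus_carrier_mat[OF B]] mat_adjoint_index[OF A] mat_adjoint_index[OF B])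

lemma mat_sum_carrier [simp]: "mat_sum \<chi> d F \<in> carrier_mat \<chi> \<chi>"
  by (simp add: mat_sum_def)

lemma mat_sum_index: "i < \<chi> \<Longrightarrow> j < \<chi> \<Longrightarrow> mat_sum \<chi> d F $$ (i, j) = (\<Sum>s<d. F s $$ (i, j))"
  by (simp add: mat_sum_def)

lemma mat_sum_cong: "(\<And>s. s < d \<Longrightarrow> F s = G s) \<Longrightarrow> mat_sum \<chi> d F = mat_sum \<chi> d G"
  by (simp add: mat_sum_def)

lemma mult_mat_sum:
  assumes P: "P \<in> carrier_mat \<chi> \<chi>" and F: "\<forall>s<d. F s \<in> carrier_mat \<chi> \<chi>"
  shows "P * mat_sum \<chi> d F = mat_sum \<chi> d (\<lambda>s. P * F s)"
proof (rule eq_matI)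
  fix i j assume "i < dim_row (mat_sum \<chi> d (\<lambda>s. P * F s))" "j < dim_col (mat_sum \<chi> d (\<lambda>s. P * F s))"
  hence ij: "i < \<chi>" "j < \<chi>" by (auto simp: mat_sum_def)
  have "(P * mat_sum \<chi> d F) $$ (i, j) = (\<Sum>k<\<chi>. \<Sum>s<d. P $$ (i, k) * F s $$ (k, j))"
    using ij by (simp add: mult_mat_index_sum[OF P mat_sum_carrier] mat_sum_index sum_distrib_left)
  also have "\<dots> = (\<Sum>s<d. \<Sum>k<\<chi>. P $$ (i, k) * F s $$ (k, j))" by (rule sum.swap)
  also have "\<dots> = mat_sum \<chi> d (\<lambda>s. P * F s) $$ (i, j)"
    unfolding mat_sum_index[OF ij] using ij F by (intro sum.cong[OF refl]) (simp add: mult_mat_index_sum[OF P, of _ \<chi>])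
  finally show "(P * mat_sum \<chi> d F) $$ (i, j) = mat_sum \<chi> d (\<lambda>s. P * F s) $$ (i, j)" .
qed (use P in \<open>auto simp: mat_sum_def\<close>)

lemma mat_sum_mult:
  assumes P: "P \<in> carrier_mat \<chi> \<chi>" and F: "\<forall>s<d. F s \<in> carrier_mat \<chi> \<chi>"
  shows "mat_sum \<chi> d F * P = mat_sum \<chi> d (\<lambda>s. F s * P)"
proof (rule eq_matI)
  fix i j assume "i < dim_row (mat_sum \<chi> d (\<lambda>s. F s * P))" "j < dim_col (mat_sum \<chi> d (\<lambda>s. F s * P))"
  hence ij: "i < \<chi>" "j < \<chi>" by (auto simp: mat_sum_def)
  have "(mat_sum \<chi> d F * P) $$ (i, j) = (\<Sum>k<\<chi>. \<Sum>s<d. F s $$ (i, k) * P $$ (k, j))"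
    using ij by (simp add: mult_mat_index_sum[OF mat_sum_carrier P] mat_sum_index sum_distrib_right)
  also have "\<dots> = (\<Sum>s<d. \<Sum>k<\<chi>. F s $$ (i, k) * P $$ (k, j))" by (rule sum.swap)
  also have "\<dots> = mat_sum \<chi> d (\<lambda>s. F s * P) $$ (i, j)"
    unfolding mat_sum_index[OF ij] using ij F by (intro sum.cong[OF refl]) (simp add: mult_mat_index_sum[OF _ P, of _ \<chi>])
  finally show "(mat_sum \<chi> d F * P) $$ (i, j) = mat_sum \<chi> d (\<lambda>s. F s * P) $$ (i, j)" .
qed (use P in \<open>auto simp: mat_sum_def\<close>)

lemma mat_adjoint_mat_sum:
  assumes F: "\<forall>s<d. F s \<in> carrier_mat \<chi> \<chi>"
  shows "mat_adjoint (mat_sum \<chi> d F) = mat_sum \<chi> d (\<lambda>s. mat_adjoint (F s))"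
proof (rule eq_matI)
  fix i j assume "i < dim_row (mat_sum \<chi> d (\<lambda>s. mat_adjoint (F s)))" 
    "j < dim_col (mat_sum \<chi> d (\<lambda>s. mat_adjoint (F s)))"
  hence ij: "i < \<chi>" "j < \<chi>" by (auto simp: mat_sum_def)
  thus "mat_adjoint (mat_sum \<chi> d F) $$ (i, j) = mat_sum \<chi> d (\<lambda>s. mat_adjoint (F s)) $$ (i, j)"
    using F by (simp add: mat_sum_index mat_adjoint_index[OF mat_sum_carrier] mat_adjoint_index[of _ \<chi> \<chi>])
qed (auto simp: mat_sum_def)

lemma mat_trace_mat_sum:
  assumes F: "\<forall>s<d. F s \<in> carrier_mat \<chi> \<chi>"
  shows "mat_trace (mat_sum \<chi> d F) = (\<Sum>s<d. mat_trace (F s))"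
proof -
  have "mat_trace (mat_sum \<chi> d F) = (\<Sum>i<\<chi>. \<Sum>s<d. F s $$ (i, i))"
    by (simp add: mat_trace_eq[OF mat_sum_carrier] mat_sum_index)
  also have "\<dots> = (\<Sum>s<d. \<Sum>i<\<chi>. F s $$ (i, i))" by (rule sum.swap)
  also have "\<dots> = (\<Sum>s<d. mat_trace (F s))"
    using F by (intro sum.cong[OF refl]) (simp add: mat_trace_eq[of _ \<chi>])
  finally show ?thesis .
qed

lemma sum_mat_trace_mult:
  assumes F: "\<forall>s<d. F s \<in> carrier_mat \<chi> \<chi>" and P: "P \<in> carrier_mat \<chi> \<chi>" and Q: "Q \<in> carrier_mat \<chi> \<chi>"
  shows "(\<Sum>s<d. mat_trace (P * F s * Q)) = mat_trace (P * mat_sum \<chi> d F * Q)"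
proof -
  have PF: "\<forall>s<d. P * F s \<in> carrier_mat \<chi> \<chi>" and PFQ: "\<forall>s<d. P * F s * Q \<in> carrier_mat \<chi> \<chi>"
    using F P Q by auto
  show ?thesis by (simp add: mult_mat_sum[OF P F] mat_sum_mult[OF Q PF] mat_trace_mat_sum[OF PFQ])
qed

lemma mat_trace_minus:
  assumes "A \<in> carrier_mat n n" "B \<in> carrier_mat n n"
  shows "mat_trace (A - B) = mat_trace A - mat_trace B"
  using assms by (simp add: mat_trace_eq[of _ n] mat_trace_eq[OF minus_carrier_mat] sum_subtractf)

section \<open>Contractivity and intertwining unitaries\<close>

text \<open>The squared Frobenius norm of \<open>Y\<close> times the square root of
  \<open>R\<close>. It is complex-valued as a trace; positivity is used through its real
  part.\<close>

definition weighted_norm_sq :: "complex mat \<Rightarrow> complex mat \<Rightarrow> complex" where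
  "weighted_norm_sq R Y = mat_trace (Y * R * mat_adjoint Y)"

lemma mat_trace_smult: "mat_trace (c \<cdot>\<^sub>m A) = c * mat_trace A" if "A \<in> carrier_mat n n"
  using that by (simp add: mat_trace_eq[of _ n] sum_distrib_left)

lemma square_mat_closed:
  fixes A B :: "complex mat"
  shows "A \<in> carrier_mat n n \<Longrightarrow> B \<in> carrier_mat n n \<Longrightarrow> A * B \<in> carrier_mat n n"
    and "A \<in> carrier_mat n n \<Longrightarrow> mat_adjoint A \<in> carrier_mat n n"
    and "A \<in> carrier_mat n n \<Longrightarrow> A ^\<^sub>m k \<in> carrier_mat n n"
  by auto

lemma smult_smult_mat: "a \<cdot>\<^sub>m (b \<cdot>\<^sub>m A) = (a * b) \<cdot>\<^sub>m (A :: complex mat)"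
  by (intro eq_matI) auto

lemma weighted_norm_sq_smult:
  assumes "R \<in> carrier_mat \<chi> \<chi>" "Y \<in> carrier_mat \<chi> \<chi>"
  shows "weighted_norm_sq R (c \<cdot>\<^sub>m Y) = of_real ((cmod c)\<^sup>2) * weighted_norm_sq R Y"
proof -
  note aY = mat_adjoint_carrier[OF assms(2)]
  have "(c \<cdot>\<^sub>m Y) * R * mat_adjoint (c \<cdot>\<^sub>m Y) = (c * cnj c) \<cdot>\<^sub>m (Y * R * mat_adjoint Y)"
    using assms aY by (simp add: mat_adjoint_smult[OF assms(2)] mult_smult_assoc_mat[of _ \<chi> \<chi> _ \<chi>] 
      mult_smult_distrib[of _ \<chi> \<chi> _ \<chi>] smult_smult_mat mult.commute)
  thus ?thesis unfolding weighted_norm_sq_def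
    using mat_trace_smult[OF mult_carrier_mat[OF mult_carrier_mat[OF assms(2,1)] aY], of "c * cnj c"]
    by (simp only: complex_norm_square)
qed

text \<open>Each conjugated row of \<open>Y\<close> contributes one value of the quadratic form of
  \<open>R\<close>, so positive definiteness carries over from vectors to matrices.\<close>

lemma weighted_norm_sq_row_sum:
  assumes R: "R \<in> carrier_mat \<chi> \<chi>" and Y: "Y \<in> carrier_mat \<chi> \<chi>"
  defines "w \<equiv> \<lambda>i. vec \<chi> (\<lambda>l. cnj (Y $$ (i, l)))"
  shows "weighted_norm_sq R Y = (\<Sum>i<\<chi>. (R *\<^sub>v w i) \<bullet>c w i)"
proof -
  note aY = mat_adjoint_carrier[OF Y]
  have "(Y * R * mat_adjoint Y) $$ (i, i) = (R *\<^sub>v w i) \<bullet>c w i" if i: "i < \<chi>" for i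
  proof -
    have w: "w i \<in> carrier_vec \<chi>" by (simp add: w_def)
    have "(Y * R * mat_adjoint Y) $$ (i, i) = 
       (\<Sum>l<\<chi>. (\<Sum>k<\<chi>. Y $$ (i, k) * R $$ (k, l)) * cnj (Y $$ (i, l)))"
      using i by (simp add: mult_mat_index_sum[OF mult_carrier_mat[OF Y R] aY] mult_mat_index_sum[OF Y R] 
        mat_adjoint_index[OF Y])
    also have "\<dots> = (\<Sum>k<\<chi>. \<Sum>l<\<chi>. Y $$ (i, k) * R $$ (k, l) * cnj (Y $$ (i, l)))"
      unfolding sum_distrib_right by (rule sum.swap)
    also have "\<dots> = (\<Sum>k<\<chi>. (\<Sum>l<\<chi>. R $$ (k, l) * w i $ l) * cnj (w i $ k))"
      by (intro sum.cong[OF refl]) (simp add: w_def sum_distrib_right sum_distrib_left ac_simps)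
    also have "\<dots> = (\<Sum>k<\<chi>. (R *\<^sub>v w i) $ k * cnj (w i $ k))"
      by (intro sum.cong[OF refl]) (simp add: mult_mat_vec_index_sum[OF R w])
    also have "\<dots> = (R *\<^sub>v w i) \<bullet>c w i"
      using w by (simp add: scalar_prod_def lessThan_atLeast0)
    finally show ?thesis .
  qed
  thus ?thesis
    unfolding weighted_norm_sq_def mat_trace_eq[OF mult_carrier_mat[OF mult_carrier_mat[OF Y R] aY]]
    by (intro sum.cong[OF refl]) (simp del: index_mult_mat)
qed

lemma weighted_norm_sq_nonneg_pos:
  assumes pd: "positive_definite \<chi> R" and Y: "Y \<in> carrier_mat \<chi> \<chi>"
  shows "Re (weighted_norm_sq R Y) \<ge> 0" and "Y \<noteq> 0\<^sub>m \<chi> \<chi> \<Longrightarrow> Re (weighted_norm_sq R Y) > 0"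
proof -
  let ?w = "\<lambda>i. vec \<chi> (\<lambda>l. cnj (Y $$ (i, l)))"
  have R: "R \<in> carrier_mat \<chi> \<chi>" using pd by (simp add: positive_definite_def)
  have pos: "Re ((R *\<^sub>v v) \<bullet>c v) > 0" if "v \<in> carrier_vec \<chi>" "v \<noteq> 0\<^sub>v \<chi>" for v
    using pd that by (auto simp: positive_definite_def less_complex_def)
  have nn: "Re ((R *\<^sub>v v) \<bullet>c v) \<ge> 0" if v: "v \<in> carrier_vec \<chi>" for v
  proof (cases "v = 0\<^sub>v \<chi>")
    case True
    have "R *\<^sub>v 0\<^sub>v \<chi> \<in> carrier_vec \<chi>" using R by auto
    thus ?thesis using True by (simp add: scalar_prod_def)
  qed (use pos[OF v] in auto)
  have eq: "Re (weighted_norm_sq R Y) = (\<Sum>i<\<chi>. Re ((R *\<^sub>v ?w i) \<bullet>c ?w i))"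
    by (simp add: weighted_norm_sq_row_sum[OF R Y])
  show "Re (weighted_norm_sq R Y) \<ge> 0"
    unfolding eq by (intro sum_nonneg nn) simp
  assume "Y \<noteq> 0\<^sub>m \<chi> \<chi>"
  then obtain i j where ij: "i < \<chi>" "j < \<chi>" "Y $$ (i, j) \<noteq> 0" 
    using Y by (metis (no_types, lifting) carrier_matD eq_matI index_zero_mat)
  have "?w i \<noteq> 0\<^sub>v \<chi>"
  proof
    assume "?w i = 0\<^sub>v \<chi>"
    hence "?w i $ j = 0" using ij by simp
    thus False using ij by simp
  qed
  thus "Re (weighted_norm_sq R Y) > 0"
    unfolding eq by (intro sum_pos2[of _ i] pos nn) (use ij in auto)
qed

text \<open>Stacking the matrices \<open>A s\<close> gives an isometry. This is the Pythagorean identity for the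
  orthogonal projection onto its range.\<close>

lemma mixed_transfer_deficit:
  assumes A: "\<forall>s<d. A s \<in> carrier_mat \<chi> \<chi>" and B: "\<forall>s<d. B s \<in> carrier_mat \<chi> \<chi>"
    and A1: "mixed_transfer d \<chi> A A (1\<^sub>m \<chi>) = 1\<^sub>m \<chi>"
    and R: "R \<in> carrier_mat \<chi> \<chi>" and BR: "mat_sum \<chi> d (\<lambda>s. B s * R * mat_adjoint (B s)) = R"
    and Y: "Y \<in> carrier_mat \<chi> \<chi>"
  defines "Z \<equiv> mixed_transfer d \<chi> A B Y"
  shows "(\<Sum>s<d. weighted_norm_sq R (Y * B s - A s * Z)) = weighted_norm_sq R Y - weighted_norm_sq R Z"
proof -
  have Z: "Z \<in> carrier_mat \<chi> \<chi>" by (simp add: Z_def)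
  let ?t = mat_trace and ?a = mat_adjoint
  note aY = mat_adjoint_carrier[OF Y] and aZ = mat_adjoint_carrier[OF Z]
  \<comment> \<open>Cyclicity of the trace gathers everything that depends on \<open>s\<close> in
    the middle of each product. The outer factors, padded with identities, are independent of
    \<open>s\<close>, as \<open>sum_mat_trace_mult\<close> demands.\<close>
  have exp: "weighted_norm_sq R (Y * B s - A s * Z) = 
      ?t (Y * (B s * R * ?a (B s)) * ?a Y) - ?t (1\<^sub>m \<chi> * (?a (A s) * Y * B s) * (R * ?a Z))
      - ?t (Z * R * (?a (B s) * ?a Y * A s) * 1\<^sub>m \<chi>) + ?t (1\<^sub>m \<chi> * (?a (A s) * 1\<^sub>m \<chi> * A s) * (Z * R * ?a Z))"
    if s: "s < d" for s
  proof -
    have As: "A s \<in> carrier_mat \<chi> \<chi>" and Bs: "B s \<in> carrier_mat \<chi> \<chi>" using A B s by auto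
    note aA = mat_adjoint_carrier[OF As] and aB = mat_adjoint_carrier[OF Bs]
    define P where "P = Y * B s"
    define Q where "Q = A s * Z"
    have P: "P \<in> carrier_mat \<chi> \<chi>" and Q: "Q \<in> carrier_mat \<chi> \<chi>" 
      using Y Bs As Z by (auto simp: P_def Q_def)
    note aP = mat_adjoint_carrier[OF P] and aQ = mat_adjoint_carrier[OF Q]
    have "(P - Q) * R * ?a (P - Q) = P * R * ?a P - Q * R * ?a P - (P * R * ?a Q - Q * R * ?a Q)"
    proof -
      have "(P - Q) * R * ?a (P - Q) = (P * R - Q * R) * (?a P - ?a Q)"
        by (simp add: mat_adjoint_minus[OF P Q] minus_mult_distrib_mat[OF P Q R])
      also have "\<dots> = (P * R - Q * R) * ?a P - (P * R - Q * R) * ?a Q"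
        by (rule mult_minus_distrib_mat) (use P Q R aP aQ in \<open>auto intro: minus_carrier_mat\<close>)
      also have "\<dots> = P * R * ?a P - Q * R * ?a P - (P * R * ?a Q - Q * R * ?a Q)"
        using minus_mult_distrib_mat[of "P * R" \<chi> \<chi> "Q * R" "?a P" \<chi>]
          minus_mult_distrib_mat[of "P * R" \<chi> \<chi> "Q * R" "?a Q" \<chi>] P Q R aP aQ 
        by (simp add: assoc_mult_mat[of _ \<chi> \<chi> _ \<chi> _ \<chi>] square_mat_closed)
      finally show ?thesis .
    qed
    moreover have "P * R * ?a P \<in> carrier_mat \<chi> \<chi>" "Q * R * ?a P \<in> carrier_mat \<chi> \<chi>"
      "P * R * ?a Q \<in> carrier_mat \<chi> \<chi>" "Q * R * ?a Q \<in> carrier_mat \<chi> \<chi>"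
      using P Q R aP aQ by auto
    ultimately have 1: "weighted_norm_sq R (P - Q) = 
       ?t (P * R * ?a P) - ?t (P * R * ?a Q) - ?t (Q * R * ?a P) + ?t (Q * R * ?a Q)"
      by (simp add: weighted_norm_sq_def mat_trace_minus[of _ \<chi>] minus_carrier_mat)
    have aPe: "?a P = ?a (B s) * ?a Y" and aQe: "?a Q = ?a Z * ?a (A s)"
      using mat_adjoint_mult[OF Y Bs] mat_adjoint_mult[OF As Z] by (auto simp: P_def Q_def)
    have t1: "P * R * ?a P = Y * (B s * R * ?a (B s)) * ?a Y"
      using Y Bs R aB aY by (simp add: P_def aPe[unfolded P_def] assoc_mult_mat[of _ \<chi> \<chi> _ \<chi> _ \<chi>] square_mat_closed)
    have "?t (P * R * ?a Q) = ?t ((P * R * ?a Z) * ?a (A s))"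
      using P R aZ aA by (simp add: aQe assoc_mult_mat[of _ \<chi> \<chi> _ \<chi> _ \<chi>] square_mat_closed)
    also have "\<dots> = ?t (?a (A s) * (P * R * ?a Z))"
      by (rule mat_trace_comm) (use P R aZ aA in auto)
    also have "?a (A s) * (P * R * ?a Z) = 1\<^sub>m \<chi> * (?a (A s) * Y * B s) * (R * ?a Z)"
      using Y Bs R aZ aA by (simp add: left_mult_one_mat[of _ \<chi> \<chi>] P_def assoc_mult_mat[of _ \<chi> \<chi> _ \<chi> _ \<chi>] square_mat_closed)
    finally have t2: "?t (P * R * ?a Q) = ?t (1\<^sub>m \<chi> * (?a (A s) * Y * B s) * (R * ?a Z))" .
    have "?t (Q * R * ?a P) = ?t (A s * (Z * R * ?a P))"
      using As Z R aP by (simp add: Q_def assoc_mult_mat[of _ \<chi> \<chi> _ \<chi> _ \<chi>] square_mat_closed)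
    also have "\<dots> = ?t ((Z * R * ?a P) * A s)"
      by (rule mat_trace_comm) (use As Z R aP in auto)
    also have "(Z * R * ?a P) * A s = Z * R * (?a (B s) * ?a Y * A s) * 1\<^sub>m \<chi>"
      using As Z R aB aY by (simp add: aPe assoc_mult_mat[of _ \<chi> \<chi> _ \<chi> _ \<chi>] square_mat_closed)
    finally have t3: "?t (Q * R * ?a P) = ?t (Z * R * (?a (B s) * ?a Y * A s) * 1\<^sub>m \<chi>)" .
    have "?t (Q * R * ?a Q) = ?t ((Q * R * ?a Z) * ?a (A s))"
      using Q R aZ aA by (simp add: aQe assoc_mult_mat[of _ \<chi> \<chi> _ \<chi> _ \<chi>] square_mat_closed)
    also have "\<dots> = ?t (?a (A s) * (Q * R * ?a Z))"
      by (rule mat_trace_comm) (use Q R aZ aA in auto)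
    also have "?a (A s) * (Q * R * ?a Z) = 1\<^sub>m \<chi> * (?a (A s) * 1\<^sub>m \<chi> * A s) * (Z * R * ?a Z)"
      using As Z R aZ aA by (simp add: left_mult_one_mat[of _ \<chi> \<chi>] Q_def assoc_mult_mat[of _ \<chi> \<chi> _ \<chi> _ \<chi>] square_mat_closed)
    finally have t4: "?t (Q * R * ?a Q) = ?t (1\<^sub>m \<chi> * (?a (A s) * 1\<^sub>m \<chi> * A s) * (Z * R * ?a Z))" .
    show ?thesis using 1 t1 t2 t3 t4 by (simp add: P_def Q_def)
  qed
  have cA: "\<forall>s<d. ?a (A s) \<in> carrier_mat \<chi> \<chi>" "\<forall>s<d. ?a (B s) \<in> carrier_mat \<chi> \<chi>"
    using A B by simp_all
  have c1: "\<forall>s<d. B s * R * ?a (B s) \<in> carrier_mat \<chi> \<chi>" "\<forall>s<d. ?a (A s) * Y * B s \<in> carrier_mat \<chi> \<chi>" 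
    "\<forall>s<d. ?a (B s) * ?a Y * A s \<in> carrier_mat \<chi> \<chi>" "\<forall>s<d. ?a (A s) * 1\<^sub>m \<chi> * A s \<in> carrier_mat \<chi> \<chi>"
    using A B R Y aY cA by (simp_all add: square_mat_closed)
  have aZe: "mat_sum \<chi> d (\<lambda>s. ?a (B s) * ?a Y * A s) = ?a Z"
  proof -
    have "?a Z = mat_sum \<chi> d (\<lambda>s. ?a (?a (A s) * Y * B s))"
      unfolding Z_def mixed_transfer_def by (rule mat_adjoint_mat_sum[OF c1(2)])
    also have "\<dots> = mat_sum \<chi> d (\<lambda>s. ?a (B s) * ?a Y * A s)"
    proof (rule mat_sum_cong)
      fix s assume s: "s < d"
      have As: "A s \<in> carrier_mat \<chi> \<chi>" and Bs: "B s \<in> carrier_mat \<chi> \<chi>" using A B s by auto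
      note aA = mat_adjoint_carrier[OF As] and aB = mat_adjoint_carrier[OF Bs]
      show "?a (?a (A s) * Y * B s) = ?a (B s) * ?a Y * A s"
        unfolding mat_adjoint_mult[OF mult_carrier_mat[OF aA Y] Bs] mat_adjoint_mult[OF aA Y] mat_adjoint_adjoint[OF As]
        using As Y Bs by (simp add: square_mat_closed assoc_mult_mat[of _ \<chi> \<chi> _ \<chi> _ \<chi>])
    qed
    finally show ?thesis ..
  qed
  have split: "(\<Sum>s<d. weighted_norm_sq R (Y * B s - A s * Z)) = 
      (\<Sum>s<d. ?t (Y * (B s * R * ?a (B s)) * ?a Y) - ?t (1\<^sub>m \<chi> * (?a (A s) * Y * B s) * (R * ?a Z))
      - ?t (Z * R * (?a (B s) * ?a Y * A s) * 1\<^sub>m \<chi>) + ?t (1\<^sub>m \<chi> * (?a (A s) * 1\<^sub>m \<chi> * A s) * (Z * R * ?a Z)))"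
    by (rule sum.cong[OF refl]) (simp only: exp lessThan_iff)
  \<comment> \<open>The first term sums by invariance of \<open>R\<close>, the mixed terms by the
    definition of \<open>Z\<close> and its adjoint, the last by left canonicity. The mixed terms
    remove the norm of \<open>Z\<close> twice and the last restores it once.\<close>
  have "(\<Sum>s<d. weighted_norm_sq R (Y * B s - A s * Z)) = 
     ?t (Y * R * ?a Y) - ?t (1\<^sub>m \<chi> * Z * (R * ?a Z)) - ?t (Z * R * ?a Z * 1\<^sub>m \<chi>) + ?t (1\<^sub>m \<chi> * 1\<^sub>m \<chi> * (Z * R * ?a Z))"
    using sum_mat_trace_mult[OF c1(1) Y aY, unfolded BR] 
      sum_mat_trace_mult[OF c1(2) one_carrier_mat mult_carrier_mat[OF R aZ], folded mixed_transfer_def, folded Z_def]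
      sum_mat_trace_mult[OF c1(3) mult_carrier_mat[OF Z R] one_carrier_mat, unfolded aZe]
      sum_mat_trace_mult[OF c1(4) one_carrier_mat mult_carrier_mat[OF mult_carrier_mat[OF Z R] aZ],
        unfolded A1[unfolded mixed_transfer_def]]
    by (simp only: split sum.distrib sum_subtractf)
  also have "\<dots> = weighted_norm_sq R Y - weighted_norm_sq R Z"
    using Y Z R aZ by (simp add: weighted_norm_sq_def assoc_mult_mat[of Z \<chi> \<chi> R \<chi> "?a Z" \<chi>])
  finally show ?thesis .
qed

text \<open>The identity is itself a fixed point of the channel, so the common direction of all
  peripheral eigenvectors is that of the identity.\<close>

lemma transfer_peripheral_scalar:
  assumes inj: "left_canonical_injective d \<chi> A" and Y: "Y \<in> carrier_mat \<chi> \<chi>" 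
    and k: "k > 0" and mu: "cmod \<mu> = 1" and ev: "iterate_seq (\<lambda>_. transfer d \<chi> A) k Y = \<mu> \<cdot>\<^sub>m Y"
  shows "\<exists>c. Y = c \<cdot>\<^sub>m 1\<^sub>m \<chi>"
proof -
  let ?E = "transfer d \<chi> A" and ?T = "superop_mat \<chi> (transfer d \<chi> A)"
  have A: "\<forall>s<d. A s \<in> carrier_mat \<chi> \<chi>" and one: "?E (1\<^sub>m \<chi>) = 1\<^sub>m \<chi>"
    using inj by (auto simp: left_canonical_injective_def)
  have lin: "linear_superop \<chi> ?E"
    unfolding transfer_eq_mixed_transfer by (intro linear_superop_mixed_transfer A)
  have E1: "iterate_seq (\<lambda>_. ?E) 1 = ?E" by auto
  have pw: "superop_mat \<chi> (iterate_seq (\<lambda>_. ?E) m) = ?T ^\<^sub>m m" for m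
    using superop_mat_iterate_seq_mult[of \<chi> "\<lambda>_. ?E" 1 m, OF lin] by (simp only: E1 mult_1_right)
  obtain v where v: "v \<in> carrier_vec (\<chi> * \<chi>)" 
    "\<And>y k \<mu>. y \<in> carrier_vec (\<chi> * \<chi>) \<Longrightarrow> ?T ^\<^sub>m k *\<^sub>v y = \<mu> \<cdot>\<^sub>v y \<Longrightarrow> k > 0 \<Longrightarrow> cmod \<mu> = 1 \<Longrightarrow> \<exists>c. y = c \<cdot>\<^sub>v v"
    using peripheral_eigenvectors_parallel[OF superop_mat_carrier, of \<chi> ?E] inj
    unfolding left_canonical_injective_def by blast
  have par: "\<exists>c. vec_of_mat \<chi> X = c \<cdot>\<^sub>v v"
    if X: "X \<in> carrier_mat \<chi> \<chi>" and "k > 0" "cmod \<mu> = 1" "iterate_seq (\<lambda>_. ?E) k X = \<mu> \<cdot>\<^sub>m X" for X k \<mu>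
    using superop_mat_mult_vec[OF linear_superop_iterate_seq[of \<chi> "\<lambda>_. ?E", OF lin] X, of k]
      that v(2)[of "vec_of_mat \<chi> X" k \<mu>] vec_of_mat_smult[OF X] by (simp add: pw)
  obtain c0 where c0: "vec_of_mat \<chi> (1\<^sub>m \<chi>) = c0 \<cdot>\<^sub>v v"
  proof -
    have "1 \<cdot>\<^sub>m 1\<^sub>m \<chi> = (1\<^sub>m \<chi> :: complex mat)" by (intro eq_matI) auto
    thus ?thesis using par[of "1\<^sub>m \<chi>" 1 1] one that by auto
  qed
  obtain c where c: "vec_of_mat \<chi> Y = c \<cdot>\<^sub>v v" using par[OF Y k mu ev] by blast
  have "c0 \<noteq> 0 \<or> \<chi> = 0"
  proof (rule ccontr)
    assume n: "\<not> (c0 \<noteq> 0 \<or> \<chi> = 0)"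
    hence "vec_of_mat \<chi> (1\<^sub>m \<chi>) $ 0 = 0" using c0 v(1) by simp
    thus False using n by (simp add: vec_of_mat_def)
  qed
  \<comment> \<open>For \<open>\<chi> = 0\<close> the divisor may be zero, but then both sides are
    the empty vector.\<close>
  have "vec_of_mat \<chi> Y = (c / c0) \<cdot>\<^sub>v vec_of_mat \<chi> (1\<^sub>m \<chi>)"
  proof (cases "\<chi> = 0")
    case False
    thus ?thesis using \<open>c0 \<noteq> 0 \<or> \<chi> = 0\<close> by (simp add: c c0 smult_smult_assoc)
  qed (auto simp: vec_of_mat_def)
  hence "vec_of_mat \<chi> Y = vec_of_mat \<chi> ((c / c0) \<cdot>\<^sub>m 1\<^sub>m \<chi>)" by (simp add: vec_of_mat_smult)
  hence "Y = (c / c0) \<cdot>\<^sub>m 1\<^sub>m \<chi>" by (intro vec_of_mat_inject[OF Y]) auto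
  thus ?thesis by blast
qed

lemma mixed_transfer_smult:
  assumes A: "\<forall>s<d. A s \<in> carrier_mat \<chi> \<chi>" and B: "\<forall>s<d. B s \<in> carrier_mat \<chi> \<chi>" and Y: "Y \<in> carrier_mat \<chi> \<chi>"
  shows "mixed_transfer d \<chi> A B (c \<cdot>\<^sub>m Y) = c \<cdot>\<^sub>m mixed_transfer d \<chi> A B Y"
proof (rule eq_matI)
  fix i j assume "i < dim_row (c \<cdot>\<^sub>m mixed_transfer d \<chi> A B Y)" "j < dim_col (c \<cdot>\<^sub>m mixed_transfer d \<chi> A B Y)"
  hence ij: "i < \<chi>" "j < \<chi>" using mixed_transfer_carrier[of d \<chi> A B Y] by (auto simp del: mixed_transfer_carrier)
  show "mixed_transfer d \<chi> A B (c \<cdot>\<^sub>m Y) $$ (i, j) = (c \<cdot>\<^sub>m mixed_transfer d \<chi> A B Y) $$ (i, j)"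
    using ij Y carrier_matD[OF mixed_transfer_carrier[of d \<chi> A B Y]]
    by (simp add: mixed_transfer_index[OF A B] sum_distrib_left ac_simps)
qed (simp_all add: mixed_transfer_def mat_sum_def)

text \<open>Left canonicity, the sum of \<open>A s\<close> adjoint times \<open>A s\<close> being
  the identity, strips the tensor off an intertwining relation.\<close>

lemma mixed_transfer_intertwined:
  assumes A: "\<forall>s<d. A s \<in> carrier_mat \<chi> \<chi>" and A1: "transfer d \<chi> A (1\<^sub>m \<chi>) = 1\<^sub>m \<chi>"
    and R: "Q \<in> carrier_mat \<chi> \<chi>" and eq: "\<forall>s<d. F s = A s * Q"
  shows "mat_sum \<chi> d (\<lambda>s. mat_adjoint (A s) * F s) = Q"
proof -
  have c: "\<forall>s<d. mat_adjoint (A s) * 1\<^sub>m \<chi> * A s \<in> carrier_mat \<chi> \<chi>" 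
    using A by (simp add: square_mat_closed)
  have "mat_sum \<chi> d (\<lambda>s. mat_adjoint (A s) * F s) = mat_sum \<chi> d (\<lambda>s. mat_adjoint (A s) * 1\<^sub>m \<chi> * A s * Q)"
  proof (rule mat_sum_cong)
    fix s assume s: "s < d"
    hence "A s \<in> carrier_mat \<chi> \<chi>" using A by simp
    thus "mat_adjoint (A s) * F s = mat_adjoint (A s) * 1\<^sub>m \<chi> * A s * Q"
      using eq s R by (simp add: square_mat_closed right_mult_one_mat[of _ \<chi> \<chi>] 
        assoc_mult_mat[of _ \<chi> \<chi> _ \<chi> _ \<chi>])
  qed
  also have "\<dots> = transfer d \<chi> A (1\<^sub>m \<chi>) * Q"
    unfolding transfer_def by (rule mat_sum_mult[symmetric, OF R c])
  finally show ?thesis using R A1 by simp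
qed

text \<open>Stripping off the tensor shows that the transfer channel maps each \<open>R n\<close> to
  its successor. After \<open>L\<close> steps this makes \<open>R 0\<close> a peripheral
  eigenvector, hence a scalar matrix.\<close>

lemma intertwiner_chain_scalar:
  assumes inj: "left_canonical_injective d \<chi> A" and R: "\<And>n. R n \<in> carrier_mat \<chi> \<chi>"
    and int: "\<And>n s. s < d \<Longrightarrow> R n * A s = A s * R (Suc n)"
    and L: "L \<ge> 1" and mu: "cmod \<mu> = 1" and per: "R L = \<mu> \<cdot>\<^sub>m R 0"
  shows "\<exists>c. \<forall>n. R n = c \<cdot>\<^sub>m 1\<^sub>m \<chi>"
proof -
  have A: "\<forall>s<d. A s \<in> carrier_mat \<chi> \<chi>" and one: "transfer d \<chi> A (1\<^sub>m \<chi>) = 1\<^sub>m \<chi>"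
    using inj by (auto simp: left_canonical_injective_def)
  have step: "transfer d \<chi> A (R n) = R (Suc n)" for n
  proof -
    have "transfer d \<chi> A (R n) = mat_sum \<chi> d (\<lambda>s. mat_adjoint (A s) * (R n * A s))"
      unfolding transfer_def by (rule mat_sum_cong, rule assoc_mult_mat) (use A R in auto)
    also have "\<dots> = R (Suc n)" by (rule mixed_transfer_intertwined[OF A one R]) (use int in auto)
    finally show ?thesis .
  qed
  have it: "iterate_seq (\<lambda>_. transfer d \<chi> A) n (R 0) = R n" for n
    by (induction n) (auto simp: step)
  obtain c where c: "R 0 = c \<cdot>\<^sub>m 1\<^sub>m \<chi>"
    using transfer_peripheral_scalar[OF inj R, of L \<mu> 0] L mu per it[of L] by auto
  \<comment> \<open>The same scalar persists along the chain because the channel fixes the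
    identity.\<close>
  have "R n = c \<cdot>\<^sub>m 1\<^sub>m \<chi>" for n
  proof (induction n)
    case (Suc n)
    thus ?case using step[of n] mixed_transfer_smult[OF A A one_carrier_mat, of c] one
      by (simp add: transfer_eq_mixed_transfer)
  qed (rule c)
  thus ?thesis by blast
qed

text \<open>Unimodular phases cancel between a tensor and its adjoint, and the relabelling merely
  permutes the sum. The transformed tensor therefore shares the channel of \<open>A\<close> and the
  fixed point of its dual.\<close>

lemma monomial_action_invariant:
  assumes A: "\<forall>s<d. A s \<in> carrier_mat \<chi> \<chi>" and bij: "bij_betw (\<pi> n) {..<d} {..<d}" 
    and p: "\<forall>s<d. cmod (p n s) = 1" and R: "R \<in> carrier_mat \<chi> \<chi>"
  defines "B \<equiv> monomial_action p \<pi> A n"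
  shows "mat_sum \<chi> d (\<lambda>s. B s * R * mat_adjoint (B s)) = mat_sum \<chi> d (\<lambda>s. A s * R * mat_adjoint (A s))"
    and "mat_sum \<chi> d (\<lambda>s. mat_adjoint (B s) * R * B s) = mat_sum \<chi> d (\<lambda>s. mat_adjoint (A s) * R * A s)"
proof -
  have u: "p n s * cnj (p n s) = 1" "cnj (p n s) * p n s = 1" if "s < d" for s
    using p that by (simp_all add: complex_norm_square[symmetric] mult.commute[of "cnj _"])
  have pi: "A (\<pi> n s) \<in> carrier_mat \<chi> \<chi>" if "s < d" for s
    using A bij_betwE[OF bij] that by auto
  have re: "mat_sum \<chi> d (\<lambda>s. F (\<pi> n s)) = mat_sum \<chi> d F" for F
  proof -
    have "(\<Sum>s<d. F (\<pi> n s) $$ (i, j)) = (\<Sum>s<d. F s $$ (i, j))" for i j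
      by (rule sum.reindex_bij_betw[OF bij])
    thus ?thesis by (simp add: mat_sum_def)
  qed
  have e1: "(c \<cdot>\<^sub>m X) * R * mat_adjoint (c \<cdot>\<^sub>m X) = (c * cnj c) \<cdot>\<^sub>m (X * R * mat_adjoint X)"
    and e2: "mat_adjoint (c \<cdot>\<^sub>m X) * R * (c \<cdot>\<^sub>m X) = (c * cnj c) \<cdot>\<^sub>m (mat_adjoint X * R * X)"
    if X: "X \<in> carrier_mat \<chi> \<chi>" for c X
    using R X by (simp_all add: mat_adjoint_smult[OF X] square_mat_closed mult_smult_assoc_mat[of _ \<chi> \<chi> _ \<chi>]
      mult_smult_distrib[of _ \<chi> \<chi> _ \<chi>] smult_smult_mat mult.commute)
  have "mat_sum \<chi> d (\<lambda>s. B s * R * mat_adjoint (B s)) = 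
      mat_sum \<chi> d (\<lambda>s. A (\<pi> n s) * R * mat_adjoint (A (\<pi> n s)))"
    by (rule mat_sum_cong) (simp only: B_def monomial_action_def e1 pi u, auto intro!: eq_matI)
  thus "mat_sum \<chi> d (\<lambda>s. B s * R * mat_adjoint (B s)) = mat_sum \<chi> d (\<lambda>s. A s * R * mat_adjoint (A s))"
    by (simp add: re[of "\<lambda>s. A s * R * mat_adjoint (A s)"])
  have "mat_sum \<chi> d (\<lambda>s. mat_adjoint (B s) * R * B s) = 
      mat_sum \<chi> d (\<lambda>s. mat_adjoint (A (\<pi> n s)) * R * A (\<pi> n s))"
    by (rule mat_sum_cong) (simp only: B_def monomial_action_def e2 pi u, auto intro!: eq_matI)
  thus "mat_sum \<chi> d (\<lambda>s. mat_adjoint (B s) * R * B s) = mat_sum \<chi> d (\<lambda>s. mat_adjoint (A s) * R * A s)"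
    by (simp add: re[of "\<lambda>s. mat_adjoint (A s) * R * A s"])
qed

text \<open>The scalar is the squared length of any column, and some column is nonzero. It supplies
  the real factor that normalizes \<open>Z\<close> to a unitary.\<close>

lemma scalar_mat_of_adjoint_mult_pos:
  assumes Z: "Z \<in> carrier_mat \<chi> \<chi>" and nz: "Z \<noteq> 0\<^sub>m \<chi> \<chi>" and c: "mat_adjoint Z * Z = c \<cdot>\<^sub>m 1\<^sub>m \<chi>"
  shows "\<exists>r>0. c = complex_of_real r"
proof -
  obtain k i where ki: "k < \<chi>" "i < \<chi>" "Z $$ (k, i) \<noteq> 0" 
    using Z nz by (metis (no_types, lifting) carrier_matD eq_matI index_zero_mat)
  have "c = (c \<cdot>\<^sub>m 1\<^sub>m \<chi>) $$ (i, i)" using ki by simp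
  also have "\<dots> = (\<Sum>k<\<chi>. cnj (Z $$ (k, i)) * Z $$ (k, i))"
    using ki by (simp add: c[symmetric] mult_mat_index_sum[OF mat_adjoint_carrier[OF Z] Z] mat_adjoint_index[OF Z]
      del: index_mult_mat)
  also have "\<dots> = complex_of_real (\<Sum>k<\<chi>. (cmod (Z $$ (k, i)))\<^sup>2)"
    unfolding of_real_sum by (simp only: mult.commute[of "cnj _"] complex_norm_square)
  finally have "c = complex_of_real (\<Sum>k<\<chi>. (cmod (Z $$ (k, i)))\<^sup>2)" .
  moreover have "(\<Sum>k<\<chi>. (cmod (Z $$ (k, i)))\<^sup>2) > 0"
    by (rule sum_pos2[of _ k]) (use ki in auto)
  ultimately show ?thesis by blast
qed

lemma minus_eq_zero_mat:
  fixes A B :: "complex mat"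
  assumes "A \<in> carrier_mat m n" "B \<in> carrier_mat m n" "A - B = 0\<^sub>m m n"
  shows "A = B"
proof (rule eq_matI)
  fix i j assume "i < dim_row B" "j < dim_col B"
  moreover from this have "(A - B) $$ (i, j) = 0" using assms by auto
  ultimately show "A $$ (i, j) = B $$ (i, j)" by simp
qed (use assms in auto)

text \<open>Along the orbit \<open>Z\<close> of the eigenvector the weighted norm cannot grow, yet
  one period multiplies it by the square of \<open>cmod \<mu>\<close>, which is at least one. So it
  is constant, every deficit vanishes, and the intertwining relation holds exactly at each site.
  Then \<open>Z n\<close> adjoint times \<open>Z n\<close> runs through a chain of the plain channel
  and must be scalar.\<close>

lemma symmetric_mps_virtual_unitaries:
  assumes inj: "left_canonical_injective d \<chi> A" and bij: "\<And>n. bij_betw (\<pi> n) {..<d} {..<d}"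
    and p: "\<And>n. \<forall>s<d. cmod (p n s) = 1"
    and L: "L \<ge> 1" and r: "r \<ge> 1" and per: "\<And>n. p (n + L) = p n" "\<And>n. \<pi> (n + L) = \<pi> n"
    and sym: "\<And>m. m \<ge> 1 \<Longrightarrow> \<exists>\<theta>::real. \<forall>s\<in>configs d (m * r * L).
       (\<Prod>n<m * r * L. p n (s ! n)) * mps \<chi> A (relabel \<pi> s) = cis \<theta> * mps \<chi> A s"
  obtains \<mu> V where "cmod \<mu> = 1" "\<And>n. V n \<in> carrier_mat \<chi> \<chi>" 
    "\<And>n. mat_adjoint (V n) * V n = 1\<^sub>m \<chi>" "\<And>n. V n * mat_adjoint (V n) = 1\<^sub>m \<chi>"
    "\<And>n. V (n + L) = \<mu> \<cdot>\<^sub>m V n" 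
    "\<And>n s. s < d \<Longrightarrow> p n s \<cdot>\<^sub>m (V n * A (\<pi> n s)) = A s * V (Suc n)"
proof -
  have A: "\<forall>s<d. A s \<in> carrier_mat \<chi> \<chi>" and one: "transfer d \<chi> A (1\<^sub>m \<chi>) = 1\<^sub>m \<chi>"
    using inj by (auto simp: left_canonical_injective_def)
  obtain R where pd: "positive_definite \<chi> R" and AR: "mat_sum \<chi> d (\<lambda>s. A s * R * mat_adjoint (A s)) = R"
    using inj unfolding left_canonical_injective_def by blast
  have R: "R \<in> carrier_mat \<chi> \<chi>" using pd by (simp add: positive_definite_def)
  let ?B = "monomial_action p \<pi> A"
  let ?F = "\<lambda>n. mixed_transfer d \<chi> A (?B n)"
  have pi: "\<forall>n. \<forall>x<d. \<pi> n x < d" using bij_betwE[OF bij] by auto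
  have B: "\<forall>s<d. ?B n s \<in> carrier_mat \<chi> \<chi>" for n
    using A pi by (auto simp: monomial_action_def)
  obtain \<mu> Y where mu: "cmod \<mu> \<ge> 1" and Y: "Y \<in> carrier_mat \<chi> \<chi>" "Y \<noteq> 0\<^sub>m \<chi> \<chi>"
    and ev: "iterate_seq ?F L Y = \<mu> \<cdot>\<^sub>m Y"
    using symmetric_mps_peripheral_eigenvector[where p = p and \<pi> = \<pi>, OF inj pi L r per sym] by metis
  define Z where "Z = (\<lambda>n. iterate_seq ?F n Y)"
  have Z0: "Z 0 = Y" and ZS: "Z (Suc n) = ?F n (Z n)" for n by (simp_all add: Z_def)
  have Z: "Z n \<in> carrier_mat \<chi> \<chi>" for n using Y by (cases n) (simp_all add: Z_def)
  have perF: "?F (n + L) = ?F n" for n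
  proof -
    have "?B (n + L) = ?B n" by (rule ext) (simp add: monomial_action_def per)
    thus ?thesis by simp
  qed
  have ZL: "Z (n + L) = \<mu> \<cdot>\<^sub>m Z n" for n
  proof (induction n)
    case 0
    thus ?case using ev by (simp add: Z_def)
  next
    case (Suc n)
    thus ?case using mixed_transfer_smult[OF A B[of n] Z[of n], of \<mu>] perF[of n] by (simp add: ZS)
  qed
  let ?N = "\<lambda>Y. Re (weighted_norm_sq R Y)"
  have def: "(\<Sum>s<d. ?N (Z n * ?B n s - A s * Z (Suc n))) = ?N (Z n) - ?N (Z (Suc n))" for n
    using arg_cong[OF mixed_transfer_deficit[OF A B[of n] one[unfolded transfer_eq_mixed_transfer] R _ Z[of n]], of Re]
      monomial_action_invariant(1)[where p = p and \<pi> = \<pi>, OF A bij[of n] p[of n] R] AR by (simp add: ZS)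
  have dc: "Z n * ?B n s - A s * Z (Suc n) \<in> carrier_mat \<chi> \<chi>" if "s < d" for n s
    using A B Z that by (intro minus_carrier_mat) (auto simp: square_mat_closed)
  have mono: "?N (Z (Suc n)) \<le> ?N (Z n)" for n
    using def[of n] sum_nonneg[of "{..<d}" "\<lambda>s. ?N (Z n * ?B n s - A s * Z (Suc n))"]
      weighted_norm_sq_nonneg_pos(1)[OF pd dc] by fastforce
  have anti: "?N (Z (n + k)) \<le> ?N (Z n)" for n k
    by (induction k) (auto intro: order_trans[OF mono])
  have mu2: "(cmod \<mu>)\<^sup>2 \<ge> 1" using mu by simp
  have NL: "?N (Z (n + L)) = (cmod \<mu>)\<^sup>2 * ?N (Z n)" for n
    by (simp add: ZL weighted_norm_sq_smult[OF R Z])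
  \<comment> \<open>Squeeze over one period: \<open>Suc n\<close> and the \<open>L - 1\<close>
    further steps end at \<open>n + L\<close>.\<close>
  have const: "?N (Z (Suc n)) = ?N (Z n)" for n
  proof -
    have "?N (Z n) \<le> (cmod \<mu>)\<^sup>2 * ?N (Z n)" 
      using mult_right_mono[OF mu2 weighted_norm_sq_nonneg_pos(1)[OF pd Z[of n]]] by simp
    also have "\<dots> \<le> ?N (Z (Suc n))"
      using anti[of "Suc n" "L - 1"] L by (simp add: NL[symmetric])
    finally show ?thesis using mono[of n] by simp
  qed
  have Zint: "Z n * ?B n s = A s * Z (Suc n)" if s: "s < d" for n s
  proof (rule ccontr)
    assume ne: "Z n * ?B n s \<noteq> A s * Z (Suc n)"
    have c: "Z n * ?B n s \<in> carrier_mat \<chi> \<chi>" "A s * Z (Suc n) \<in> carrier_mat \<chi> \<chi>"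
      using A B Z s by (auto simp: square_mat_closed)
    have "Z n * ?B n s - A s * Z (Suc n) \<noteq> 0\<^sub>m \<chi> \<chi>"
    proof
      assume z: "Z n * ?B n s - A s * Z (Suc n) = 0\<^sub>m \<chi> \<chi>"
      have "Z n * ?B n s = A s * Z (Suc n)" by (rule minus_eq_zero_mat[OF c z])
      thus False using ne by simp
    qed
    hence "?N (Z n * ?B n s - A s * Z (Suc n)) > 0" 
      by (rule weighted_norm_sq_nonneg_pos(2)[OF pd dc[OF s]])
    hence "(\<Sum>s<d. ?N (Z n * ?B n s - A s * Z (Suc n))) > 0"
      by (intro sum_pos2[of _ s]) (use s weighted_norm_sq_nonneg_pos(1)[OF pd dc] in auto)
    thus False using def[of n] const[of n] by simp
  qed
  \<comment> \<open>The constant norm is nonzero because \<open>Y\<close> is, so the factor gained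
    over a period equals one.\<close>
  have mu1: "cmod \<mu> = 1"
  proof -
    have "?N (Z L) = ?N (Z 0)"
    proof -
      have "?N (Z n) = ?N (Z 0)" for n by (induction n) (auto simp: const)
      thus ?thesis .
    qed
    hence "(cmod \<mu>)\<^sup>2 * ?N (Z 0) = ?N (Z 0)" using NL[of 0] by simp
    moreover have "?N (Z 0) > 0" using weighted_norm_sq_nonneg_pos(2)[OF pd Y] Z0 by simp
    ultimately show ?thesis using mu by (auto simp: power2_eq_1_iff)
  qed
  \<comment> \<open>By invariance the channel of \<open>A\<close> may be evaluated with the
    transformed tensor, which the intertwining relation converts back into \<open>A\<close> next to
    \<open>Z (Suc n)\<close>.\<close>
  have adj: "transfer d \<chi> A (mat_adjoint (Z n) * Z n) = mat_adjoint (Z (Suc n)) * Z (Suc n)" for n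
  proof -
    let ?Q = "mat_adjoint (Z n) * Z n" and ?Z' = "Z (Suc n)"
    have Q: "?Q \<in> carrier_mat \<chi> \<chi>" using Z by (simp add: square_mat_closed)
    have "transfer d \<chi> A ?Q = mat_sum \<chi> d (\<lambda>s. mat_adjoint (?B n s) * ?Q * ?B n s)"
      unfolding transfer_def by (rule monomial_action_invariant(2)[where p = p and \<pi> = \<pi>, symmetric, OF A bij[of n] p[of n] Q])
    also have "\<dots> = mat_sum \<chi> d (\<lambda>s. mat_adjoint ?Z' * (mat_adjoint (A s) * (A s * ?Z')))"
    proof (rule mat_sum_cong)
      fix s assume s: "s < d"
      have As: "A s \<in> carrier_mat \<chi> \<chi>" and Bs: "?B n s \<in> carrier_mat \<chi> \<chi>" using A B s by auto
      have "mat_adjoint (?B n s) * ?Q * ?B n s = mat_adjoint (Z n * ?B n s) * (Z n * ?B n s)"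
        using Bs Z[of n] by (simp add: mat_adjoint_mult[OF Z Bs] square_mat_closed assoc_mult_mat[of _ \<chi> \<chi> _ \<chi> _ \<chi>])
      also have "\<dots> = mat_adjoint ?Z' * (mat_adjoint (A s) * (A s * ?Z'))"
        using As Z[of "Suc n"] by (simp add: Zint[OF s] mat_adjoint_mult[OF As Z] square_mat_closed 
          assoc_mult_mat[of _ \<chi> \<chi> _ \<chi> _ \<chi>])
      finally show "mat_adjoint (?B n s) * ?Q * ?B n s = mat_adjoint ?Z' * (mat_adjoint (A s) * (A s * ?Z'))" .
    qed
    also have "\<dots> = mat_adjoint ?Z' * mat_sum \<chi> d (\<lambda>s. mat_adjoint (A s) * (A s * ?Z'))"
      by (rule mult_mat_sum[symmetric]) (use A Z in \<open>simp_all add: square_mat_closed\<close>)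
    also have "mat_sum \<chi> d (\<lambda>s. mat_adjoint (A s) * (A s * ?Z')) = ?Z'"
      by (rule mixed_transfer_intertwined[OF A one Z]) simp
    finally show ?thesis .
  qed
  have it: "iterate_seq (\<lambda>_. transfer d \<chi> A) n (mat_adjoint (Z 0) * Z 0) = mat_adjoint (Z n) * Z n" for n
    by (induction n) (auto simp: adj)
  \<comment> \<open>The phase \<open>\<mu>\<close> meets its conjugate, and the product is
    unimodular.\<close>
  have "mat_adjoint (Z L) * Z L = (\<mu> * cnj \<mu>) \<cdot>\<^sub>m (mat_adjoint (Z 0) * Z 0)"
    using ZL[of 0] Z[of 0] by (simp add: mat_adjoint_smult[OF Z] square_mat_closed mult_smult_assoc_mat[of _ \<chi> \<chi> _ \<chi>]
      mult_smult_distrib[of _ \<chi> \<chi> _ \<chi>] smult_smult_mat mult.commute)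
  hence "iterate_seq (\<lambda>_. transfer d \<chi> A) L (mat_adjoint (Z 0) * Z 0) = (\<mu> * cnj \<mu>) \<cdot>\<^sub>m (mat_adjoint (Z 0) * Z 0)"
    by (simp only: it)
  then obtain c where c0: "mat_adjoint (Z 0) * Z 0 = c \<cdot>\<^sub>m 1\<^sub>m \<chi>"
    using transfer_peripheral_scalar[OF inj, of "mat_adjoint (Z 0) * Z 0" L "\<mu> * cnj \<mu>"] Z[of 0] L mu1
    by (auto simp: square_mat_closed norm_mult)
  have c: "mat_adjoint (Z n) * Z n = c \<cdot>\<^sub>m 1\<^sub>m \<chi>" for n
  proof (induction n)
    case (Suc n)
    thus ?case using adj[of n] mixed_transfer_smult[OF A A one_carrier_mat, of c] one
      by (simp add: transfer_eq_mixed_transfer)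
  qed (rule c0)
  obtain \<nu> where nu: "\<nu> > 0" "c = complex_of_real \<nu>"
    using scalar_mat_of_adjoint_mult_pos[OF Z _ c, of 0] Y(2) Z0 by auto
  \<comment> \<open>One normalization serves all sites, since the scalar \<open>c\<close> does not
    depend on \<open>n\<close>.\<close>
  define k where "k = complex_of_real (1 / sqrt \<nu>)"
  have "(1 / sqrt \<nu>) * (1 / sqrt \<nu>) * \<nu> = 1" using nu by (simp add: field_simps)
  hence kk: "k * cnj k * c = 1" unfolding k_def nu(2) complex_cnj_complex_of_real of_real_mult[symmetric] 
    by simp
  define V where "V = (\<lambda>n. k \<cdot>\<^sub>m Z n)"
  have V: "V n \<in> carrier_mat \<chi> \<chi>" for n using Z by (simp add: V_def)
  have VV: "mat_adjoint (V n) * V n = 1\<^sub>m \<chi>" for n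
  proof -
    have "mat_adjoint (V n) * V n = (k * cnj k) \<cdot>\<^sub>m (mat_adjoint (Z n) * Z n)"
      using Z[of n] by (simp add: V_def mat_adjoint_smult[OF Z] square_mat_closed mult_smult_assoc_mat[of _ \<chi> \<chi> _ \<chi>]
        mult_smult_distrib[of _ \<chi> \<chi> _ \<chi>] smult_smult_mat mult.commute)
    also have "\<dots> = 1\<^sub>m \<chi>" by (simp only: c smult_smult_mat kk) (auto intro!: eq_matI)
    finally show ?thesis .
  qed
  show ?thesis
  proof (rule that[of \<mu> V])
    show "V n * mat_adjoint (V n) = 1\<^sub>m \<chi>" for n
      by (rule mat_mult_left_right_inverse[OF _ V VV]) (use V in \<open>simp add: square_mat_closed\<close>)
    show "V (n + L) = \<mu> \<cdot>\<^sub>m V n" for n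
      by (simp add: V_def ZL smult_smult_mat mult.commute)
    show "p n s \<cdot>\<^sub>m (V n * A (\<pi> n s)) = A s * V (Suc n)" if s: "s < d" for n s
    proof -
      have c: "A s \<in> carrier_mat \<chi> \<chi>" "A (\<pi> n s) \<in> carrier_mat \<chi> \<chi>" using A pi s by auto
      have "p n s \<cdot>\<^sub>m (V n * A (\<pi> n s)) = k \<cdot>\<^sub>m (Z n * ?B n s)"
        using c Z[of n] by (simp add: V_def monomial_action_def mult_smult_assoc_mat[of _ \<chi> \<chi> _ \<chi>]
          mult_smult_distrib[of _ \<chi> \<chi> _ \<chi>] smult_smult_mat mult.commute)
      also have "\<dots> = A s * V (Suc n)"
        using c Z[of "Suc n"] by (simp add: Zint[OF s] V_def mult_smult_distrib[of _ \<chi> \<chi> _ \<chi>])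
      finally show ?thesis .
    qed
  qed (use mu1 V VV in auto)
qed

section \<open>The algebra of the virtual unitaries\<close>

definition unitary_mat :: "nat \<Rightarrow> complex mat \<Rightarrow> bool" where
  "unitary_mat n U \<longleftrightarrow> U \<in> carrier_mat n n \<and> mat_adjoint U * U = 1\<^sub>m n \<and> U * mat_adjoint U = 1\<^sub>m n"

lemma unitary_matD:
  assumes "unitary_mat n U"
  shows "U \<in> carrier_mat n n" "mat_adjoint U \<in> carrier_mat n n" 
    "mat_adjoint U * U = 1\<^sub>m n" "U * mat_adjoint U = 1\<^sub>m n"
  using assms by (auto simp: unitary_mat_def)

lemma unitary_mat_cancel:
  assumes U: "unitary_mat n U" and X: "X \<in> carrier_mat n m"
  shows "mat_adjoint U * (U * X) = X" "U * (mat_adjoint U * X) = X"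
  using assoc_mult_mat[of "mat_adjoint U" n n U n X m] assoc_mult_mat[of U n n "mat_adjoint U" n X m]
    unitary_matD[OF U] X by simp_all

lemma unitary_mat_mult:
  assumes U: "unitary_mat n U" and V: "unitary_mat n V"
  shows "unitary_mat n (U * V)"
proof -
  note u = unitary_matD[OF U] and v = unitary_matD[OF V]
  show ?thesis
    unfolding unitary_mat_def mat_adjoint_mult[OF u(1) v(1)]
    using u v by (simp add: square_mat_closed assoc_mult_mat[of _ n n _ n _ n] unitary_mat_cancel[OF U, of _ n] unitary_mat_cancel[OF V, of _ n])
qed

lemma unitary_mat_pow: "unitary_mat n U \<Longrightarrow> unitary_mat n (U ^\<^sub>m k)"
proof (induction k)
  case 0
  have "dim_row U = n" using unitary_matD(1)[OF 0] by simp
  thus ?case by (simp add: unitary_mat_def mat_adjoint_one)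
next
  case (Suc k)
  thus ?case using unitary_mat_mult[of n "U ^\<^sub>m k" U] by simp
qed

text \<open>Inverts an intertwining relation, so that inverses of powers of \<open>V n\<close> and
  of \<open>W\<close> can be carried past the tensor as well.\<close>

lemma unitary_mat_flip:
  assumes P: "unitary_mat n P" and Q: "unitary_mat n Q" and X: "X \<in> carrier_mat n n" and Y: "Y \<in> carrier_mat n n"
    and eq: "P * X = Y * Q"
  shows "mat_adjoint P * Y = X * mat_adjoint Q"
proof -
  note p = unitary_matD[OF P] and q = unitary_matD[OF Q]
  have "X * mat_adjoint Q = mat_adjoint P * (P * X) * mat_adjoint Q"
    by (simp only: unitary_mat_cancel[OF P X])
  also have "\<dots> = mat_adjoint P * (Y * (Q * mat_adjoint Q))"
    unfolding eq using p q Y by (simp add: square_mat_closed assoc_mult_mat[of _ n n _ n _ n])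
  also have "\<dots> = mat_adjoint P * Y" using q Y by simp
  finally show ?thesis ..
qed

section \<open>Powers and scalar multiples of matrices, and N-th roots of unity\<close>

lemma pow_mat_commute: 
  fixes A :: "complex mat"
  assumes A: "A \<in> carrier_mat n n"
  shows "A * A ^\<^sub>m k = A ^\<^sub>m k * A"
proof (induction k)
  case (Suc k)
  have "A * A ^\<^sub>m Suc k = A * A ^\<^sub>m k * A"
    using A by (simp add: assoc_mult_mat[of A n n "A ^\<^sub>m k" n A n])
  thus ?case using Suc by simp
qed (use A in simp)

lemma pow_mat_smult:
  fixes A :: "complex mat"
  assumes A: "A \<in> carrier_mat n n"
  shows "(c \<cdot>\<^sub>m A) ^\<^sub>m k = c ^ k \<cdot>\<^sub>m A ^\<^sub>m k"
proof (induction k)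
  case 0
  show ?case using A by (auto intro!: eq_matI)
next
  case (Suc k)
  thus ?case using A by (simp add: mult_smult_assoc_mat[of _ n n _ n] mult_smult_distrib[of _ n n _ n] 
      smult_smult_mat mult.commute)
qed

lemma pow_mat_pow:
  fixes A :: "complex mat"
  assumes A: "A \<in> carrier_mat n n"
  shows "(A ^\<^sub>m j) ^\<^sub>m k = A ^\<^sub>m (j * k)"
proof -
  interpret semiring "ring_mat TYPE(complex) n ()" by (rule semiring_mat)
  have "A \<in> carrier (ring_mat TYPE(complex) n ())" using A by (simp add: ring_mat_simps)
  from nat_pow_pow[OF this, of j k] show ?thesis
    using pow_mat_ring_pow[OF A, of _ "()"] pow_mat_ring_pow[OF pow_carrier_mat[OF A, of j], of k "()"] by simp
qed

lemma one_smult_mat: "1 \<cdot>\<^sub>m A = (A :: complex mat)"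
  by (intro eq_matI) auto

lemma pow_mat_one: "(1\<^sub>m n :: complex mat) ^\<^sub>m k = 1\<^sub>m n"
  by (induction k) auto

lemma smult_one_mat_inject:
  "n > 0 \<Longrightarrow> c \<cdot>\<^sub>m 1\<^sub>m n = d \<cdot>\<^sub>m (1\<^sub>m n :: complex mat) \<Longrightarrow> c = d"
  by (drule arg_cong[of _ _ "\<lambda>A. A $$ (0, 0)"]) simp

text \<open>The character sending \<open>z\<close> to omega to the power \<open>z\<close>, taken on
  all integers so that labels such as \<open>z - a ^ n\<close> need no reduction modulo
  \<open>N\<close>.\<close>

definition phase :: "nat \<Rightarrow> int \<Rightarrow> complex" where
  "phase N z = cis (2 * pi * real_of_int z / real N)"

lemma phase_add: "phase N (y + z) = phase N y * phase N z"
  by (simp add: phase_def cis_mult add_divide_distrib algebra_simps)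

lemma cmod_phase [simp]: "cmod (phase N z) = 1"
  by (simp add: phase_def)

lemma phase_minus: "phase N z * phase N (- z) = 1" "phase N (- z) * phase N z = 1"
  using phase_add[of N z "- z"] phase_add[of N "- z" z] by (simp_all add: phase_def)

lemma phase_pow: "phase N z ^ k = phase N (int k * z)"
  by (simp add: phase_def DeMoivre algebra_simps)

text \<open>The algebraic core. \<open>Ah\<close> extends the tensor periodically to integer labels,
  so shifting and negating labels become plain integer operations. Each scalar below arises as a
  chain that commutes with the tensor.\<close>

lemma clock_shift_anomaly:
  fixes A :: "nat \<Rightarrow> complex mat" and a :: int
  assumes N: "N > 0" "even N" and a: "odd a" and inj: "left_canonical_injective N \<chi> A"
    and L: "L \<ge> 1" and mu: "cmod \<mu> = 1" and eta: "cmod \<eta> = 1"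
    and V: "\<And>n. unitary_mat \<chi> (V n)" and W: "unitary_mat \<chi> W"
    and VL: "\<And>n. V (n + L) = \<mu> \<cdot>\<^sub>m V n"
  defines "Ah \<equiv> \<lambda>z. A (nat (z mod int N))"
  assumes VA: "\<And>n z. V n * Ah (z - a ^ n) = Ah z * V (Suc n)"
    and WA: "\<And>z. phase N (- z) \<cdot>\<^sub>m (W * Ah (- z)) = \<eta> \<cdot>\<^sub>m (Ah z * W)"
  shows False
proof -
  have A: "\<forall>s<N. A s \<in> carrier_mat \<chi> \<chi>" using inj by (auto simp: left_canonical_injective_def)
  have chi: "\<chi> > 0"
  proof (rule ccontr)
    assume "\<not> \<chi> > 0"
    hence "mat_trace X = 0" if "X \<in> carrier_mat \<chi> \<chi>" for X using that by (simp add: mat_trace_eq[of _ \<chi>])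
    thus False using inj by (auto simp: left_canonical_injective_def positive_definite_def)
  qed
  have Ah: "Ah z \<in> carrier_mat \<chi> \<chi>" for z
    unfolding Ah_def using A N by (simp add: nat_less_iff)
  have As: "A s = Ah (int s)" if "s < N" for s using that by (simp add: Ah_def)
  have per: "Ah (z + k * int N) = Ah z" for z k by (simp add: Ah_def)
  note v = unitary_matD[OF V] and w = unitary_matD[OF W]
  note sq = square_mat_closed assoc_mult_mat[of _ \<chi> \<chi> _ \<chi> _ \<chi>]
  note sm = mult_smult_assoc_mat[of _ \<chi> \<chi> _ \<chi>] mult_smult_distrib[of _ \<chi> \<chi> _ \<chi>] smult_smult_mat
  have pow: "V n ^\<^sub>m k * Ah (z - int k * a ^ n) = Ah z * V (Suc n) ^\<^sub>m k" for n k z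
  proof (induction k arbitrary: z)
    case 0
    show ?case using carrier_matD(1)[OF v(1)[of n]] carrier_matD(1)[OF v(1)[of "Suc n"]] Ah[of z] by simp
  next
    case (Suc k)
    let ?y = "z - int k * a ^ n"
    have "V n ^\<^sub>m Suc k * Ah (z - int (Suc k) * a ^ n) = V n ^\<^sub>m k * (V n * Ah (?y - a ^ n))"
      using v(1)[of n] Ah[of "?y - a ^ n"] by (simp add: sq algebra_simps(2-))
    also have "\<dots> = V n ^\<^sub>m k * Ah ?y * V (Suc n)"
      unfolding VA using v(1)[of n] v(1)[of "Suc n"] Ah[of ?y] by (simp add: sq)
    also have "\<dots> = Ah z * V (Suc n) ^\<^sub>m Suc k"
      unfolding Suc using v(1)[of n] v(1)[of "Suc n"] Ah[of z] by (simp add: sq)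
    finally show ?case .
  qed
  \<comment> \<open>The integer \<open>a\<close> may be negative while matrix powers take natural
    exponents, so its residue \<open>b\<close> replaces it; it stays odd because \<open>N\<close> is
    even.\<close>
  define b where "b = nat (a mod int N)"
  define q where "q = a div int N"
  have q: "a = int b + q * int N" using N by (simp add: b_def q_def)
  have oddb: "odd b" using a N(2) q by auto
  \<comment> \<open>Since \<open>b * a ^ n\<close> and \<open>a ^ Suc n\<close> agree modulo
    \<open>N\<close>, the power \<open>V n ^\<^sub>m b\<close> performs the shift that belongs to
    the next site.\<close>
  have powb: "V n ^\<^sub>m b * Ah (z - a ^ Suc n) = Ah z * V (Suc n) ^\<^sub>m b" for n z
  proof -
    have "z - int b * a ^ n = z - a ^ Suc n + (q * a ^ n) * int N" using q by (simp add: algebra_simps)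
    thus ?thesis using pow[of n b z] per by metis
  qed
  \<comment> \<open>A total shift by \<open>N * a ^ n\<close> leaves the label unchanged modulo
    \<open>N\<close>.\<close>
  have "\<exists>g. \<forall>n. V n ^\<^sub>m N = g \<cdot>\<^sub>m 1\<^sub>m \<chi>"
  proof (rule intertwiner_chain_scalar[OF inj _ _ L, of _ "\<mu> ^ N"])
    show "V n ^\<^sub>m N \<in> carrier_mat \<chi> \<chi>" for n using v(1) by simp
    show "V n ^\<^sub>m N * A s = A s * V (Suc n) ^\<^sub>m N" if "s < N" for n s
    proof -
      have "int s - int N * a ^ n = int s + (- (a ^ n)) * int N" by simp
      thus ?thesis using pow[of n N "int s"] per As[OF that] by metis
    qed
    show "V L ^\<^sub>m N = \<mu> ^ N \<cdot>\<^sub>m V 0 ^\<^sub>m N" using VL[of 0] pow_mat_smult[OF v(1)] by simp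
  qed (simp add: norm_power mu)
  then obtain g where g: "\<And>n. V n ^\<^sub>m N = g \<cdot>\<^sub>m 1\<^sub>m \<chi>" by blast
  have g0: "g \<noteq> 0"
  proof
    assume "g = 0"
    moreover have "mat_adjoint (V 0 ^\<^sub>m N) * V 0 ^\<^sub>m N = 1\<^sub>m \<chi>" 
      by (rule unitary_matD(3)[OF unitary_mat_pow[OF V]])
    ultimately have "0 \<cdot>\<^sub>m 1\<^sub>m \<chi> = 1 \<cdot>\<^sub>m (1\<^sub>m \<chi> :: complex mat)" 
      by (simp add: g mat_adjoint_smult[OF one_carrier_mat] mat_adjoint_one sm) (auto intro!: eq_matI)
    thus False using smult_one_mat_inject[OF chi] by fastforce
  qed
  \<comment> \<open>A quotient of two matrices performing the same shift moves past the tensor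
    without changing its label.\<close>
  have "\<exists>c. \<forall>n. mat_adjoint (V n ^\<^sub>m b) * V (Suc n) = c \<cdot>\<^sub>m 1\<^sub>m \<chi>"
  proof (rule intertwiner_chain_scalar[OF inj _ _ L, of _ "cnj (\<mu> ^ b) * \<mu>"])
    show "mat_adjoint (V n ^\<^sub>m b) * V (Suc n) \<in> carrier_mat \<chi> \<chi>" for n
      using v(1) by (simp add: square_mat_closed)
    show "mat_adjoint (V n ^\<^sub>m b) * V (Suc n) * A s = A s * (mat_adjoint (V (Suc n) ^\<^sub>m b) * V (Suc (Suc n)))"
      if s: "s < N" for n s
    proof -
      let ?z = "int s + a ^ Suc n"
      have V1: "V (Suc n) * A s = Ah ?z * V (Suc (Suc n))"
        using VA[of "Suc n" ?z] As[OF s] by simp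
      have V2: "mat_adjoint (V n ^\<^sub>m b) * Ah ?z = A s * mat_adjoint (V (Suc n) ^\<^sub>m b)"
        using unitary_mat_flip[OF unitary_mat_pow[OF V] unitary_mat_pow[OF V] _ _ powb[of n ?z]] Ah As[OF s] by simp
      note c = v(1)[of n] v(1)[of "Suc n"] v(1)[of "Suc (Suc n)"] Ah[of ?z] A[rule_format, OF s]
      have "mat_adjoint (V n ^\<^sub>m b) * V (Suc n) * A s = mat_adjoint (V n ^\<^sub>m b) * Ah ?z * V (Suc (Suc n))"
        using c by (simp only: sq V1)
      also have "\<dots> = A s * (mat_adjoint (V (Suc n) ^\<^sub>m b) * V (Suc (Suc n)))"
        unfolding V2 using c by (simp only: sq)
      finally show ?thesis .
    qed
    show "mat_adjoint (V L ^\<^sub>m b) * V (Suc L) = (cnj (\<mu> ^ b) * \<mu>) \<cdot>\<^sub>m (mat_adjoint (V 0 ^\<^sub>m b) * V (Suc 0))"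
      using VL[of 0] VL[of "Suc 0"] v(1)[of 0] v(1)[of "Suc 0"] 
      by (simp add: pow_mat_smult[OF v(1)] mat_adjoint_smult[of _ \<chi> \<chi>] sm square_mat_closed mult.commute)
  qed (simp add: norm_mult norm_power mu)
  then obtain c where c: "mat_adjoint (V 0 ^\<^sub>m b) * V (Suc 0) = c \<cdot>\<^sub>m 1\<^sub>m \<chi>" by blast
  have V1: "V (Suc 0) = c \<cdot>\<^sub>m V 0 ^\<^sub>m b"
  proof -
    have "V (Suc 0) = V 0 ^\<^sub>m b * (mat_adjoint (V 0 ^\<^sub>m b) * V (Suc 0))"
      by (rule unitary_mat_cancel(2)[symmetric, OF unitary_mat_pow[OF V] v(1)])
    thus ?thesis using v(1)[of 0] by (simp add: c sm square_mat_closed right_mult_one_mat[of _ \<chi> \<chi>])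
  qed
  \<comment> \<open>\<open>\<kappa>\<close> compensates the phases collected when the clock symmetry passes the shifts\<close>
  define \<kappa> where "\<kappa> = (\<lambda>n. phase N (- (\<Sum>j<n. a ^ j)))"
  have kS: "\<kappa> n * phase N (- (a ^ n)) = \<kappa> (Suc n)" for n
    by (simp add: \<kappa>_def phase_add[symmetric])
  let ?R = "\<lambda>n. V n * W * V n * mat_adjoint W"
  have Rc: "?R n \<in> carrier_mat \<chi> \<chi>" for n using v(1) w by (simp add: square_mat_closed)
  have "\<exists>l. \<forall>n. \<kappa> n \<cdot>\<^sub>m ?R n = l \<cdot>\<^sub>m 1\<^sub>m \<chi>"
  proof (rule intertwiner_chain_scalar[OF inj _ _ L, of _ "\<kappa> L * \<mu>\<^sup>2"])
    show "\<kappa> n \<cdot>\<^sub>m ?R n \<in> carrier_mat \<chi> \<chi>" for n using Rc by simp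
    show "\<kappa> n \<cdot>\<^sub>m ?R n * A s = A s * (\<kappa> (Suc n) \<cdot>\<^sub>m ?R (Suc n))" if s: "s < N" for n s
    proof -
      define z where "z = int s"
      \<comment> \<open>As \<open>?R n\<close> passes the tensor, the label runs through
        \<open>z\<close>, \<open>- z\<close>, \<open>- z + a ^ n\<close>, \<open>z - a ^ n\<close>
        and back to \<open>z\<close>. The adjoint of \<open>W\<close> contributes \<open>?e\<close>
        in the first move, and \<open>W\<close> contributes \<open>?f\<close> in the third.\<close>
      let ?e = "phase N (- z)" and ?f = "phase N (z - a ^ n)"
      have zs: "A s = Ah z" using As[OF s] by (simp add: z_def)
      note cc = v(1)[of n] v(1)[of "Suc n"] w(1,2) Ah[of z] Ah[of "- z"] Ah[of "- z + a ^ n"] Ah[of "z - a ^ n"]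
      have "W * (?e \<cdot>\<^sub>m Ah (- z)) = (\<eta> \<cdot>\<^sub>m Ah z) * W" using WA[of z] cc by (simp add: sm)
      from unitary_mat_flip[OF W W _ _ this] have "mat_adjoint W * (\<eta> \<cdot>\<^sub>m Ah z) = (?e \<cdot>\<^sub>m Ah (- z)) * mat_adjoint W"
        using cc by simp
      hence 1: "\<eta> \<cdot>\<^sub>m (mat_adjoint W * Ah z) = ?e \<cdot>\<^sub>m (Ah (- z) * mat_adjoint W)" using cc by (simp add: sm)
      have 2: "V n * Ah (- z) = Ah (- z + a ^ n) * V (Suc n)" using VA[of n "- z + a ^ n"] by simp
      have "?f \<cdot>\<^sub>m (phase N (- (z - a ^ n)) \<cdot>\<^sub>m (W * Ah (- (z - a ^ n)))) = ?f \<cdot>\<^sub>m (\<eta> \<cdot>\<^sub>m (Ah (z - a ^ n) * W))"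
        by (simp only: WA)
      hence 3: "W * Ah (- z + a ^ n) = (?f * \<eta>) \<cdot>\<^sub>m (Ah (z - a ^ n) * W)"
        by (simp add: smult_smult_mat one_smult_mat phase_minus[of N "z - a ^ n", simplified])
      have 4: "V n * Ah (z - a ^ n) = Ah z * V (Suc n)" by (rule VA)
      \<comment> \<open>The label cancels, so the remaining phase depends on the site alone and can
        be absorbed into \<open>\<kappa>\<close>.\<close>
      have ef: "?e * ?f = phase N (- (a ^ n))" by (simp add: phase_add[symmetric])
      have "\<eta> \<cdot>\<^sub>m (?R n * Ah z) = V n * W * V n * (\<eta> \<cdot>\<^sub>m (mat_adjoint W * Ah z))"
        using cc by (simp only: sq sm smult_carrier_mat)
      also have "\<dots> = ?e \<cdot>\<^sub>m (V n * W * (V n * Ah (- z)) * mat_adjoint W)"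
        unfolding 1 using cc by (simp only: sq sm smult_carrier_mat)
      also have "\<dots> = ?e \<cdot>\<^sub>m (V n * (W * Ah (- z + a ^ n)) * V (Suc n) * mat_adjoint W)"
        unfolding 2 using cc by (simp only: sq sm smult_carrier_mat)
      also have "\<dots> = (?e * (?f * \<eta>)) \<cdot>\<^sub>m (V n * Ah (z - a ^ n) * W * V (Suc n) * mat_adjoint W)"
        unfolding 3 using cc by (simp only: sq sm smult_carrier_mat)
      also have "\<dots> = (phase N (- (a ^ n)) * \<eta>) \<cdot>\<^sub>m (Ah z * ?R (Suc n))"
        unfolding 4 mult.assoc[symmetric] ef using cc by (simp only: sq sm smult_carrier_mat)
      finally have "(\<kappa> n * cnj \<eta>) \<cdot>\<^sub>m (\<eta> \<cdot>\<^sub>m (?R n * Ah z)) = 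
          (\<kappa> n * cnj \<eta>) \<cdot>\<^sub>m ((phase N (- (a ^ n)) * \<eta>) \<cdot>\<^sub>m (Ah z * ?R (Suc n)))" by simp
      \<comment> \<open>\<open>W\<close> and its adjoint each pass the tensor once, so
        \<open>\<eta>\<close> drops out.\<close>
      moreover have "\<kappa> n * cnj \<eta> * \<eta> = \<kappa> n" "\<kappa> n * cnj \<eta> * (phase N (- (a ^ n)) * \<eta>) = \<kappa> (Suc n)"
        using complex_norm_square[of \<eta>] eta by (simp_all add: kS[symmetric] ac_simps)
      ultimately have "\<kappa> n \<cdot>\<^sub>m (?R n * Ah z) = \<kappa> (Suc n) \<cdot>\<^sub>m (Ah z * ?R (Suc n))"
        by (simp only: smult_smult_mat)
      thus ?thesis using Rc[of n] Rc[of "Suc n"] cc unfolding zs by (simp only: sm)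
    qed
    show "\<kappa> L \<cdot>\<^sub>m ?R L = (\<kappa> L * \<mu>\<^sup>2) \<cdot>\<^sub>m (\<kappa> 0 \<cdot>\<^sub>m ?R 0)"
    proof -
      have "\<kappa> 0 = 1" by (simp add: \<kappa>_def phase_def)
      thus ?thesis using VL[of 0] v(1)[of 0] w 
        by (simp add: sm square_mat_closed power2_eq_square ac_simps)
    qed
  qed (simp add: norm_mult norm_power mu \<kappa>_def)
  then obtain l where l: "\<And>n. \<kappa> n \<cdot>\<^sub>m ?R n = l \<cdot>\<^sub>m 1\<^sub>m \<chi>" by blast
  have VWV: "\<kappa> n \<cdot>\<^sub>m (V n * W * V n) = l \<cdot>\<^sub>m W" for n
  proof -
    have "\<kappa> n \<cdot>\<^sub>m ?R n * W = \<kappa> n \<cdot>\<^sub>m (V n * W * V n * (mat_adjoint W * W))"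
      using v(1)[of n] w(1,2) by (simp only: sq sm)
    also have "\<dots> = \<kappa> n \<cdot>\<^sub>m (V n * W * V n)" using v(1)[of n] w by (simp add: square_mat_closed)
    finally show ?thesis using w(1) by (simp add: l sm)
  qed
  \<comment> \<open>The sum in \<open>\<kappa> (Suc 0)\<close> has the single term
    \<open>a ^ 0 = 1\<close>. This is the source of the primitive root of unity.\<close>
  have k01: "\<kappa> 0 = 1" "\<kappa> (Suc 0) = phase N (- 1)" by (simp_all add: \<kappa>_def phase_def)
  \<comment> \<open>The innermost pair of factors around \<open>W\<close> is removed at each step,
    at the price of one factor \<open>l\<close>.\<close>
  have pVWV: "V 0 ^\<^sub>m k * W * V 0 ^\<^sub>m k = l ^ k \<cdot>\<^sub>m W" for k
  proof (induction k)
    case 0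
    show ?case using w(1) carrier_matD(1)[OF v(1)[of 0]] by (auto intro!: eq_matI)
  next
    case (Suc k)
    have one: "V 0 * W * V 0 = l \<cdot>\<^sub>m W" 
      using VWV[of 0] by (simp only: k01 one_smult_mat)
    have "V 0 ^\<^sub>m Suc k * W * V 0 ^\<^sub>m Suc k = V 0 ^\<^sub>m k * V 0 * W * (V 0 * V 0 ^\<^sub>m k)"
      by (simp only: pow_mat.simps pow_mat_commute[OF v(1)])
    also have "\<dots> = V 0 ^\<^sub>m k * (V 0 * W * V 0) * V 0 ^\<^sub>m k"
      using v(1)[of 0] w(1) by (simp only: sq)
    also have "\<dots> = l \<cdot>\<^sub>m (V 0 ^\<^sub>m k * W * V 0 ^\<^sub>m k)"
      unfolding one using v(1)[of 0] w(1) by (simp only: sq sm smult_carrier_mat)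
    finally show ?case by (simp add: Suc smult_smult_mat)
  qed
  have Winj: "x = y" if "x \<cdot>\<^sub>m W = y \<cdot>\<^sub>m W" for x y
  proof -
    have "x \<cdot>\<^sub>m W * mat_adjoint W = y \<cdot>\<^sub>m W * mat_adjoint W" using that by simp
    hence "x \<cdot>\<^sub>m 1\<^sub>m \<chi> = y \<cdot>\<^sub>m (1\<^sub>m \<chi> :: complex mat)" using w by (simp add: sm)
    thus ?thesis by (rule smult_one_mat_inject[OF chi])
  qed
  have lN: "l ^ N = g\<^sup>2"
  proof -
    have "(g * g) \<cdot>\<^sub>m W = V 0 ^\<^sub>m N * W * V 0 ^\<^sub>m N"
      using w(1) by (simp add: g sm square_mat_closed left_mult_one_mat[of _ \<chi> \<chi>] right_mult_one_mat[of _ \<chi> \<chi>])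
    thus ?thesis using pVWV[of N] Winj by (metis power2_eq_square)
  qed
  \<comment> \<open>The relation at site 1, rewritten at site 0 through
    \<open>V (Suc 0) = c \<cdot>\<^sub>m V 0 ^\<^sub>m b\<close>.\<close>
  have lb: "phase N (- 1) * c\<^sup>2 * l ^ b = l"
  proof -
    have "l \<cdot>\<^sub>m W = phase N (- 1) \<cdot>\<^sub>m ((c \<cdot>\<^sub>m V 0 ^\<^sub>m b) * W * (c \<cdot>\<^sub>m V 0 ^\<^sub>m b))"
      using VWV[of "Suc 0"] by (simp only: k01 V1)
    also have "\<dots> = (phase N (- 1) * c\<^sup>2) \<cdot>\<^sub>m (V 0 ^\<^sub>m b * W * V 0 ^\<^sub>m b)"
      using v(1)[of 0] w(1) by (simp only: sq sm smult_carrier_mat power2_eq_square mult.assoc)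
    also have "\<dots> = (phase N (- 1) * c\<^sup>2 * l ^ b) \<cdot>\<^sub>m W" by (simp only: pVWV smult_smult_mat)
    finally show ?thesis by (intro Winj) simp
  qed
  \<comment> \<open>The N-th power of \<open>V (Suc 0)\<close>, computed directly and through
    \<open>V 0\<close>, gives the same scalar \<open>g\<close>.\<close>
  have gb: "g = c ^ N * g ^ b"
  proof -
    have "V (Suc 0) ^\<^sub>m N = c ^ N \<cdot>\<^sub>m (V 0 ^\<^sub>m b) ^\<^sub>m N"
      unfolding V1 by (rule pow_mat_smult[OF pow_carrier_mat[OF v(1)]])
    also have "(V 0 ^\<^sub>m b) ^\<^sub>m N = (V 0 ^\<^sub>m N) ^\<^sub>m b"
      by (simp only: pow_mat_pow[OF v(1)] mult.commute)
    also have "\<dots> = g ^ b \<cdot>\<^sub>m 1\<^sub>m \<chi>" by (simp only: g pow_mat_smult[OF one_carrier_mat] pow_mat_one)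
    finally have "g \<cdot>\<^sub>m 1\<^sub>m \<chi> = (c ^ N * g ^ b) \<cdot>\<^sub>m (1\<^sub>m \<chi> :: complex mat)" by (simp only: g smult_smult_mat)
    thus ?thesis by (rule smult_one_mat_inject[OF chi])
  qed
  obtain h where h: "N = 2 * h" using N(2) by (elim evenE)
  obtain k where k: "b = 2 * k + 1" using oddb by (elim oddE)
  have "l \<noteq> 0" using lN g0 N(1) by (auto simp: zero_power)
  have cg: "c ^ N * g ^ (2 * k) = 1" using gb g0 by (simp add: k)
  \<comment> \<open>Half of \<open>N\<close> turns the root of unity into -1. As
    \<open>b - 1 = 2 * k\<close>, the power \<open>l ^ (2 * k * h)\<close> is
    \<open>(l ^ N) ^ k\<close>, so \<open>lN\<close> and \<open>cg\<close> evaluate the rest to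
    1.\<close>
  have "phase N (- 1) ^ h = - 1" using N(1) h by (simp add: phase_pow) (simp add: phase_def complex_eq_iff)
  moreover have "phase N (- 1) * (c\<^sup>2 * l ^ (2 * k)) = 1" 
    using lb \<open>l \<noteq> 0\<close> by (simp add: k mult.assoc)
  hence "phase N (- 1) ^ h * ((c\<^sup>2) ^ h * (l ^ (2 * k)) ^ h) = 1" 
    by (metis power_mult_distrib power_one)
  moreover have "(c\<^sup>2) ^ h = c ^ N" by (simp add: h power_mult)
  moreover have "(l ^ (2 * k)) ^ h = (l ^ N) ^ k" by (simp add: h power_mult[symmetric] ac_simps)
  ultimately have "- (c ^ N * (l ^ N) ^ k) = 1" by simp
  hence "- (c ^ N * g ^ (2 * k)) = 1" by (simp add: lN power_mult)
  thus False by (simp add: cg)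
qed

section \<open>Shift and clock symmetries as relabellings\<close>

lemma shift_mat_pow_index:
  assumes "i < N" "j < N"
  shows "(shift_mat N ^\<^sub>m m) $$ (i, j) = (if i = (j + m) mod N then 1 else 0)"
    and "(mat_adjoint (shift_mat N) ^\<^sub>m m) $$ (i, j) = (if j = (i + m) mod N then 1 else 0)"
proof -
  have "\<forall>i<N. \<forall>j<N. (shift_mat N ^\<^sub>m m) $$ (i, j) = (if i = (j + m) mod N then 1 else 0)"
  proof (induction m)
    case (Suc m)
    show ?case
    proof (intro allI impI)
      fix i j assume ij: "i < N" "j < N"
      have "(shift_mat N ^\<^sub>m Suc m) $$ (i, j) = (\<Sum>k<N. (shift_mat N ^\<^sub>m m) $$ (i, k) * shift_mat N $$ (k, j))"
        unfolding pow_mat.simps by (rule mult_mat_index_sum[OF _ site_mat_carrier(1) ij]) simp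
      also have "\<dots> = (\<Sum>k<N. if k = (j + 1) mod N then (if i = (k + m) mod N then 1 else 0) else 0)"
        using Suc ij by (intro sum.cong) (auto simp: shift_mat_def)
      also have "\<dots> = (if i = (j + Suc m) mod N then 1 else 0)"
        using ij by (simp add: mod_add_left_eq)
      finally show "(shift_mat N ^\<^sub>m Suc m) $$ (i, j) = (if i = (j + Suc m) mod N then 1 else 0)" .
    qed
  qed auto
  thus "(shift_mat N ^\<^sub>m m) $$ (i, j) = (if i = (j + m) mod N then 1 else 0)" using assms by blast
  have adj: "mat_adjoint (shift_mat N) $$ (k, j) = (if j = (k + 1) mod N then 1 else 0)" if "k < N" "j < N" for k j
    using that by (simp add: mat_adjoint_index[OF site_mat_carrier(1) that]) (simp add: shift_mat_def)
  have "\<forall>i<N. \<forall>j<N. (mat_adjoint (shift_mat N) ^\<^sub>m m) $$ (i, j) = (if j = (i + m) mod N then 1 else 0)"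
  proof (induction m)
    case (Suc m)
    show ?case
    proof (intro allI impI)
      fix i j assume ij: "i < N" "j < N"
      have "(mat_adjoint (shift_mat N) ^\<^sub>m Suc m) $$ (i, j) = 
          (\<Sum>k<N. (mat_adjoint (shift_mat N) ^\<^sub>m m) $$ (i, k) * mat_adjoint (shift_mat N) $$ (k, j))"
        unfolding pow_mat.simps by (rule mult_mat_index_sum[OF _ mat_adjoint_carrier[OF site_mat_carrier(1)] ij]) simp
      also have "\<dots> = (\<Sum>k<N. if k = (i + m) mod N then (if j = (k + 1) mod N then 1 else 0) else 0)"
        using Suc ij adj by (intro sum.cong) auto
      also have "\<dots> = (if j = (i + Suc m) mod N then 1 else 0)"
        using ij by (simp add: mod_Suc_eq)
      finally show "(mat_adjoint (shift_mat N) ^\<^sub>m Suc m) $$ (i, j) = (if j = (i + Suc m) mod N then 1 else 0)" .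
    qed
  qed auto
  thus "(mat_adjoint (shift_mat N) ^\<^sub>m m) $$ (i, j) = (if j = (i + m) mod N then 1 else 0)" using assms by blast
qed

text \<open>The column of the nonzero entry in row \<open>s\<close> of the \<open>k\<close>-th shift
  power: the label from which the amplitude at \<open>s\<close> is taken.\<close>

definition shift_label :: "nat \<Rightarrow> int \<Rightarrow> nat \<Rightarrow> nat" where
  "shift_label N k s = nat ((int s - k) mod int N)"

lemma unitary_powi_shift_index:
  assumes ij: "i < N" "j < N"
  shows "unitary_powi (shift_mat N) k $$ (i, j) = (if j = shift_label N k i then 1 else 0)"
proof -
  have eq: "i = (j + m) mod N \<longleftrightarrow> j = shift_label N (int m) i" if "i < N" "j < N" for i j m
  proof -
    have "i = (j + m) mod N \<longleftrightarrow> int i = (int j + int m) mod int N"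
      by (metis of_nat_add of_nat_eq_iff of_nat_mod)
    also have "\<dots> \<longleftrightarrow> int i mod int N = (int j + int m) mod int N" using that by simp
    also have "\<dots> \<longleftrightarrow> (int i - int m) mod int N = int j mod int N"
      by (metis add_diff_cancel_right' diff_add_cancel mod_add_left_eq mod_diff_left_eq)
    also have "\<dots> \<longleftrightarrow> j = shift_label N (int m) i"
      using that by (auto simp: shift_label_def)
    finally show ?thesis .
  qed
  have eq': "j = (i + m) mod N \<longleftrightarrow> j = shift_label N (- int m) i" if "i < N" "j < N" for i j m
  proof -
    have "shift_label N (- int m) i = (i + m) mod N"
      by (simp add: shift_label_def nat_mod_distrib nat_add_distrib)
    thus ?thesis by simp
  qed
  show ?thesis
  proof (cases "k \<ge> 0")
    case True
    thus ?thesis using ij eq[OF ij, of "nat k"] by (simp add: unitary_powi_def shift_mat_pow_index)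
  next
    case False
    thus ?thesis using ij eq'[OF ij, of "nat (- k)"] by (simp add: unitary_powi_def shift_mat_pow_index)
  qed
qed

lemma bij_betw_shift_label:
  assumes "N > 0"
  shows "bij_betw (shift_label N k) {..<N} {..<N}"
proof (rule bij_betw_byWitness[of _ "shift_label N (- k)"])
  have lt: "shift_label N k s < N" for k s using assms by (simp add: shift_label_def nat_less_iff)
  have inv: "shift_label N (- k) (shift_label N k s) = s" if "s < N" for k s
    using that assms by (simp add: shift_label_def mod_simps)
  show "\<forall>s\<in>{..<N}. shift_label N (- k) (shift_label N k s) = s" using inv by simp
  show "\<forall>s\<in>{..<N}. shift_label N k (shift_label N (- k) s) = s" using inv[of _ "- k"] by simp
qed (use assms in \<open>auto simp: shift_label_def nat_less_iff\<close>)

text \<open>Written with an integer remainder to match \<open>shift_label\<close> and the periodic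
  integer labels of the tensor.\<close>

definition neg_label :: "nat \<Rightarrow> nat \<Rightarrow> nat" where
  "neg_label N s = nat ((- int s) mod int N)"

lemma neg_label_eq: "s < N \<Longrightarrow> neg_label N s = (N - s) mod N"
  by (cases "s = 0") (auto simp: neg_label_def zmod_zminus1_eq_if nat_diff_distrib)

lemma phase_mod: "N > 0 \<Longrightarrow> phase N (z mod int N) = phase N z"
proof -
  assume N: "N > 0"
  have "phase N (int N * (z div int N)) = 1"
    using N cis_multiple_2pi[of "of_int (z div int N)"] by (simp add: phase_def mult.assoc)
  thus ?thesis using phase_add[of N "int N * (z div int N)" "z mod int N"] by simp
qed

text \<open>The clock acts before charge conjugation, so its phase is that of the column label, the
  negative of \<open>i\<close>.\<close>

lemma charge_clock_index:
  assumes ij: "i < N" "j < N"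
  shows "(charge_mat N * clock_mat N) $$ (i, j) = (if j = neg_label N i then phase N (- int i) else 0)"
proof -
  have m: "(N - i) mod N < N" using ij by simp
  have "phase N (- int i) = phase N (int ((N - i) mod N))"
    using ij phase_mod[of N "- int i"] phase_mod[of N "int (N - i)"] 
    by (metis neg_label_def neg_label_eq nat_0_le mod_int_pos_iff nat_int of_nat_0_less_iff gr_implies_not0 neq0_conv)
  thus ?thesis
    unfolding mult_charge_index(2)[OF site_mat_carrier(2) ij] neg_label_eq[OF ij(1)]
    using ij m by (auto simp: clock_mat_def phase_def)
qed

lemma bij_betw_neg_label:
  assumes "N > 0"
  shows "bij_betw (neg_label N) {..<N} {..<N}"
proof (rule bij_betw_byWitness[of _ "neg_label N"])
  have "neg_label N (neg_label N s) = s" if "s < N" for s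
    using that assms by (simp add: neg_label_def mod_simps)
  thus "\<forall>s\<in>{..<N}. neg_label N (neg_label N s) = s" by simp
  thus "\<forall>s\<in>{..<N}. neg_label N (neg_label N s) = s" .
qed (use assms in \<open>auto simp: neg_label_def nat_less_iff\<close>)

section \<open>From eigenstates to an identity between amplitudes\<close>

lemma periodic_mult:
  fixes f :: "nat \<Rightarrow> 'a"
  assumes "\<And>n. f (n + L) = f n"
  shows "f (b * L + j) = f j"
proof (induction b)
  case (Suc b)
  thus ?case using assms[of "b * L + j"] by (simp add: ac_simps)
qed simp

text \<open>Periodicity lets one sequence of phases and relabellings, indexed by the absolute
  position \<open>b * L + j\<close>, describe all blocks, so the tensor power is again
  monomial.\<close>

lemma eigenstate_tensor_power_monomial:
  assumes e: "eigenstate d (m * L) (tensor_power L m (site_tensor Os)) \<psi>" and len: "length Os = L"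
    and pi: "\<forall>n. \<forall>x<d. \<pi> n x < d" 
    and Os: "\<And>j x y. j < L \<Longrightarrow> x < d \<Longrightarrow> y < d \<Longrightarrow> (Os ! j) $$ (x, y) = (if y = \<pi> j x then p j x else 0)"
    and per: "\<And>n. p (n + L) = p n" "\<And>n. \<pi> (n + L) = \<pi> n"
  shows "\<exists>\<theta>::real. \<forall>s\<in>configs d (m * L). (\<Prod>n<m * L. p n (s ! n)) * \<psi> (relabel \<pi> s) = cis \<theta> * \<psi> s"
proof -
  let ?K = "tensor_power L m (site_tensor Os)"
  have K: "?K s t = (\<Prod>n<m * L. if t ! n = \<pi> n (s ! n) then p n (s ! n) else 0)"
    if s: "s \<in> configs d (m * L)" and t: "t \<in> configs d (m * L)" for s t
  proof -
    let ?f = "\<lambda>n. if t ! n = \<pi> n (s ! n) then p n (s ! n) else 0"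
    have st: "length s = m * L" "length t = m * L" "\<And>n. n < m * L \<Longrightarrow> s ! n < d" "\<And>n. n < m * L \<Longrightarrow> t ! n < d"
      using s t nth_mem unfolding configs_def by (fastforce simp: subset_iff)+
    have "?K s t = (\<Prod>b<m. \<Prod>j<L. ?f (b * L + j))"
      unfolding tensor_power_def site_tensor_def len
    proof (intro prod.cong[OF refl])
      fix b j assume "b \<in> {..<m}" "j \<in> {..<L}"
      hence bj: "b < m" "j < L" by auto
      have "b * L + j < Suc b * L" using bj by simp
      also have "\<dots> \<le> m * L" using bj by (intro mult_right_mono) auto
      finally have lt: "b * L + j < m * L" .
      show "(Os ! j) $$ (take L (drop (b * L) s) ! j, take L (drop (b * L) t) ! j) = ?f (b * L + j)"
        using bj lt st Os[OF bj(2) st(3)[OF lt] st(4)[OF lt]] 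
        by (simp add: periodic_mult[of p L, OF per(1)] periodic_mult[of \<pi> L, OF per(2)])
    qed
    also have "\<dots> = (\<Prod>b<m. prod ?f {b * L..<b * L + L})"
    proof (rule prod.cong[OF refl])
      fix b
      show "(\<Prod>j<L. ?f (b * L + j)) = prod ?f {b * L..<b * L + L}"
        by (rule prod.reindex_bij_witness[of _ "\<lambda>n. n - b * L" "\<lambda>j. b * L + j"]) auto
    qed
    also have "\<dots> = prod ?f {..<m * L}" by (rule prod.nat_group)
    finally show ?thesis .
  qed
  obtain \<theta> :: real where th: "\<forall>s\<in>configs d (m * L). apply_op d (m * L) ?K \<psi> s = cis \<theta> * \<psi> s"
    using e unfolding eigenstate_def by blast
  have "(\<Prod>n<m * L. p n (s ! n)) * \<psi> (relabel \<pi> s) = cis \<theta> * \<psi> s" if s: "s \<in> configs d (m * L)" for s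
  proof -
    have "apply_op d (m * L) ?K \<psi> s = (\<Prod>n<m * L. p n (s ! n)) * \<psi> (relabel \<pi> s)"
      by (rule apply_op_monomial[OF s pi]) (rule K[OF s])
    thus ?thesis using th s by metis
  qed
  thus ?thesis by blast
qed

theorem mainTheorem6:
  fixes N L :: nat and a :: int
  assumes "N \<ge> 2" and "even N"
    and "coprime a (int N)"
    and "L \<ge> 1" and "[a ^ L = 1] (mod int N)"
  shows "\<not> (\<exists>\<chi> A. left_canonical_injective N \<chi> A \<and>
           (\<forall>m\<ge>1. eigenstate N (m * L) (tensor_power L m (U_x N L a)) (mps \<chi> A) \<and>
                   eigenstate N (m * L) (tensor_power L m (U_c N L)) (mps \<chi> A)))"
proof
  assume "\<exists>\<chi> A. left_canonical_injective N \<chi> A \<and>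
           (\<forall>m\<ge>1. eigenstate N (m * L) (tensor_power L m (U_x N L a)) (mps \<chi> A) \<and>
                   eigenstate N (m * L) (tensor_power L m (U_c N L)) (mps \<chi> A))"
  then obtain \<chi> A where inj: "left_canonical_injective N \<chi> A"
    and ex: "\<And>m. m \<ge> 1 \<Longrightarrow> eigenstate N (m * L) (tensor_power L m (U_x N L a)) (mps \<chi> A)"
    and ec: "\<And>m. m \<ge> 1 \<Longrightarrow> eigenstate N (m * L) (tensor_power L m (U_c N L)) (mps \<chi> A)"
    by blast
  have N: "N > 0" using assms(1) by simp
  have A: "\<forall>s<N. A s \<in> carrier_mat \<chi> \<chi>" using inj by (auto simp: left_canonical_injective_def)
  have odd: "odd a"
    using coprime_common_divisor[OF assms(3), of 2] assms(2) by auto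

  define \<pi> where "\<pi> = (\<lambda>n. shift_label N (a ^ n))"
  \<comment> \<open>Here \<open>a ^ L\<close> being 1 modulo \<open>N\<close> enters: the shift
    exponents repeat after \<open>L\<close> sites, also across block boundaries.\<close>
  have perx: "\<pi> (n + L) = \<pi> n" for n
  proof
    fix s
    have "[a ^ n * a ^ L = a ^ n * 1] (mod int N)" by (intro cong_mult cong_refl assms(5))
    hence "[int s - a ^ (n + L) = int s - a ^ n] (mod int N)" by (intro cong_diff cong_refl) (simp add: power_add)
    thus "\<pi> (n + L) s = \<pi> n s" by (simp add: \<pi>_def shift_label_def cong_def)
  qed
  have bijx: "bij_betw (\<pi> n) {..<N} {..<N}" for n unfolding \<pi>_def by (rule bij_betw_shift_label[OF N])
  have symx: "\<exists>\<theta>::real. \<forall>s\<in>configs N (m * 1 * L). 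
      (\<Prod>n<m * 1 * L. (\<lambda>_ _. 1) n (s ! n)) * mps \<chi> A (relabel \<pi> s) = cis \<theta> * mps \<chi> A s" if "m \<ge> 1" for m
  proof -
    let ?Os = "map (\<lambda>j. unitary_powi (shift_mat N) (a ^ (j - 1))) [1..<L + 1]"
    have len: "length ?Os = L" by simp
    \<comment> \<open>List position \<open>j\<close> holds site \<open>j + 1\<close>, so the
      exponent \<open>a ^ (j - 1)\<close> of the one-based site number becomes
      \<open>a ^ j\<close>.\<close>
    have nth: "(?Os ! j) $$ (x, y) = (if y = \<pi> j x then (\<lambda>_ _. 1) j x else 0)" 
      if "j < L" "x < N" "y < N" for j x y
      using that by (simp add: \<pi>_def unitary_powi_shift_index nth_map_upt del: upt_Suc)
    show ?thesis
      using eigenstate_tensor_power_monomial[OF ex[OF that, unfolded U_x_def] len, where \<pi> = \<pi> and p = "\<lambda>_ _. 1"]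
        bij_betwE[OF bijx] perx nth by simp
  qed
  obtain \<mu> V where mu: "cmod \<mu> = 1" and V: "\<And>n. V n \<in> carrier_mat \<chi> \<chi>" 
    "\<And>n. mat_adjoint (V n) * V n = 1\<^sub>m \<chi>" "\<And>n. V n * mat_adjoint (V n) = 1\<^sub>m \<chi>"
    and VL: "\<And>n. V (n + L) = \<mu> \<cdot>\<^sub>m V n" 
    and VA: "\<And>n s. s < N \<Longrightarrow> 1 \<cdot>\<^sub>m (V n * A (\<pi> n s)) = A s * V (Suc n)"
    using symmetric_mps_virtual_unitaries[where p = "\<lambda>_ _. 1" and \<pi> = \<pi>, OF inj bijx _ assms(4) order_refl _ perx symx]
    by (auto simp del: mult_1_right)

  define \<sigma> where "\<sigma> = (\<lambda>n::nat. neg_label N)"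
  define p where "p = (\<lambda>(n::nat) s. phase N (- int s))"
  have bijc: "bij_betw (\<sigma> n) {..<N} {..<N}" for n unfolding \<sigma>_def by (rule bij_betw_neg_label[OF N])
  have symc: "\<exists>\<theta>::real. \<forall>s\<in>configs N (m * L * 1). 
      (\<Prod>n<m * L * 1. p n (s ! n)) * mps \<chi> A (relabel \<sigma> s) = cis \<theta> * mps \<chi> A s" if "m \<ge> 1" for m
  proof -
    have nth: "(replicate L (charge_mat N * clock_mat N) ! j) $$ (x, y) = (if y = \<sigma> j x then p j x else 0)" 
      if "j < L" "x < N" "y < N" for j x y
      using that by (simp add: \<sigma>_def p_def charge_clock_index del: index_mult_mat)
    show ?thesis
      using eigenstate_tensor_power_monomial[OF ec[OF that, unfolded U_c_def] length_replicate, where \<pi> = \<sigma> and p = p]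
        bij_betwE[OF bijc] nth by (simp add: \<sigma>_def p_def)
  qed
  have pc: "\<forall>s<N. cmod (p n s) = 1" for n by (simp add: p_def)
  have perc: "p (n + 1) = p n" "\<sigma> (n + 1) = \<sigma> n" for n by (simp_all add: p_def \<sigma>_def)
  \<comment> \<open>Period one with length unit \<open>L\<close>: the eigenstate condition is known
    only for multiples of \<open>L\<close>, yet consecutive \<open>W n\<close> differ just by the
    phase \<open>\<eta>\<close>, so \<open>W 0\<close> alone represents the symmetry.\<close>
  obtain \<eta> W where eta: "cmod \<eta> = 1" and W: "\<And>n. W n \<in> carrier_mat \<chi> \<chi>" 
    "\<And>n. mat_adjoint (W n) * W n = 1\<^sub>m \<chi>" "\<And>n. W n * mat_adjoint (W n) = 1\<^sub>m \<chi>"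
    and W1: "\<And>n. W (n + 1) = \<eta> \<cdot>\<^sub>m W n" 
    and WA: "\<And>n s. s < N \<Longrightarrow> p n s \<cdot>\<^sub>m (W n * A (\<sigma> n s)) = A s * W (Suc n)"
    using symmetric_mps_virtual_unitaries[where p = p and \<pi> = \<sigma>, OF inj bijc pc order_refl assms(4) perc symc]
    by blast

  let ?Ah = "\<lambda>z. A (nat (z mod int N))"
  have z: "nat (z mod int N) < N" "int (nat (z mod int N)) = z mod int N" for z using N by (simp_all add: nat_less_iff)
  show False
  proof (rule clock_shift_anomaly[OF N assms(2) odd inj assms(4) mu eta, of V "W 0"])
    show "unitary_mat \<chi> (V n)" for n using V by (simp add: unitary_mat_def)
    show "unitary_mat \<chi> (W 0)" using W by (simp add: unitary_mat_def)
    show "V (n + L) = \<mu> \<cdot>\<^sub>m V n" for n by (rule VL)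
    show "V n * ?Ah (y - a ^ n) = ?Ah y * V (Suc n)" for n y
    proof -
      have "\<pi> n (nat (y mod int N)) = nat ((y - a ^ n) mod int N)"
        unfolding \<pi>_def shift_label_def z(2) by (simp only: mod_diff_left_eq)
      thus ?thesis using VA[OF z(1), of n y] by (simp add: one_smult_mat)
    qed
    show "phase N (- y) \<cdot>\<^sub>m (W 0 * ?Ah (- y)) = \<eta> \<cdot>\<^sub>m (?Ah y * W 0)" for y
    proof -
      have "\<sigma> 0 (nat (y mod int N)) = nat ((- y) mod int N)"
        unfolding \<sigma>_def neg_label_def z(2) by (simp only: mod_minus_eq)
      moreover have "p 0 (nat (y mod int N)) = phase N (- y)"
        using phase_mod[OF N, of "- (y mod int N)"] phase_mod[OF N, of "- y"]
        unfolding p_def z(2) by (simp only: mod_minus_eq)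
      moreover have "?Ah y * (\<eta> \<cdot>\<^sub>m W 0) = \<eta> \<cdot>\<^sub>m (?Ah y * W 0)"
        using mult_smult_distrib[OF A[rule_format, OF z(1)] W(1)] .
      ultimately show ?thesis using WA[OF z(1), of 0 y] W1[of 0] by simp
    qed
  qed
qed

end
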